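(* Assume the semiparametric model satisfies the standing assumptions A1--A7 of the context. Assume also that for every random sequence $\tilde\theta_n\in\Theta$, $\Delta_n(\tilde\theta_n)=o_P(1)$ implies $\tilde\theta_n=\theta_0+o_P(1)$. If $\rho$ is a proper prior density on $\Theta$ with $\rho(\theta_0)>0$ and $\rho(\cdot)$ has a continuous and finite first-order derivative in some neighborhood of $\theta_0$, then $$\sup_{\xi\in\mathbb R}\Big|\tilde P_{\theta|\tilde X}\big(\sqrt n(\theta-\hat\theta_n)\tilde I_0^{1/2}\le\xi\big)-\Phi(\xi)\Big|=O_P(n^{-1/2}),$$ where $\Phi$ is the standard normal cumulative distribution function.
   Context: Setting. The data $X_1,\dots,X_n$ are i.i.d. with values in a sample space $\mathcal X$, from a semiparametric model $\{p_{\theta,\eta}:\theta\in\Theta,\eta\in\mathcal H\}$ with $\Theta\subset\mathbb R$ and $\mathcal H$ an arbitrary (typically infinite-dimensional) set equipped with a norm $\|\cdot\|$; $(\theta_0,\eta_0)$ is the true parameter and $P=P_{\theta_0,\eta_0}$ the true law. $\mathrm{lik}(\theta,\eta)(x)$ is the likelihood of one observation, and $\mathrm{lik}_n(\theta,\eta)=\prod_{i=1}^n\mathrm{lik}(\theta,\eta)(X_i)$. The profile likelihood is $pl_n(\theta)=\sup_\eta \mathrm{lik}_n(\theta,\eta)$; $\hat\eta_\theta=\arg\max_\eta \mathrm{lik}_n(\theta,\eta)$; $(\hat\theta_n,\hat\eta_n)$, $\hat\eta_n=\hat\eta_{\hat\theta_n}$, is the maximum likelihood estimator for the full likelihood. Operator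 notation: $Pf=\int f\,dP$, $\mathbb P_nf=n^{-1}\sum_{i=1}^n f(X_i)$, $\mathbb G_nf=n^{-1/2}\sum_{i=1}^n(f(X_i)-Pf)$. Efficient score: $\tilde\ell_{\theta,\eta}=\dot\ell_{\theta,\eta}-\Pi_{\theta,\eta}\dot\ell_{\theta,\eta}$, where $\dot\ell_{\theta,\eta}$ is the score for $\theta$ (partial derivative of the log-likelihood in $\theta$, $\eta$ fixed) and $\Pi_{\theta,\eta}$ is the $L_2(P_{\theta,\eta})$-projection onto the closed linear span of the score functions for $\eta$. $\tilde I_{\theta,\eta}$ is the variance of $\tilde\ell_{\theta,\eta}$. Write $\tilde\ell_0=\tilde\ell_{\theta_0,\eta_0}$, $\tilde I_0=\tilde I_{\theta_0,\eta_0}=P\tilde\ell_0^2$. Least favorable submodel: a map $t\mapsto\eta_t(\theta,\eta)$ from a neighborhood of $\theta$ into $\mathcal H$ is given, and $\ell(t,\theta,\eta)(x)=\log\mathrm{lik}(t,\eta_t(\theta,\eta))(x)$. $\dot\ell,\ddot\ell,\ell^{(3)}$ denote the first, second and third derivatives of $\ell(t,\theta,\eta)$ in $t$; $\ell_{t,\theta}(t,\theta,\eta)$ is the derivative of $\dot\ell(t,\theta,\eta)$ in $\theta$. $\dot\ell_0=\dot\ell(\theta_0,\theta_0,\eta_0)$, $\ddot\ell_0=\ddot\ell(\theta_0,\theta_0,\eta_0)$. The submodel is least favorable at $(\theta_0,\eta_0)$, i.e. $\dot\ell_0=\tilde\ell_0$. Standing assumptions: A1. $\Theta\subset\mathbb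 R$ is compact and $\theta_0$ is an interior point of $\Theta$. A2. $\eta_\theta(\theta,\eta)=\eta$ for all $(\theta,\eta)\in\Theta\times\mathcal H$. A3. $\|\hat\eta_{\tilde\theta_n}-\eta_0\|=O_P(n^{-1/2}+|\tilde\theta_n-\theta_0|)$ whenever $\tilde\theta_n=\theta_0+o_P(1)$. A4. The maps $(t,\theta,\eta)\mapsto\frac{\partial^{l+m}}{\partial t^l\partial\theta^m}\ell(t,\theta,\eta)$ have integrable envelope functions in $L_1(P)$ in some neighborhood of $(\theta_0,\theta_0,\eta_0)$ for $(l,m)=(0,0),(1,0),(2,0),(3,0),(1,1),(1,2),(2,1)$. This smoothness is taken to imply $-P\dot\ell_0^2=P\ddot\ell_0$ and $\frac{\partial}{\partial\theta}P\dot\ell(\theta_0,\theta,\eta_0)|_{\theta=\theta_0}=0$. A5. There is a neighborhood $V$ of $(\theta_0,\theta_0,\eta_0)$ in $\Theta\times\Theta\times\mathcal H$ such that $\{\ddot\ell(t,\theta,\eta):(t,\theta,\eta)\in V\}$ and $\{\ell_{t,\theta}(t,\theta,\eta):(t,\theta,\eta)\in V\}$ are $P$-Donsker and $\{\ell^{(3)}(t,\theta,\eta):(t,\theta,\eta)\in V\}$ is $P$-Glivenko--Cantelli. A6. For all $\eta$ in some neighborhood of $\eta_0$: $\mathbb G_n(\dot\ell(\theta_0,\theta_0,\eta)-\dot\ell_0)=O_P(\|\eta-\eta_0\|)$; $P\ddot\ell(\theta_0,\theta_0,\eta)-P\ddot\ell(\theta_0,\theta_0,\eta_0)=O(\|\eta-\eta_0\|)$;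 $P\ell_{t,\theta}(\theta_0,\theta_0,\eta)-P\ell_{t,\theta}(\theta_0,\theta_0,\eta_0)=O(\|\eta-\eta_0\|)$; $P\dot\ell(\theta_0,\theta_0,\eta)=O(\|\eta-\eta_0\|^2)$. A7. $\tilde I_0>0$. Posterior profile distribution: $\tilde P_{\theta|\tilde X}$ is the distribution of $\theta$ with density proportional to $\rho(\theta)pl_n(\theta)$, given the data $\tilde X=(X_1,\dots,X_n)$. Also $\Delta_n(\theta)=n^{-1}\{\log pl_n(\theta)-\log pl_n(\hat\theta_n)\}$. *)

theory Defs
  imports "HOL-Probability.Probability"
begin

text \<open>Suprema over the nuisance parameter, argmax selections and empirical processes indexed by
  functions need not be measurable, so stochastic statements are expressed by outer probability and
  outer expectation, as usual in empirical process theory. For measurable maps these are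
  the ordinary notions.\<close>

definition outer_prob :: "'w measure \<Rightarrow> 'w set \<Rightarrow> real" where
  "outer_prob M A = (INF B\<in>{B\<in>sets M. A \<subseteq> B}. measure M B)"

definition outer_expectation :: "'w measure \<Rightarrow> ('w \<Rightarrow> real) \<Rightarrow> real" where
  "outer_expectation M Z = Inf {integral\<^sup>L M U |U. integrable M U \<and> (\<forall>\<omega>\<in>space M. Z \<omega> \<le> U \<omega>)}"

text \<open>The values are extended reals because \<open>\<Delta>\<^sub>n\<close> below equals \<open>-\<infinity>\<close> where the profile
  likelihood vanishes.\<close>

definition o_P_one :: "'w measure \<Rightarrow> (nat \<Rightarrow> 'w \<Rightarrow> ereal) \<Rightarrow> bool" where
  "o_P_one M Y \<longleftrightarrow>
     (\<forall>\<epsilon>>0. (\<lambda>n. outer_prob M {\<omega>\<in>space M. \<bar>Y n \<omega>\<bar> > ereal \<epsilon>}) \<longlonglongrightarrow> 0)"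

text \<open>The rate \<open>R\<close> may itself be random.\<close>

definition O_P :: "'w measure \<Rightarrow> (nat \<Rightarrow> 'w \<Rightarrow> real) \<Rightarrow> (nat \<Rightarrow> 'w \<Rightarrow> real) \<Rightarrow> bool" where
  "O_P M Y R \<longleftrightarrow>
     (\<forall>\<epsilon>>0. \<exists>C. \<forall>\<^sub>F n in sequentially.
        outer_prob M {\<omega>\<in>space M. \<bar>Y n \<omega>\<bar> > C * R n \<omega>} \<le> \<epsilon>)"

text \<open>Uniform version: one exceptional event serves all \<open>s \<in> S\<close>, so that a random index may be
  substituted for \<open>s\<close>.\<close>

definition O_P_uniformly ::
  "'w measure \<Rightarrow> 's set \<Rightarrow> (nat \<Rightarrow> 's \<Rightarrow> 'w \<Rightarrow> real) \<Rightarrow> (nat \<Rightarrow> 's \<Rightarrow> 'w \<Rightarrow> real) \<Rightarrow> bool" where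
  "O_P_uniformly M S Y R \<longleftrightarrow>
     (\<forall>\<epsilon>>0. \<exists>C. \<forall>\<^sub>F n in sequentially.
        outer_prob M {\<omega>\<in>space M. \<exists>s\<in>S. \<bar>Y n s \<omega>\<bar> > C * R n s \<omega>} \<le> \<epsilon>)"

text \<open>Throughout, \<open>d :: nat \<Rightarrow> 'x\<close> is an infinite sample path; the first \<open>n\<close> observations are
  \<open>d 0, \<dots>, d (n - 1)\<close>.\<close>

definition emp_mean :: "(nat \<Rightarrow> 'x) \<Rightarrow> nat \<Rightarrow> ('x \<Rightarrow> real) \<Rightarrow> real" where
  "emp_mean d n f = (\<Sum>i<n. f (d i)) / real n"

definition emp_process :: "'x measure \<Rightarrow> (nat \<Rightarrow> 'x) \<Rightarrow> nat \<Rightarrow> ('x \<Rightarrow> real) \<Rightarrow> real" where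
  "emp_process P d n f = (\<Sum>i<n. f (d i) - (\<integral>x. f x \<partial>P)) / sqrt (real n)"

definition iid_sample :: "'w measure \<Rightarrow> ('w \<Rightarrow> nat \<Rightarrow> 'x) \<Rightarrow> 'x measure \<Rightarrow> bool" where
  "iid_sample M X P \<longleftrightarrow>
     prob_space M \<and>
     prob_space.indep_vars M (\<lambda>_. P) (\<lambda>i \<omega>. X \<omega> i) UNIV \<and>
     (\<forall>i. distr M P (\<lambda>\<omega>. X \<omega> i) = P)"

definition ell_infty :: "('x \<Rightarrow> real) set \<Rightarrow> (('x \<Rightarrow> real) \<Rightarrow> real) metric" where
  "ell_infty F = funspace F euclidean_metric"

definition tight_borel_law :: "'z metric \<Rightarrow> 'z measure \<Rightarrow> bool" where
  "tight_borel_law m L \<longleftrightarrow>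
     prob_space L \<and> space L = mspace m \<and>
     sets L = sigma_sets (mspace m) {U. openin (mtopology_of m) U} \<and>
     (\<forall>\<epsilon>>0. \<exists>K. compactin (mtopology_of m) K \<and> K \<in> sets L \<and> measure L K \<ge> 1 - \<epsilon>)"

text \<open>Donsker property: weak convergence (in the sense of outer expectations, the sample being the
  coordinate projections of the infinite product space) of the empirical process to a tight Borel
  law on \<open>\<ell>\<^sup>\<infinity>(F)\<close>. The paths lie in \<open>\<ell>\<^sup>\<infinity>(F)\<close> almost surely; since \<open>h\<close> is bounded on
  its whole type, its values at the exceptional paths do not matter.\<close>

definition P_Donsker :: "'x measure \<Rightarrow> ('x \<Rightarrow> real) set \<Rightarrow> bool" where
  "P_Donsker P F \<longleftrightarrow>
     (\<forall>f\<in>F. integrable P f) \<and>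
     (AE x in P. bounded ((\<lambda>f. f x - (\<integral>y. f y \<partial>P)) ` F)) \<and>
     (\<exists>L. tight_borel_law (ell_infty F) L \<and>
        (\<forall>h. continuous_map (mtopology_of (ell_infty F)) euclideanreal h \<and> bounded (range h) \<longrightarrow>
           (\<lambda>n. outer_expectation (PiM UNIV (\<lambda>_::nat. P)) (\<lambda>d. h (restrict (emp_process P d n) F)))
             \<longlonglongrightarrow> (\<integral>z. h z \<partial>L)))"

text \<open>Outer almost sure convergence: \<open>D n\<close> is a measurable majorant of the supremum over \<open>F\<close>.\<close>

definition P_Glivenko_Cantelli :: "'x measure \<Rightarrow> ('x \<Rightarrow> real) set \<Rightarrow> bool" where
  "P_Glivenko_Cantelli P F \<longleftrightarrow>
     (\<forall>f\<in>F. integrable P f) \<and>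
     (\<exists>D :: nat \<Rightarrow> (nat \<Rightarrow> 'x) \<Rightarrow> ennreal.
        (\<forall>n. D n \<in> borel_measurable (PiM UNIV (\<lambda>_::nat. P))) \<and>
        (AE d in PiM UNIV (\<lambda>_::nat. P).
           (\<forall>n. \<forall>f\<in>F. ennreal \<bar>emp_mean d n f - (\<integral>x. f x \<partial>P)\<bar> \<le> D n d) \<and>
           (\<lambda>n. D n d) \<longlonglongrightarrow> 0))"

text \<open>\<open>lik \<theta> \<eta>\<close> is the density of \<open>P\<^bsub>\<theta>,\<eta>\<^esub>\<close> with respect to a fixed dominating measure
  \<open>\<mu>\<close>. The nuisance parameters form an arbitrary subset \<open>H\<close> of a normed space.\<close>

definition model_law :: "'x measure \<Rightarrow> (real \<Rightarrow> 'h \<Rightarrow> 'x \<Rightarrow> real) \<Rightarrow> real \<Rightarrow> 'h \<Rightarrow> 'x measure" where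
  "model_law \<mu> lik \<theta> \<eta> = density \<mu> (\<lambda>x. ennreal (lik \<theta> \<eta> x))"

definition semiparametric_model ::
  "'x measure \<Rightarrow> (real \<Rightarrow> 'h \<Rightarrow> 'x \<Rightarrow> real) \<Rightarrow> real set \<Rightarrow> 'h set \<Rightarrow> bool" where
  "semiparametric_model \<mu> lik \<Theta> H \<longleftrightarrow>
     sigma_finite_measure \<mu> \<and>
     (\<forall>\<theta>\<in>\<Theta>. \<forall>\<eta>\<in>H. lik \<theta> \<eta> \<in> borel_measurable \<mu> \<and> (\<forall>x\<in>space \<mu>. 0 \<le> lik \<theta> \<eta> x) \<and>
        prob_space (model_law \<mu> lik \<theta> \<eta>))"

definition L2 :: "'x measure \<Rightarrow> ('x \<Rightarrow> real) set" where
  "L2 P = {f \<in> borel_measurable P. integrable P (\<lambda>x. (f x)\<^sup>2)}"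

definition closed_linear_span :: "'x measure \<Rightarrow> ('x \<Rightarrow> real) set \<Rightarrow> ('x \<Rightarrow> real) set" where
  "closed_linear_span P S = {g \<in> L2 P. \<forall>\<epsilon>>0. \<exists>(k::nat) c s.
     (\<forall>i<k. s i \<in> S) \<and> (\<integral>x. (g x - (\<Sum>i<k. c i * s i x))\<^sup>2 \<partial>P) < \<epsilon>}"

definition is_L2_projection ::
  "'x measure \<Rightarrow> ('x \<Rightarrow> real) set \<Rightarrow> ('x \<Rightarrow> real) \<Rightarrow> ('x \<Rightarrow> real) \<Rightarrow> bool" where
  "is_L2_projection P V f g \<longleftrightarrow> g \<in> V \<and> (\<forall>h\<in>V. (\<integral>x. (f x - g x) * h x \<partial>P) = 0)"

definition L2_projection ::
  "'x measure \<Rightarrow> ('x \<Rightarrow> real) set \<Rightarrow> ('x \<Rightarrow> real) \<Rightarrow> 'x \<Rightarrow> real" where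
  "L2_projection P V f = (SOME g. is_L2_projection P V f g)"

definition theta_score :: "(real \<Rightarrow> 'h \<Rightarrow> 'x \<Rightarrow> real) \<Rightarrow> real \<Rightarrow> 'h \<Rightarrow> 'x \<Rightarrow> real" where
  "theta_score lik \<theta> \<eta> x = deriv (\<lambda>t. ln (lik t \<eta> x)) \<theta>"

definition has_theta_score ::
  "'x measure \<Rightarrow> (real \<Rightarrow> 'h \<Rightarrow> 'x \<Rightarrow> real) \<Rightarrow> real \<Rightarrow> 'h \<Rightarrow> bool" where
  "has_theta_score \<mu> lik \<theta> \<eta> \<longleftrightarrow>
     (AE x in model_law \<mu> lik \<theta> \<eta>.
        (\<forall>\<^sub>F t in nhds \<theta>. 0 < lik t \<eta> x) \<and>
        (\<lambda>t. ln (lik t \<eta> x)) field_differentiable at \<theta>) \<and>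
     theta_score lik \<theta> \<eta> \<in> L2 (model_law \<mu> lik \<theta> \<eta>)"

text \<open>Score functions for \<open>\<eta>\<close> at \<open>(\<theta>,\<eta>)\<close>: the scores at \<open>s = 0\<close> of the one-dimensional submodels
  \<open>s \<mapsto> P\<^bsub>\<theta>,\<gamma> s\<^esub>\<close>, \<open>s \<ge> 0\<close>, with \<open>\<gamma> 0 = \<eta>\<close>, that are differentiable in quadratic mean.\<close>

definition eta_scores ::
  "'x measure \<Rightarrow> (real \<Rightarrow> 'h \<Rightarrow> 'x \<Rightarrow> real) \<Rightarrow> 'h set \<Rightarrow> real \<Rightarrow> 'h \<Rightarrow> ('x \<Rightarrow> real) set" where
  "eta_scores \<mu> lik H \<theta> \<eta> = {g \<in> L2 (model_law \<mu> lik \<theta> \<eta>). \<exists>\<gamma> :: real \<Rightarrow> 'h.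
     \<gamma> 0 = \<eta> \<and> (\<forall>\<^sub>F s in at_right 0. \<gamma> s \<in> H) \<and>
     ((\<lambda>s. \<integral>\<^sup>+x. ennreal (((sqrt (lik \<theta> (\<gamma> s) x) - sqrt (lik \<theta> \<eta> x)) / s
              - g x * sqrt (lik \<theta> \<eta> x) / 2)\<^sup>2) \<partial>\<mu>) \<longlongrightarrow> 0) (at_right 0)}"

definition efficient_score ::
  "'x measure \<Rightarrow> (real \<Rightarrow> 'h \<Rightarrow> 'x \<Rightarrow> real) \<Rightarrow> 'h set \<Rightarrow> real \<Rightarrow> 'h \<Rightarrow> 'x \<Rightarrow> real" where
  "efficient_score \<mu> lik H \<theta> \<eta> x =
     theta_score lik \<theta> \<eta> x -
     L2_projection (model_law \<mu> lik \<theta> \<eta>)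
       (closed_linear_span (model_law \<mu> lik \<theta> \<eta>) (eta_scores \<mu> lik H \<theta> \<eta>))
       (theta_score lik \<theta> \<eta>) x"

definition efficient_information ::
  "'x measure \<Rightarrow> (real \<Rightarrow> 'h \<Rightarrow> 'x \<Rightarrow> real) \<Rightarrow> 'h set \<Rightarrow> real \<Rightarrow> 'h \<Rightarrow> real" where
  "efficient_information \<mu> lik H \<theta> \<eta> =
     (\<integral>x. (efficient_score \<mu> lik H \<theta> \<eta> x
        - (\<integral>y. efficient_score \<mu> lik H \<theta> \<eta> y \<partial>model_law \<mu> lik \<theta> \<eta>))\<^sup>2 \<partial>model_law \<mu> lik \<theta> \<eta>)"

text \<open>\<open>lfs t \<theta> \<eta>\<close> is \<open>\<eta>\<^sub>t(\<theta>,\<eta>)\<close>.\<close>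

definition ell ::
  "(real \<Rightarrow> 'h \<Rightarrow> 'x \<Rightarrow> real) \<Rightarrow> (real \<Rightarrow> real \<Rightarrow> 'h \<Rightarrow> 'h) \<Rightarrow> real \<Rightarrow> real \<Rightarrow> 'h \<Rightarrow> 'x \<Rightarrow> real" where
  "ell lik lfs t \<theta> \<eta> x = ln (lik t (lfs t \<theta> \<eta>) x)"

text \<open>\<open>ell_deriv lik lfs l m\<close> is \<open>\<partial>\<^sup>l\<^sup>+\<^sup>m\<ell> / \<partial>t\<^sup>l\<partial>\<theta>\<^sup>m\<close>, where the \<open>t\<close>-derivatives are
  taken first; in particular \<open>(l,m) = (1,1)\<close> is the \<open>\<theta>\<close>-derivative of the \<open>t\<close>-derivative.\<close>

definition ell_deriv ::
  "(real \<Rightarrow> 'h \<Rightarrow> 'x \<Rightarrow> real) \<Rightarrow> (real \<Rightarrow> real \<Rightarrow> 'h \<Rightarrow> 'h) \<Rightarrow> nat \<Rightarrow> nat \<Rightarrow>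
   real \<Rightarrow> real \<Rightarrow> 'h \<Rightarrow> 'x \<Rightarrow> real" where
  "ell_deriv lik lfs l m t \<theta> \<eta> x =
     (deriv ^^ m) (\<lambda>\<theta>'. (deriv ^^ l) (\<lambda>s. ell lik lfs s \<theta>' \<eta> x) t) \<theta>"

definition param_nbhd ::
  "real set \<Rightarrow> 'h::real_normed_vector set \<Rightarrow> real \<Rightarrow> 'h \<Rightarrow> real \<Rightarrow> (real \<times> real \<times> 'h) set" where
  "param_nbhd \<Theta> H \<theta>0 \<eta>0 \<delta> = (\<Theta> \<inter> ball \<theta>0 \<delta>) \<times> (\<Theta> \<inter> ball \<theta>0 \<delta>) \<times> (H \<inter> ball \<eta>0 \<delta>)"

text \<open>The derivatives of \<open>\<ell>\<close> entering the envelope conditions exist at \<open>(t,\<theta>,\<eta>)\<close> for the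
  observation \<open>x\<close>, and the logarithm is a genuine one.\<close>

definition ell_derivs_exist ::
  "(real \<Rightarrow> 'h \<Rightarrow> 'x \<Rightarrow> real) \<Rightarrow> (real \<Rightarrow> real \<Rightarrow> 'h \<Rightarrow> 'h) \<Rightarrow> real \<Rightarrow> real \<Rightarrow> 'h \<Rightarrow> 'x \<Rightarrow> bool" where
  "ell_derivs_exist lik lfs t \<theta> \<eta> x \<longleftrightarrow>
     0 < lik t (lfs t \<theta> \<eta>) x \<and>
     (\<forall>l\<in>{0,1,2}. (\<lambda>s. ell_deriv lik lfs l 0 s \<theta> \<eta> x) field_differentiable at t) \<and>
     (\<forall>(l,m)\<in>{(1,0),(1,1),(2,0)}.
        (\<lambda>\<theta>'. ell_deriv lik lfs l m t \<theta>' \<eta> x) field_differentiable at \<theta>)"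

definition has_L1_envelope :: "'x measure \<Rightarrow> 'i set \<Rightarrow> ('i \<Rightarrow> 'x \<Rightarrow> real) \<Rightarrow> bool" where
  "has_L1_envelope P V f \<longleftrightarrow>
     (\<forall>v\<in>V. f v \<in> borel_measurable P) \<and>
     (\<exists>F. integrable P F \<and> (AE x in P. \<forall>v\<in>V. \<bar>f v x\<bar> \<le> F x))"

definition lik_n ::
  "(real \<Rightarrow> 'h \<Rightarrow> 'x \<Rightarrow> real) \<Rightarrow> (nat \<Rightarrow> 'x) \<Rightarrow> nat \<Rightarrow> real \<Rightarrow> 'h \<Rightarrow> real" where
  "lik_n lik d n \<theta> \<eta> = (\<Prod>i<n. lik \<theta> \<eta> (d i))"

definition profile_lik ::
  "(real \<Rightarrow> 'h \<Rightarrow> 'x \<Rightarrow> real) \<Rightarrow> 'h set \<Rightarrow> (nat \<Rightarrow> 'x) \<Rightarrow> nat \<Rightarrow> real \<Rightarrow> real" where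
  "profile_lik lik H d n \<theta> = (SUP \<eta>\<in>H. lik_n lik d n \<theta> \<eta>)"

definition log_ereal :: "real \<Rightarrow> ereal" where
  "log_ereal y = (if y = 0 then -\<infinity> else ereal (ln y))"

text \<open>\<open>\<Delta>\<^sub>n(\<theta>)\<close>; the argument \<open>\<theta>hat\<close> is the value of the maximum likelihood estimator.\<close>

definition Delta_n ::
  "(real \<Rightarrow> 'h \<Rightarrow> 'x \<Rightarrow> real) \<Rightarrow> 'h set \<Rightarrow> (nat \<Rightarrow> 'x) \<Rightarrow> nat \<Rightarrow> real \<Rightarrow> real \<Rightarrow> ereal" where
  "Delta_n lik H d n \<theta>hat \<theta> =
     (log_ereal (profile_lik lik H d n \<theta>) - log_ereal (profile_lik lik H d n \<theta>hat)) / ereal (real n)"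

text \<open>Only meaningful when the profile likelihood is a measurable function on \<open>\<Theta>\<close>, which a supremum
  over an uncountable \<open>H\<close> need not be.\<close>

definition posterior_profile ::
  "(real \<Rightarrow> 'h \<Rightarrow> 'x \<Rightarrow> real) \<Rightarrow> 'h set \<Rightarrow> real set \<Rightarrow> (real \<Rightarrow> real) \<Rightarrow> (nat \<Rightarrow> 'x) \<Rightarrow> nat \<Rightarrow> real measure" where
  "posterior_profile lik H \<Theta> \<rho> d n =
     density (lebesgue_on \<Theta>)
       (\<lambda>\<theta>. ennreal (\<rho> \<theta> * profile_lik lik H d n \<theta> /
          (\<integral>\<theta>'. \<rho> \<theta>' * profile_lik lik H d n \<theta>' \<partial>lebesgue_on \<Theta>)))"

definition proper_prior_density :: "real set \<Rightarrow> (real \<Rightarrow> real) \<Rightarrow> bool" where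
  "proper_prior_density \<Theta> \<rho> \<longleftrightarrow>
     (\<forall>\<theta>\<in>\<Theta>. 0 \<le> \<rho> \<theta>) \<and> integrable (lebesgue_on \<Theta>) \<rho> \<and> (\<integral>\<theta>. \<rho> \<theta> \<partial>lebesgue_on \<Theta>) = 1"

end

theory Submission
  imports Defs "HOL-Real_Asymp.Real_Asymp"
begin

text \<open>The posterior profile distribution is asymptotically normal because the profile likelihood
  is nearly a Gaussian function of \<open>\<theta>\<close>, and the rate \<open>n\<^sup>-\<^sup>1\<^sup>/\<^sup>2\<close> is the relative size of the cubic
  remainder in the expansion of its logarithm.

  For every \<open>\<psi>\<close> the least favourable submodel through \<open>(\<psi>, \<eta>\<^sub>\<psi>)\<close>, with \<open>\<eta>\<^sub>\<psi>\<close> the maximiser of the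
  likelihood in the nuisance parameter, gives a smooth lower bound of the profile likelihood that is exact
  at \<open>\<psi>\<close>. Along such a submodel the mean log-likelihood equals
  \<open>(t - \<theta>0) s - I (t - \<theta>0)\<^sup>2 / 2\<close> up to a constant and an error of third order in
  \<open>n\<^sup>-\<^sup>1\<^sup>/\<^sup>2 + \<bar>\<psi> - \<theta>0\<bar> + \<bar>t - \<theta>0\<bar>\<close>, where \<open>s\<close> is the sample mean of the efficient score and \<open>I\<close> the
  efficient information (\<open>submodel_expansion\<close>). The coefficients are the same for all \<open>\<psi>\<close>, because the mean
  score is quadratic in the nuisance deviation. Using the submodels through the two end points bounds an
  increment of the log profile likelihood from below and from above
  (\<open>profile_likelihood_expansion\<close>).

  The expansion has to be recentred at the maximum likelihood estimator \<open>m\<close>. Comparing values of the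
  likelihood would locate \<open>m\<close> only up to \<open>n\<^sup>-\<^sup>3\<^sup>/\<^sup>4\<close>, which is too coarse. Instead, \<open>m\<close> also maximises the likelihood
  along the submodel through \<open>(m, \<eta>\<^sub>m)\<close>, so that the derivative vanishes there; this gives
  \<open>s - I (m - \<theta>0) = O(1/n)\<close>, and the linear term left over after recentring has the size of the cubic
  remainder (\<open>expansion_imp_nearly_gaussian_weight\<close>).

  It remains to integrate. In the scale \<open>h = \<surd>n (\<theta> - m)\<close> the likelihood ratio is
  \<open>exp (- I h\<^sup>2 / 2 + O(n\<^sup>-\<^sup>1\<^sup>/\<^sup>2 (1 + \<bar>h\<bar>)\<^sup>3))\<close> on a small neighbourhood of \<open>\<theta>0\<close> and exponentially small outside by
  consistency, while the prior density varies by \<open>O(n\<^sup>-\<^sup>1\<^sup>/\<^sup>2 (1 + \<bar>h\<bar>))\<close>. Hence the unnormalised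
  posterior is within a relative \<open>L\<^sub>1\<close> distance \<open>O(n\<^sup>-\<^sup>1\<^sup>/\<^sup>2)\<close> of a normal density
  (\<open>nearly_gaussian_weight_imp_normal_posterior\<close>).

  The hypotheses speak of random sequences of parameters and of weak convergence, whereas this argument
  works with one sample at a time and needs bounds that are uniform in the parameters.
  \<open>diagonal_selection\<close> converts statements along sequences into uniform ones, and
  \<open>P_Donsker_likely_bounded\<close> extracts a uniform bound on the empirical process from the Donsker
  property.\<close>

section \<open>Outer probability\<close>

context prob_space
begin

lemma outer_prob_le:
  assumes "B \<in> events" "A \<subseteq> B"
  shows "outer_prob M A \<le> prob B"
  unfolding outer_prob_def using assms by (intro cINF_lower bdd_belowI[of _ 0]) auto

lemma outer_prob_cover:
  assumes "A \<subseteq> space M" "outer_prob M A < e"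
  obtains B where "B \<in> events" "A \<subseteq> B" "prob B < e"
proof -
  have "bdd_below (prob ` {B \<in> events. A \<subseteq> B})"
    by (intro bdd_belowI[of _ 0]) auto
  moreover have "{B \<in> events. A \<subseteq> B} \<noteq> {}" using assms(1) by auto
  ultimately show ?thesis using assms(2) that
    unfolding outer_prob_def by (subst (asm) cINF_less_iff) auto
qed

lemma outer_prob_nonneg: "A \<subseteq> space M \<Longrightarrow> 0 \<le> outer_prob M A"
  unfolding outer_prob_def by (rule cINF_greatest) auto

lemma outer_prob_empty: "outer_prob M {} = 0"
  using outer_prob_le[of "{}" "{}"] outer_prob_nonneg[of "{}"] by simp

lemma outer_prob_mono:
  assumes "A \<subseteq> B" "B \<subseteq> space M"
  shows "outer_prob M A \<le> outer_prob M B"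
proof (rule ccontr)
  assume "\<not> ?thesis"
  then obtain C where "C \<in> events" "B \<subseteq> C" "prob C < outer_prob M A"
    using assms outer_prob_cover[of B "outer_prob M A"] by force
  then show False using outer_prob_le[of C A] assms by auto
qed

lemma outer_prob_Un_le:
  assumes "A \<subseteq> space M" "B \<subseteq> space M"
  shows "outer_prob M (A \<union> B) \<le> outer_prob M A + outer_prob M B"
proof (rule field_le_epsilon)
  fix e :: real assume "0 < e"
  then obtain A' B' where *: "A' \<in> events" "A \<subseteq> A'" "prob A' < outer_prob M A + e / 2"
      "B' \<in> events" "B \<subseteq> B'" "prob B' < outer_prob M B + e / 2"
    using outer_prob_cover[OF assms(1), of "outer_prob M A + e / 2"]
      outer_prob_cover[OF assms(2), of "outer_prob M B + e / 2"]
    by (metis half_gt_zero less_add_same_cancel1)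
  have "outer_prob M (A \<union> B) \<le> prob (A' \<union> B')"
    using * by (intro outer_prob_le) auto
  also have "\<dots> \<le> prob A' + prob B'" using * by (intro measure_Un_le) auto
  finally show "outer_prob M (A \<union> B) \<le> outer_prob M A + outer_prob M B + e" using * by simp
qed

lemma outer_prob_AE_zero:
  assumes "AE \<omega> in M. G \<omega>"
  shows "outer_prob M {\<omega>\<in>space M. \<not> G \<omega>} = 0"
proof -
  obtain N where N: "{\<omega>\<in>space M. \<not> G \<omega>} \<subseteq> N" "N \<in> null_sets M"
    using AE_E3[OF assms] by (smt (verit) mem_Collect_eq DiffI subsetI)
  have "outer_prob M {\<omega>\<in>space M. \<not> G \<omega>} \<le> prob N"
    using N by (intro outer_prob_le) auto
  also have "\<dots> = 0" using N(2) by (simp add: measure_def null_setsD1)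
  finally show ?thesis using outer_prob_nonneg[of "{\<omega>\<in>space M. \<not> G \<omega>}"] by auto
qed

end

text \<open>A property of the sample is \<open>likely\<close> at level \<open>\<epsilon>\<close> if its failure has outer probability at most
  \<open>\<epsilon>\<close> for all large sample sizes. Stochastic order statements become statements about likely
  properties, which are closed under conjunction at the cost of adding levels; the analysis then
  happens path by path on the intersection.\<close>

definition likely :: "'w measure \<Rightarrow> real \<Rightarrow> (nat \<Rightarrow> 'w \<Rightarrow> bool) \<Rightarrow> bool" where
  "likely M \<epsilon> G \<longleftrightarrow> (\<forall>\<^sub>F n in sequentially. outer_prob M {\<omega>\<in>space M. \<not> G n \<omega>} \<le> \<epsilon>)"

lemma likely_mono:
  assumes "prob_space M" "likely M \<epsilon> G" "\<epsilon> \<le> \<epsilon>'"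
    and "\<forall>\<^sub>F n in sequentially. \<forall>\<omega>\<in>space M. G n \<omega> \<longrightarrow> G' n \<omega>"
  shows "likely M \<epsilon>' G'"
  unfolding likely_def
proof (rule eventually_mono[OF eventually_conj[OF assms(2)[unfolded likely_def] assms(4)]])
  interpret prob_space M by fact
  fix n assume *: "outer_prob M {\<omega>\<in>space M. \<not> G n \<omega>} \<le> \<epsilon> \<and> (\<forall>\<omega>\<in>space M. G n \<omega> \<longrightarrow> G' n \<omega>)"
  have "outer_prob M {\<omega>\<in>space M. \<not> G' n \<omega>} \<le> outer_prob M {\<omega>\<in>space M. \<not> G n \<omega>}"
    using * by (intro outer_prob_mono) auto
  then show "outer_prob M {\<omega>\<in>space M. \<not> G' n \<omega>} \<le> \<epsilon>'" using * assms(3) by linarith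
qed

lemma likely_conj:
  assumes "prob_space M" "likely M a G" "likely M b G'"
  shows "likely M (a + b) (\<lambda>n \<omega>. G n \<omega> \<and> G' n \<omega>)"
  unfolding likely_def
proof (rule eventually_mono[OF eventually_conj[OF assms(2,3)[unfolded likely_def]]])
  interpret prob_space M by fact
  fix n assume *: "outer_prob M {\<omega>\<in>space M. \<not> G n \<omega>} \<le> a \<and> outer_prob M {\<omega>\<in>space M. \<not> G' n \<omega>} \<le> b"
  have "{\<omega>\<in>space M. \<not> (G n \<omega> \<and> G' n \<omega>)} = {\<omega>\<in>space M. \<not> G n \<omega>} \<union> {\<omega>\<in>space M. \<not> G' n \<omega>}"
    by auto
  then show "outer_prob M {\<omega>\<in>space M. \<not> (G n \<omega> \<and> G' n \<omega>)} \<le> a + b"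
    using * outer_prob_Un_le[of "{\<omega>\<in>space M. \<not> G n \<omega>}" "{\<omega>\<in>space M. \<not> G' n \<omega>}"] by auto
qed

lemma likely_AE:
  assumes "prob_space M" "\<And>n. AE \<omega> in M. G n \<omega>" "0 \<le> \<epsilon>"
  shows "likely M \<epsilon> G"
  using assms prob_space.outer_prob_AE_zero[OF assms(1,2)] by (auto simp: likely_def)

lemma likely_Markov:
  assumes "prob_space M" "\<And>n. integrable M (u n)" "\<And>n \<omega>. 0 \<le> u n \<omega>"
    and "\<forall>\<^sub>F n in sequentially. integral\<^sup>L M (u n) \<le> c * \<epsilon>" "0 < c" 
  shows "likely M \<epsilon> (\<lambda>n \<omega>. u n \<omega> < c)"
  unfolding likely_def
proof (rule eventually_mono[OF assms(4)])
  interpret prob_space M by fact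
  fix n assume "integral\<^sup>L M (u n) \<le> c * \<epsilon>"
  have [measurable]: "u n \<in> borel_measurable M" using assms(2) by auto
  have "outer_prob M {\<omega>\<in>space M. \<not> u n \<omega> < c} \<le> prob {\<omega>\<in>space M. c \<le> u n \<omega>}"
    by (intro outer_prob_le) auto
  also have "\<dots> \<le> integral\<^sup>L M (u n) / c"
    using assms by (intro integral_Markov_inequality_measure[where A="space M"]) auto
  also have "\<dots> \<le> \<epsilon>" using \<open>integral\<^sup>L M (u n) \<le> c * \<epsilon>\<close> \<open>0 < c\<close> by (simp add: field_simps)
  finally show "outer_prob M {\<omega>\<in>space M. \<not> u n \<omega> < c} \<le> \<epsilon>" .
qed

lemma O_P_uniformly_likely:
  assumes "prob_space M" "O_P_uniformly M S Y R" "\<And>n s \<omega>. 0 \<le> R n s \<omega>" "0 < \<epsilon>"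
  shows "\<exists>C0. \<forall>C\<ge>C0. likely M \<epsilon> (\<lambda>n \<omega>. \<forall>s\<in>S. \<bar>Y n s \<omega>\<bar> \<le> C * R n s \<omega>)"
proof -
  obtain C0 where C0: "\<forall>\<^sub>F n in sequentially.
      outer_prob M {\<omega>\<in>space M. \<exists>s\<in>S. \<bar>Y n s \<omega>\<bar> > C0 * R n s \<omega>} \<le> \<epsilon>"
    using assms(2,4) unfolding O_P_uniformly_def by blast
  have *: "likely M \<epsilon> (\<lambda>n \<omega>. \<forall>s\<in>S. \<bar>Y n s \<omega>\<bar> \<le> C0 * R n s \<omega>)"
    using C0 unfolding likely_def by (simp add: not_le)
  show ?thesis
  proof (intro exI allI impI)
    fix C assume "C0 \<le> C"
    then have "C0 * R n s \<omega> \<le> C * R n s \<omega>" for n s \<omega>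
      using assms(3) by (intro mult_right_mono) auto
    then show "likely M \<epsilon> (\<lambda>n \<omega>. \<forall>s\<in>S. \<bar>Y n s \<omega>\<bar> \<le> C * R n s \<omega>)"
      by (intro likely_mono[OF assms(1) * order_refl] always_eventually) (auto intro: order_trans)
  qed
qed

section \<open>From random sequences to uniform statements\<close>

text \<open>Hypotheses about every random sequence of parameters say something uniform over the parameter:
  were the uniform statement false at every level \<open>k\<close>, one could pick sample sizes
  \<open>\<sigma> 0 < \<sigma> 1 < \<dots>\<close> and, at size \<open>\<sigma> k\<close>, a parameter violating the statement at level \<open>k\<close>, and the
  resulting sequence would contradict the hypothesis. The selection need not be measurable, which
  is where outer probabilities pay off.\<close>

lemma diagonal_selection:
  assumes "\<And>k. \<not> likely M \<epsilon> (\<lambda>n \<omega>. \<forall>s\<in>S. \<not> Bad k n s \<omega>)"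
  obtains \<sigma> :: "nat \<Rightarrow> nat" and s where "strict_mono \<sigma>"
    "\<And>k. outer_prob M {\<omega>\<in>space M. s (\<sigma> k) \<omega> \<in> S \<and> Bad k (\<sigma> k) (s (\<sigma> k) \<omega>) \<omega>} > \<epsilon>"
    "\<And>n \<omega>. s n \<omega> = dflt n \<omega> \<or> (\<exists>k. n = \<sigma> k \<and> s n \<omega> \<in> S \<and> Bad k n (s n \<omega>) \<omega>)"
proof -
  have freq: "\<exists>n>m. outer_prob M {\<omega>\<in>space M. \<exists>s\<in>S. Bad k n s \<omega>} > \<epsilon>" for k m
  proof (rule ccontr)
    assume "\<not> ?thesis"
    then have "\<forall>\<^sub>F n in sequentially. outer_prob M {\<omega>\<in>space M. \<exists>s\<in>S. Bad k n s \<omega>} \<le> \<epsilon>"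
      by (intro eventually_sequentiallyI[of "Suc m"]) (meson Suc_le_lessD not_less)
    then show False using assms[of k] unfolding likely_def by simp
  qed
  define p where "p k m = (SOME n. n > m \<and> outer_prob M {\<omega>\<in>space M. \<exists>s\<in>S. Bad k n s \<omega>} > \<epsilon>)" for k m
  have p: "p k m > m" "outer_prob M {\<omega>\<in>space M. \<exists>s\<in>S. Bad k (p k m) s \<omega>} > \<epsilon>" for k m
    using someI_ex[OF freq[of m k]] unfolding p_def by auto
  define \<sigma> where "\<sigma> = rec_nat (p 0 0) (\<lambda>k m. p (Suc k) m)"
  have \<sigma>: "\<sigma> 0 = p 0 0" "\<sigma> (Suc k) = p (Suc k) (\<sigma> k)" for k unfolding \<sigma>_def by simp_all
  have mono: "strict_mono \<sigma>" by (rule strict_mono_Suc_iff[THEN iffD2]) (simp add: \<sigma> p)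
  have large: "outer_prob M {\<omega>\<in>space M. \<exists>s\<in>S. Bad k (\<sigma> k) s \<omega>} > \<epsilon>" for k
    by (cases k) (simp_all add: \<sigma> p)
  define Q where "Q n \<omega> s \<longleftrightarrow> (\<exists>k. n = \<sigma> k \<and> s \<in> S \<and> Bad k n s \<omega>)" for n \<omega> s
  define s where "s n \<omega> = (if \<exists>s. Q n \<omega> s then SOME s. Q n \<omega> s else dflt n \<omega>)" for n \<omega>
  have s: "s n \<omega> = dflt n \<omega> \<or> Q n \<omega> (s n \<omega>)" "\<exists>s. Q n \<omega> s \<Longrightarrow> Q n \<omega> (s n \<omega>)" for n \<omega>
    unfolding s_def by (auto intro: someI)
  have "{\<omega>\<in>space M. \<exists>s\<in>S. Bad k (\<sigma> k) s \<omega>}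
      = {\<omega>\<in>space M. s (\<sigma> k) \<omega> \<in> S \<and> Bad k (\<sigma> k) (s (\<sigma> k) \<omega>) \<omega>}" for k
    using s(2)[of "\<sigma> k"] strict_mono_eq[OF mono] unfolding Q_def by auto
  with large have "outer_prob M {\<omega>\<in>space M. s (\<sigma> k) \<omega> \<in> S \<and> Bad k (\<sigma> k) (s (\<sigma> k) \<omega>) \<omega>} > \<epsilon>" for k
    by simp
  then show ?thesis using that[OF mono] s(1) unfolding Q_def by blast
qed

text \<open>The violators at level \<open>k\<close> are taken with constant \<open>k\<close> and within distance \<open>1/(k+1)\<close> of \<open>\<theta>0\<close>. The
  sequence selected from them is therefore consistent, and no fixed constant can serve it.\<close>

lemma O_P_along_sequences_imp_uniform:
  fixes r :: "nat \<Rightarrow> real \<Rightarrow> real" and Y :: "nat \<Rightarrow> real \<Rightarrow> 'w \<Rightarrow> real"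
  assumes "prob_space M" and \<theta>0: "\<theta>0 \<in> \<Theta>" and "0 < \<epsilon>" and r: "\<And>n \<theta>. 0 \<le> r n \<theta>"
    and along: "\<And>\<theta>s. (\<And>n \<omega>. \<omega> \<in> space M \<Longrightarrow> \<theta>s n \<omega> \<in> \<Theta>) \<Longrightarrow>
      o_P_one M (\<lambda>n \<omega>. ereal (\<theta>s n \<omega> - \<theta>0)) \<Longrightarrow>
      O_P M (\<lambda>n \<omega>. Y n (\<theta>s n \<omega>) \<omega>) (\<lambda>n \<omega>. r n (\<theta>s n \<omega>))"
  shows "\<exists>C0. \<exists>\<delta>>0. \<forall>C\<ge>C0. likely M \<epsilon> (\<lambda>n \<omega>. \<forall>\<theta>\<in>\<Theta>. \<bar>\<theta> - \<theta>0\<bar> < \<delta> \<longrightarrow> \<bar>Y n \<theta> \<omega>\<bar> \<le> C * r n \<theta>)"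
proof -
  interpret prob_space M by fact
  define G where "G C \<delta> n \<omega> \<longleftrightarrow> (\<forall>\<theta>\<in>\<Theta>. \<bar>\<theta> - \<theta>0\<bar> < \<delta> \<longrightarrow> \<bar>Y n \<theta> \<omega>\<bar> \<le> C * r n \<theta>)" for C \<delta> :: real and n \<omega>
  have "\<exists>k::nat. likely M \<epsilon> (G k (1 / Suc k))"
  proof (rule ccontr)
    define Bad where "Bad k n \<theta> \<omega> \<longleftrightarrow> \<bar>\<theta> - \<theta>0\<bar> < 1 / Suc k \<and> \<bar>Y n \<theta> \<omega>\<bar> > real k * r n \<theta>" for k n \<theta> \<omega>
    assume "\<not> ?thesis"
    moreover have "(\<lambda>n \<omega>. \<forall>\<theta>\<in>\<Theta>. \<not> Bad k n \<theta> \<omega>) = G k (1 / Suc k)" for k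
      unfolding G_def Bad_def by (auto simp: fun_eq_iff not_less)
    ultimately have "\<not> likely M \<epsilon> (\<lambda>n \<omega>. \<forall>\<theta>\<in>\<Theta>. \<not> Bad k n \<theta> \<omega>)" for k
      by simp
    then obtain \<sigma> \<theta>s where \<sigma>: "strict_mono \<sigma>"
      and large: "\<And>k. outer_prob M {\<omega>\<in>space M. \<theta>s (\<sigma> k) \<omega> \<in> \<Theta> \<and> Bad k (\<sigma> k) (\<theta>s (\<sigma> k) \<omega>) \<omega>} > \<epsilon>"
      and \<theta>s: "\<And>n \<omega>. \<theta>s n \<omega> = \<theta>0 \<or> (\<exists>k. n = \<sigma> k \<and> \<theta>s n \<omega> \<in> \<Theta> \<and> Bad k n (\<theta>s n \<omega>) \<omega>)"
      by (rule diagonal_selection[where S = \<Theta> and Bad = Bad and \<epsilon> = \<epsilon> and M = M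
            and dflt = "\<lambda>_ _. \<theta>0"]) blast+
    have in\<Theta>: "\<theta>s n \<omega> \<in> \<Theta>" for n \<omega> using \<theta>s[of n \<omega>] \<theta>0 by auto
    have "o_P_one M (\<lambda>n \<omega>. ereal (\<theta>s n \<omega> - \<theta>0))"
      unfolding o_P_one_def
    proof (intro allI impI)
      fix e :: real assume "0 < e"
      then obtain k0 :: nat where k0: "1 / Suc k0 < e" using nat_approx_posE by blast
      have "{\<omega>\<in>space M. \<bar>ereal (\<theta>s n \<omega> - \<theta>0)\<bar> > ereal e} = {}" if "n \<ge> \<sigma> k0" for n
      proof -
        have "\<bar>\<theta>s n \<omega> - \<theta>0\<bar> \<le> e" for \<omega>
        proof (cases "\<theta>s n \<omega> = \<theta>0")
          case False
          then obtain k where k: "n = \<sigma> k" "Bad k n (\<theta>s n \<omega>) \<omega>" using \<theta>s by blast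
          then have "k0 \<le> k" using that \<sigma> by (simp add: strict_mono_less_eq)
          then have "1 / real (Suc k) \<le> 1 / Suc k0" by (simp add: field_simps)
          then show ?thesis using k(2) k0 unfolding Bad_def by linarith
        qed (use \<open>0 < e\<close> in simp)
        then show ?thesis by (auto simp: not_less)
      qed
      then have "\<forall>\<^sub>F n in sequentially. outer_prob M {\<omega>\<in>space M. \<bar>ereal (\<theta>s n \<omega> - \<theta>0)\<bar> > ereal e} = 0"
        by (intro eventually_sequentiallyI[of "\<sigma> k0"]) (simp only: outer_prob_empty)
      then show "(\<lambda>n. outer_prob M {\<omega>\<in>space M. \<bar>ereal (\<theta>s n \<omega> - \<theta>0)\<bar> > ereal e}) \<longlonglongrightarrow> 0"
        by (rule tendsto_eventually)
    qed
    with along[of \<theta>s] in\<Theta> \<open>0 < \<epsilon>\<close> obtain C where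
      "\<forall>\<^sub>F n in sequentially. outer_prob M {\<omega>\<in>space M. \<bar>Y n (\<theta>s n \<omega>) \<omega>\<bar> > C * r n (\<theta>s n \<omega>)} \<le> \<epsilon>"
      unfolding O_P_def by blast
    then obtain N where N: "\<And>n. n \<ge> N \<Longrightarrow>
        outer_prob M {\<omega>\<in>space M. \<bar>Y n (\<theta>s n \<omega>) \<omega>\<bar> > C * r n (\<theta>s n \<omega>)} \<le> \<epsilon>"
      unfolding eventually_sequentially by blast
    obtain k where k: "real k \<ge> C" "k \<ge> N"
      by (metis max.cobounded1 max.cobounded2 of_nat_le_iff order_trans real_arch_simple)
    have "C * r n \<theta> \<le> k * r n \<theta>" for n \<theta> using k r by (intro mult_right_mono) auto
    then have "outer_prob M {\<omega>\<in>space M. \<theta>s (\<sigma> k) \<omega> \<in> \<Theta> \<and> Bad k (\<sigma> k) (\<theta>s (\<sigma> k) \<omega>) \<omega>}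
      \<le> outer_prob M {\<omega>\<in>space M. \<bar>Y (\<sigma> k) (\<theta>s (\<sigma> k) \<omega>) \<omega>\<bar> > C * r (\<sigma> k) (\<theta>s (\<sigma> k) \<omega>)}"
      unfolding Bad_def by (intro outer_prob_mono) (auto intro: order.strict_trans1)
    also have "\<dots> \<le> \<epsilon>" using N[of "\<sigma> k"] strict_mono_imp_increasing[OF \<sigma>, of k] k by simp
    finally show False using large[of k] by simp
  qed
  then obtain k :: nat where k: "likely M \<epsilon> (G k (1 / Suc k))" ..
  have "likely M \<epsilon> (G C (1 / Suc k))" if "real k \<le> C" for C
  proof (rule likely_mono[OF assms(1) k order_refl always_eventually], intro allI ballI impI)
    fix n \<omega> assume "G k (1 / Suc k) n \<omega>"
    moreover have "k * r n \<theta> \<le> C * r n \<theta>" for \<theta> using that r by (intro mult_right_mono) auto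
    ultimately show "G C (1 / Suc k) n \<omega>" unfolding G_def by (meson order_trans)
  qed
  then show ?thesis unfolding G_def
    by (intro exI[of _ "real k"] exI[of _ "1 / real (Suc k)"]) auto
qed

text \<open>A violator at level \<open>k\<close> stays away from \<open>\<theta>0\<close> although its criterion value is at least
  \<open>exp (- n/(k+1))\<close> times the maximum. A sequence of violators thus nearly maximises the
  criterion without being consistent. The level at which violators become unlikely, and with it the
  exponent \<open>\<kappa>\<close>, depends on \<open>\<epsilon>\<close>.\<close>

lemma consistency_imp_separation:
  fixes L :: "nat \<Rightarrow> 'w \<Rightarrow> real \<Rightarrow> real"
  assumes "prob_space M" and "0 < \<epsilon>" "0 < \<delta>"
    and \<theta>hat: "\<And>n \<omega>. \<omega> \<in> space M \<Longrightarrow> \<theta>hat n \<omega> \<in> \<Theta>"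
    and max: "\<And>n \<omega> \<theta>. \<omega> \<in> space M \<Longrightarrow> \<theta> \<in> \<Theta> \<Longrightarrow> L n \<omega> \<theta> \<le> L n \<omega> (\<theta>hat n \<omega>)"
    and pos: "\<And>n. AE \<omega> in M. 0 < L n \<omega> (\<theta>hat n \<omega>)"
    and cons: "\<And>\<theta>s. (\<And>n \<omega>. \<omega> \<in> space M \<Longrightarrow> \<theta>s n \<omega> \<in> \<Theta>) \<Longrightarrow>
      o_P_one M (\<lambda>n \<omega>. (log_ereal (L n \<omega> (\<theta>s n \<omega>)) - log_ereal (L n \<omega> (\<theta>hat n \<omega>))) / ereal (real n)) \<Longrightarrow>
      o_P_one M (\<lambda>n \<omega>. ereal (\<theta>s n \<omega> - \<theta>0))"
  shows "\<exists>\<kappa>>0. likely M \<epsilon> (\<lambda>n \<omega>. \<forall>\<theta>\<in>\<Theta>. \<delta> < \<bar>\<theta> - \<theta>0\<bar> \<longrightarrow>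
    L n \<omega> \<theta> \<le> exp (- \<kappa> * real n) * L n \<omega> (\<theta>hat n \<omega>))"
proof (rule ccontr)
  interpret prob_space M by fact
  define Bad where "Bad k n \<theta> \<omega> \<longleftrightarrow> \<delta> < \<bar>\<theta> - \<theta>0\<bar> \<and>
    L n \<omega> \<theta> > exp (- (1 / Suc k) * real n) * L n \<omega> (\<theta>hat n \<omega>)" for k n \<theta> \<omega>
  assume neg: "\<not> ?thesis"
  have "\<not> likely M \<epsilon> (\<lambda>n \<omega>. \<forall>\<theta>\<in>\<Theta>. \<not> Bad k n \<theta> \<omega>)" for k
  proof
    assume a: "likely M \<epsilon> (\<lambda>n \<omega>. \<forall>\<theta>\<in>\<Theta>. \<not> Bad k n \<theta> \<omega>)"
    moreover have "(\<lambda>n \<omega>. \<forall>\<theta>\<in>\<Theta>. \<not> Bad k n \<theta> \<omega>) = (\<lambda>n \<omega>. \<forall>\<theta>\<in>\<Theta>. \<delta> < \<bar>\<theta> - \<theta>0\<bar> \<longrightarrow>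
        L n \<omega> \<theta> \<le> exp (- (1 / Suc k) * real n) * L n \<omega> (\<theta>hat n \<omega>))"
      unfolding Bad_def by (auto simp: fun_eq_iff not_less)
    ultimately have "likely M \<epsilon> (\<lambda>n \<omega>. \<forall>\<theta>\<in>\<Theta>. \<delta> < \<bar>\<theta> - \<theta>0\<bar> \<longrightarrow>
        L n \<omega> \<theta> \<le> exp (- (1 / Suc k) * real n) * L n \<omega> (\<theta>hat n \<omega>))"
      using a by metis
    then have "\<exists>\<kappa>>0. likely M \<epsilon> (\<lambda>n \<omega>. \<forall>\<theta>\<in>\<Theta>. \<delta> < \<bar>\<theta> - \<theta>0\<bar> \<longrightarrow>
        L n \<omega> \<theta> \<le> exp (- \<kappa> * real n) * L n \<omega> (\<theta>hat n \<omega>))"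
      by (intro exI[of _ "1 / real (Suc k)"] conjI) simp_all
    then show False using neg by contradiction
  qed
  then obtain \<sigma> \<theta>s where \<sigma>: "strict_mono \<sigma>"
    and large: "\<And>k. outer_prob M {\<omega>\<in>space M. \<theta>s (\<sigma> k) \<omega> \<in> \<Theta> \<and> Bad k (\<sigma> k) (\<theta>s (\<sigma> k) \<omega>) \<omega>} > \<epsilon>"
    and \<theta>s: "\<And>n \<omega>. \<theta>s n \<omega> = \<theta>hat n \<omega> \<or> (\<exists>k. n = \<sigma> k \<and> \<theta>s n \<omega> \<in> \<Theta> \<and> Bad k n (\<theta>s n \<omega>) \<omega>)"
    by (rule diagonal_selection[where S = \<Theta> and Bad = Bad and \<epsilon> = \<epsilon> and M = M
            and dflt = \<theta>hat]) blast+
  have in\<Theta>: "\<theta>s n \<omega> \<in> \<Theta>" if "\<omega> \<in> space M" for n \<omega> using \<theta>s[of n \<omega>] \<theta>hat that by auto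
  define \<Delta> where "\<Delta> n \<omega> = (log_ereal (L n \<omega> (\<theta>s n \<omega>)) - log_ereal (L n \<omega> (\<theta>hat n \<omega>))) / ereal (real n)" for n \<omega>
  have "o_P_one M \<Delta>"
    unfolding o_P_one_def
  proof (intro allI impI)
    fix e :: real assume "0 < e"
    then obtain k0 :: nat where k0: "1 / Suc k0 < e" using nat_approx_posE by blast
    have small: "\<bar>\<Delta> n \<omega>\<bar> \<le> ereal e" if "n \<ge> \<sigma> k0" "n > 0" "\<omega> \<in> space M" "0 < L n \<omega> (\<theta>hat n \<omega>)" for n \<omega>
    proof (cases "\<theta>s n \<omega> = \<theta>hat n \<omega>")
      case True
      then show ?thesis using that \<open>0 < e\<close> unfolding \<Delta>_def log_ereal_def by simp
    next
      case False
      then obtain k where k: "n = \<sigma> k" "Bad k n (\<theta>s n \<omega>) \<omega>" using \<theta>s by blast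
      then have "k0 \<le> k" using that \<sigma> by (simp add: strict_mono_less_eq)
      then have "1 / real (Suc k) \<le> 1 / Suc k0" by (simp add: field_simps)
      then have ek: "1 / real (Suc k) \<le> e" using k0 by simp
      let ?a = "L n \<omega> (\<theta>s n \<omega>)" and ?b = "L n \<omega> (\<theta>hat n \<omega>)"
      have ab: "exp (- (1 / Suc k) * real n) * ?b < ?a" using k(2) unfolding Bad_def by simp
      then have "0 < ?a" using that(4) by (smt (verit) exp_gt_zero mult_pos_pos)
      have "ln (exp (- (1 / Suc k) * real n) * ?b) \<le> ln ?a"
        using ab that(4) by (intro ln_mono) auto
      then have lower: "- (1 / Suc k) * real n \<le> ln ?a - ln ?b" using that(4) by (simp add: ln_mult)
      have "?a \<le> ?b" using max in\<Theta> that(3) by blast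
      then have "ln ?a \<le> ln ?b" using \<open>0 < ?a\<close> by (intro ln_mono) auto
      moreover have "- e * real n \<le> ln ?a - ln ?b"
        using lower mult_right_mono[OF ek, of "real n"] by simp
      ultimately have "\<bar>(ln ?a - ln ?b) / real n\<bar> \<le> e"
        using \<open>n > 0\<close> by (auto simp: abs_le_iff field_simps)
      then show ?thesis using \<open>0 < ?a\<close> that(2,4) unfolding \<Delta>_def log_ereal_def by simp
    qed
    have "outer_prob M {\<omega>\<in>space M. \<bar>\<Delta> n \<omega>\<bar> > ereal e} = 0" if "n \<ge> max 1 (\<sigma> k0)" for n
    proof -
      have "outer_prob M {\<omega>\<in>space M. \<bar>\<Delta> n \<omega>\<bar> > ereal e}
          \<le> outer_prob M {\<omega>\<in>space M. \<not> 0 < L n \<omega> (\<theta>hat n \<omega>)}"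
        using small[of n] that by (intro outer_prob_mono) force+
      also have "\<dots> = 0" by (rule outer_prob_AE_zero[OF pos])
      finally show ?thesis using outer_prob_nonneg[of "{\<omega>\<in>space M. \<bar>\<Delta> n \<omega>\<bar> > ereal e}"] by auto
    qed
    then have "\<forall>\<^sub>F n in sequentially. outer_prob M {\<omega>\<in>space M. \<bar>\<Delta> n \<omega>\<bar> > ereal e} = 0"
      unfolding eventually_sequentially by blast
    then show "(\<lambda>n. outer_prob M {\<omega>\<in>space M. \<bar>\<Delta> n \<omega>\<bar> > ereal e}) \<longlonglongrightarrow> 0"
      by (rule tendsto_eventually)
  qed
  then have "o_P_one M (\<lambda>n \<omega>. ereal (\<theta>s n \<omega> - \<theta>0))"
    using cons in\<Theta> unfolding \<Delta>_def by blast
  then have "(\<lambda>n. outer_prob M {\<omega>\<in>space M. \<bar>ereal (\<theta>s n \<omega> - \<theta>0)\<bar> > ereal \<delta>}) \<longlonglongrightarrow> 0"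
    using \<open>0 < \<delta>\<close> unfolding o_P_one_def by blast
  from order_tendstoD(2)[OF this \<open>0 < \<epsilon>\<close>]
  obtain N where N: "\<And>n. n \<ge> N \<Longrightarrow> outer_prob M {\<omega>\<in>space M. \<bar>ereal (\<theta>s n \<omega> - \<theta>0)\<bar> > ereal \<delta>} < \<epsilon>"
    unfolding eventually_sequentially by blast
  have "outer_prob M {\<omega>\<in>space M. \<theta>s (\<sigma> N) \<omega> \<in> \<Theta> \<and> Bad N (\<sigma> N) (\<theta>s (\<sigma> N) \<omega>) \<omega>}
      \<le> outer_prob M {\<omega>\<in>space M. \<bar>ereal (\<theta>s (\<sigma> N) \<omega> - \<theta>0)\<bar> > ereal \<delta>}"
    unfolding Bad_def by (intro outer_prob_mono) auto
  also have "\<dots> < \<epsilon>" using N[of "\<sigma> N"] strict_mono_imp_increasing[OF \<sigma>, of N] by simp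
  finally show False using large[of N] by simp
qed

lemma consistent_imp_likely:
  assumes "o_P_one M (\<lambda>n \<omega>. ereal (Z n \<omega> - z))" "0 < \<delta>" "0 < \<epsilon>"
  shows "likely M \<epsilon> (\<lambda>n \<omega>. \<bar>Z n \<omega> - z\<bar> \<le> \<delta>)"
proof -
  have "(\<lambda>n. outer_prob M {\<omega>\<in>space M. \<bar>ereal (Z n \<omega> - z)\<bar> > ereal \<delta>}) \<longlonglongrightarrow> 0"
    using assms unfolding o_P_one_def by blast
  from order_tendstoD(2)[OF this \<open>0 < \<epsilon>\<close>] show ?thesis
    unfolding likely_def by eventually_elim (simp add: not_le)
qed

section \<open>Sample means and empirical processes\<close>

lemma iid_sampleD:
  assumes "iid_sample M X P"
  shows "prob_space M" "(\<lambda>\<omega>. X \<omega> i) \<in> measurable M P" "distr M P (\<lambda>\<omega>. X \<omega> i) = P"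
    "prob_space P"
proof -
  show 1: "prob_space M" and 3: "distr M P (\<lambda>\<omega>. X \<omega> i) = P"
    using assms unfolding iid_sample_def by auto
  then interpret prob_space M by simp
  show 2: "(\<lambda>\<omega>. X \<omega> i) \<in> measurable M P"
    using assms unfolding iid_sample_def indep_vars_def2 by simp
  show "prob_space P" using prob_space_distr[OF 2] 3 by simp
qed

lemma iid_sample_AE:
  assumes "iid_sample M X P" "AE x in P. G x"
  shows "AE \<omega> in M. \<forall>i. G (X \<omega> i)"
proof -
  have "AE x in distr M P (\<lambda>\<omega>. X \<omega> i). G x" for i
    unfolding iid_sampleD(3)[OF assms(1)] by (rule assms(2))
  then have "AE \<omega> in M. G (X \<omega> i)" for i
    by (rule AE_distrD[OF iid_sampleD(2)[OF assms(1)]])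
  then show ?thesis by (simp add: AE_all_countable)
qed

lemma iid_sample_integral:
  fixes f :: "'x \<Rightarrow> real"
  assumes "iid_sample M X P" "integrable P f"
  shows "integrable M (\<lambda>\<omega>. f (X \<omega> i))" "(\<integral>\<omega>. f (X \<omega> i) \<partial>M) = integral\<^sup>L P f"
proof -
  note X = iid_sampleD[OF assms(1)]
  have f: "integrable (distr M P (\<lambda>\<omega>. X \<omega> i)) f" using X(3) assms(2) by simp
  have [measurable]: "f \<in> borel_measurable P" using assms(2) by simp
  show "integrable M (\<lambda>\<omega>. f (X \<omega> i))"
    using f X(2) by (subst (asm) integrable_distr_eq) simp_all
  show "(\<integral>\<omega>. f (X \<omega> i) \<partial>M) = integral\<^sup>L P f"
    using integral_distr[OF X(2), of f i] X(3) by simp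
qed

text \<open>Markov's inequality, since a sample mean of \<open>F\<close> has expectation \<open>P F\<close> whatever the sample size. It is applied to the envelopes of the third derivatives.\<close>

lemma emp_mean_bounded_likely:
  assumes iid: "iid_sample M X P" and F: "integrable P F" "\<And>x. 0 \<le> F x" and "0 < \<epsilon>"
  shows "\<exists>C0. \<forall>C\<ge>C0. likely M \<epsilon> (\<lambda>n \<omega>. emp_mean (X \<omega>) n F \<le> C)"
proof (intro exI allI impI)
  fix C assume C: "max 1 (integral\<^sup>L P F / \<epsilon>) \<le> C"
  have int: "integrable M (\<lambda>\<omega>. emp_mean (X \<omega>) n F)" for n
    unfolding emp_mean_def using iid_sample_integral(1)[OF iid F(1)] by simp
  have "(\<integral>\<omega>. emp_mean (X \<omega>) n F \<partial>M) \<le> C * \<epsilon>" if "n > 0" for n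
  proof -
    have "(\<integral>\<omega>. emp_mean (X \<omega>) n F \<partial>M) = integral\<^sup>L P F"
      unfolding emp_mean_def using iid_sample_integral[OF iid F(1)] that by simp
    also have "\<dots> \<le> C * \<epsilon>" using C \<open>0 < \<epsilon>\<close> by (simp add: field_simps)
    finally show ?thesis .
  qed
  then have ev: "\<forall>\<^sub>F n in sequentially. (\<integral>\<omega>. emp_mean (X \<omega>) n F \<partial>M) \<le> C * \<epsilon>"
    by (intro eventually_sequentiallyI[of 1]) simp
  have "likely M \<epsilon> (\<lambda>n \<omega>. emp_mean (X \<omega>) n F < C)"
    using C by (intro likely_Markov[OF iid_sampleD(1)[OF iid] int _ ev])
      (auto simp: emp_mean_def F intro!: divide_nonneg_nonneg sum_nonneg)
  then show "likely M \<epsilon> (\<lambda>n \<omega>. emp_mean (X \<omega>) n F \<le> C)"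
    by (rule likely_mono[OF iid_sampleD(1)[OF iid] _ order_refl always_eventually]) simp
qed

text \<open>Chebyshev's inequality: the cross terms of the squared sum vanish by independence, so that \<open>n\<close> times
  the squared sample mean has constant expectation.\<close>

lemma emp_mean_sqrt_n_likely:
  assumes iid: "iid_sample M X P" and f: "f \<in> borel_measurable P" "integrable P (\<lambda>x. (f x)\<^sup>2)"
    and mean: "integral\<^sup>L P f = 0" and "0 < \<epsilon>"
  shows "\<exists>C0. \<forall>C\<ge>C0. likely M \<epsilon> (\<lambda>n \<omega>. \<bar>emp_mean (X \<omega>) n f\<bar> \<le> C / sqrt (real n))"
proof -
  interpret M: prob_space M by (rule iid_sampleD(1)[OF iid])
  interpret P: prob_space P by (rule iid_sampleD(4)[OF iid])
  note [measurable] = iid_sampleD(2)[OF iid] f(1)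
  have fint: "integrable P f" by (rule P.square_integrable_imp_integrable[OF f])
  define Y where "Y i \<omega> = f (X \<omega> i)" for i \<omega>
  have Yint: "integrable M (Y i)" "M.expectation (Y i) = 0" for i
    using iid_sample_integral[OF iid fint, of i] mean unfolding Y_def by simp_all
  have Y2: "integrable M (\<lambda>\<omega>. Y i \<omega> * Y i \<omega>)" "(\<integral>\<omega>. Y i \<omega> * Y i \<omega> \<partial>M) = (\<integral>x. (f x)\<^sup>2 \<partial>P)" for i
    using iid_sample_integral[OF iid f(2), of i] unfolding Y_def by (simp_all add: power2_eq_square)
  have indep: "M.indep_vars (\<lambda>_. borel) Y UNIV"
    using iid M.indep_vars_compose2[of "\<lambda>_. P" "\<lambda>i \<omega>. X \<omega> i" UNIV "\<lambda>_. f" "\<lambda>_. borel"]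
    unfolding iid_sample_def Y_def by auto
  have cross: "integrable M (\<lambda>\<omega>. Y i \<omega> * Y j \<omega>) \<and> (\<integral>\<omega>. Y i \<omega> * Y j \<omega> \<partial>M) = 0" if "i \<noteq> j" for i j
  proof -
    have ij: "M.indep_vars (\<lambda>_. borel) Y {i, j}" by (rule M.indep_vars_subset[OF indep]) simp
    have "integrable M (\<lambda>\<omega>. \<Prod>k\<in>{i, j}. Y k \<omega>)"
      by (rule M.indep_vars_integrable[OF _ ij]) (auto intro: Yint)
    moreover have "(\<integral>\<omega>. (\<Prod>k\<in>{i, j}. Y k \<omega>) \<partial>M) = (\<Prod>k\<in>{i, j}. M.expectation (Y k))"
      by (rule M.indep_vars_lebesgue_integral[OF _ ij]) (auto intro: Yint)
    ultimately show ?thesis using that Yint(2) by simp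
  qed
  define V where "V = (\<integral>x. (f x)\<^sup>2 \<partial>P)"
  define Q where "Q n \<omega> = real n * (emp_mean (X \<omega>) n f)\<^sup>2" for n \<omega>
  have Q: "Q n \<omega> = (\<Sum>i<n. \<Sum>j<n. Y i \<omega> * Y j \<omega>) / real n" for n \<omega>
    unfolding Q_def emp_mean_def Y_def by (simp add: power2_eq_square sum_product)
  have Yij: "integrable M (\<lambda>\<omega>. Y i \<omega> * Y j \<omega>)" "(\<integral>\<omega>. Y i \<omega> * Y j \<omega> \<partial>M) = (if i = j then V else 0)" for i j
    using Y2 cross[of i j] unfolding V_def by (cases "i = j"; simp)+
  have Qint: "integrable M (Q n)" for n
    unfolding Q using Yij(1) by (intro integrable_divide_zero Bochner_Integration.integrable_sum impI)
  have EQ: "integral\<^sup>L M (Q n) = V" if "n > 0" for n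
  proof -
    have "integral\<^sup>L M (Q n) = (\<Sum>i<n. \<Sum>j<n. if i = j then V else 0) / real n"
      unfolding Q using Yij by simp
    also have "(\<Sum>i<n. \<Sum>j<n. if i = j then V else 0) = real n * V" by simp
    finally show ?thesis using that by simp
  qed
  show ?thesis
  proof (intro exI allI impI)
    fix C assume C: "max 1 (V / \<epsilon>) \<le> C"
    have "1 \<le> C" using C by simp
    have "likely M \<epsilon> (\<lambda>n \<omega>. Q n \<omega> < C\<^sup>2)"
    proof (rule likely_Markov[OF iid_sampleD(1)[OF iid] Qint])
      have "V \<le> C * \<epsilon>" using C \<open>0 < \<epsilon>\<close> by (simp add: field_simps)
      also have "\<dots> \<le> C\<^sup>2 * \<epsilon>"
        using \<open>1 \<le> C\<close> \<open>0 < \<epsilon>\<close> by (intro mult_right_mono self_le_power) auto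
      finally show "\<forall>\<^sub>F n in sequentially. integral\<^sup>L M (Q n) \<le> C\<^sup>2 * \<epsilon>"
        using EQ by (intro eventually_sequentiallyI[of 1]) simp
    qed (use \<open>1 \<le> C\<close> in \<open>auto simp: Q_def\<close>)
    then show "likely M \<epsilon> (\<lambda>n \<omega>. \<bar>emp_mean (X \<omega>) n f\<bar> \<le> C / sqrt (real n))"
    proof (rule likely_mono[OF iid_sampleD(1)[OF iid] _ order_refl], intro eventually_sequentiallyI[of 1] ballI impI)
      fix n \<omega> assume n: "1 \<le> (n::nat)" and "Q n \<omega> < C\<^sup>2"
      then have "(sqrt (real n) * \<bar>emp_mean (X \<omega>) n f\<bar>)\<^sup>2 \<le> C\<^sup>2"
        unfolding Q_def by (simp add: power_mult_distrib)
      then have "sqrt (real n) * \<bar>emp_mean (X \<omega>) n f\<bar> \<le> C"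
        by (rule power2_le_imp_le) (use \<open>1 \<le> C\<close> in simp)
      then show "\<bar>emp_mean (X \<omega>) n f\<bar> \<le> C / sqrt (real n)"
        using n by (simp add: field_simps)
    qed
  qed
qed

lemma iid_sample_path_law:
  assumes "iid_sample M X P"
  shows "X \<in> measurable M (PiM UNIV (\<lambda>_. P))" "distr M (PiM UNIV (\<lambda>_. P)) X = PiM UNIV (\<lambda>_. P)"
proof -
  interpret M: prob_space M by (rule iid_sampleD(1)[OF assms])
  show "X \<in> measurable M (PiM UNIV (\<lambda>_. P))"
    using iid_sampleD(2)[OF assms] by (intro measurable_PiM_single') (auto dest: measurable_space)
  have "M.indep_vars (\<lambda>_. P) (\<lambda>i \<omega>. X \<omega> i) UNIV" using assms unfolding iid_sample_def by simp
  then show "distr M (PiM UNIV (\<lambda>_. P)) X = PiM UNIV (\<lambda>_. P)"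
    using iid_sampleD(2,3)[OF assms]
    by (subst (asm) M.indep_vars_iff_distr_eq_PiM) (simp_all add: restrict_UNIV)
qed

text \<open>Measurable covers in path space pull back to measurable covers, and the pull-back preserves
  probabilities because the path has the product law. The pulled-back cover need not be the best one,
  which is why outer probabilities satisfy an inequality only.\<close>

lemma likely_path:
  assumes iid: "iid_sample M X P" and "likely (PiM UNIV (\<lambda>_. P)) \<epsilon> G"
  shows "likely M \<epsilon> (\<lambda>n \<omega>. G n (X \<omega>))"
  unfolding likely_def
proof (rule eventually_mono[OF assms(2)[unfolded likely_def]])
  let ?D = "PiM UNIV (\<lambda>_::nat. P)"
  note X = iid_sample_path_law[OF iid]
  interpret M: prob_space M by (rule iid_sampleD(1)[OF iid])
  interpret D: prob_space ?D using M.prob_space_distr[OF X(1)] X(2) by simp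
  fix n assume n: "outer_prob ?D {d \<in> space ?D. \<not> G n d} \<le> \<epsilon>"
  show "outer_prob M {\<omega>\<in>space M. \<not> G n (X \<omega>)} \<le> \<epsilon>"
  proof (rule field_le_epsilon)
    fix e :: real assume "0 < e"
    then obtain B where B: "B \<in> sets ?D" "{d \<in> space ?D. \<not> G n d} \<subseteq> B" "D.prob B < \<epsilon> + e"
      using D.outer_prob_cover[of "{d \<in> space ?D. \<not> G n d}" "\<epsilon> + e"] n by auto
    have "outer_prob M {\<omega>\<in>space M. \<not> G n (X \<omega>)} \<le> M.prob (X -` B \<inter> space M)"
      using B X(1) by (intro M.outer_prob_le measurable_sets[OF X(1)]) (auto dest: measurable_space)
    also have "\<dots> = D.prob B" using measure_distr[OF X(1) B(1)] X(2) by simp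
    finally show "outer_prob M {\<omega>\<in>space M. \<not> G n (X \<omega>)} \<le> \<epsilon> + e" using B(3) by simp
  qed
qed

lemma ell_infty_iff:
  "z \<in> mspace (ell_infty F) \<longleftrightarrow> z \<in> extensional F \<and> bounded (z ` F)"
  by (auto simp: ell_infty_def Met_TC.fspace_def)

lemma ell_infty_dist_upper:
  assumes "y \<in> mspace (ell_infty F)" "z \<in> mspace (ell_infty F)" "f \<in> F"
  shows "\<bar>y f - z f\<bar> \<le> mdist (ell_infty F) y z"
proof -
  have yz: "y \<in> Met_TC.fspace F" "z \<in> Met_TC.fspace F" using assms(1,2) unfolding ell_infty_def by auto
  have "dist (y f) (z f) \<le> Sup ((\<lambda>u. dist (y u) (z u)) ` F)"
    using Met_TC.bdd_above_dist[OF yz] assms(3) by (intro cSUP_upper) force+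
  then show ?thesis using yz assms(3) by (auto simp: ell_infty_def Met_TC.fdist_def dist_real_def)
qed

text \<open>Weak convergence to a tight law bounds the empirical process uniformly over the class: the limit
  puts mass close to one on a compact, hence bounded, set, and the distance to the origin clipped
  between the radius of that set and the radius plus one is an admissible test function.\<close>

lemma P_Donsker_likely_bounded:
  assumes iid: "iid_sample M X P" and Donsker: "P_Donsker P F" and "0 < \<epsilon>"
  shows "\<exists>C0. \<forall>C\<ge>C0. likely M \<epsilon> (\<lambda>n \<omega>. \<forall>f\<in>F. \<bar>emp_process P (X \<omega>) n f\<bar> \<le> C)"
proof -
  let ?D = "PiM UNIV (\<lambda>_::nat. P)"
  let ?m = "ell_infty F"
  let ?G = "\<lambda>d n. restrict (emp_process P d n) F"
  interpret M: prob_space M by (rule iid_sampleD(1)[OF iid])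
  interpret D: prob_space ?D
    using M.prob_space_distr[OF iid_sample_path_law(1)[OF iid]] iid_sample_path_law(2)[OF iid] by simp
  define z0 where "z0 = (\<lambda>f\<in>F. 0::real)"
  have z0: "z0 \<in> mspace ?m"
    unfolding ell_infty_iff z0_def by (auto intro!: finite_imp_bounded intro: finite_subset[of _ "{0}"])
  obtain L where tight: "tight_borel_law ?m L" and
    conv: "\<And>h. continuous_map (mtopology_of ?m) euclideanreal h \<Longrightarrow> bounded (range h) \<Longrightarrow>
           (\<lambda>n. outer_expectation ?D (\<lambda>d. h (?G d n))) \<longlonglongrightarrow> (\<integral>z. h z \<partial>L)"
    using Donsker unfolding P_Donsker_def by blast
  interpret L: prob_space L using tight unfolding tight_borel_law_def by simp
  obtain K where K: "compactin (mtopology_of ?m) K" "K \<in> sets L" "measure L K \<ge> 1 - \<epsilon> / 2"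
    using tight half_gt_zero[OF \<open>0 < \<epsilon>\<close>] unfolding tight_borel_law_def by blast
  have cont: "continuous_map (mtopology_of ?m) euclideanreal (\<lambda>z. mdist ?m z0 z)"
    by (intro continuous_intros) (simp_all add: z0)
  have "compact ((\<lambda>z. mdist ?m z0 z) ` K)"
    using image_compactin[OF K(1) cont] by simp
  from compact_imp_bounded[OF this] obtain R where "\<And>z. z \<in> K \<Longrightarrow> \<bar>mdist ?m z0 z\<bar> \<le> R"
    unfolding bounded_real by blast
  then have R: "\<And>z. z \<in> K \<Longrightarrow> mdist ?m z0 z \<le> R" by (meson abs_le_D1)
  define h where "h z = min 1 (max 0 (mdist ?m z0 z - R))" for z
  have h01: "0 \<le> h z" "h z \<le> 1" for z unfolding h_def by auto
  have "continuous_map (mtopology_of ?m) euclideanreal h"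
    unfolding h_def by (intro continuous_map_real_min continuous_map_real_max continuous_map_diff cont) auto
  moreover have "bounded (range h)" unfolding bounded_iff using h01 by (auto intro!: exI[of _ 1])
  ultimately have lim: "(\<lambda>n. outer_expectation ?D (\<lambda>d. h (?G d n))) \<longlonglongrightarrow> (\<integral>z. h z \<partial>L)"
    by (rule conv)
  have "(\<integral>z. h z \<partial>L) \<le> \<epsilon> / 2"
  proof (cases "integrable L h")
    case True
    have "(\<integral>z. h z \<partial>L) \<le> (\<integral>z. indicator (space L - K) z \<partial>L)"
    proof (rule integral_mono[OF True])
      show "integrable L (indicator (space L - K) :: _ \<Rightarrow> real)"
        using K(2) by (simp add: integrable_indicator_iff L.emeasure_eq_measure)
      fix z assume "z \<in> space L"
      then show "h z \<le> indicator (space L - K) z" using R h01(2)[of z]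
        by (cases "z \<in> K") (auto simp: h_def)
    qed
    also have "\<dots> = 1 - measure L K" using K(2) by (simp add: L.prob_compl)
    finally show ?thesis using K(3) by simp
  qed (use \<open>0 < \<epsilon>\<close> in \<open>simp add: not_integrable_integral_eq\<close>)
  then have "(\<integral>z. h z \<partial>L) < \<epsilon>" using \<open>0 < \<epsilon>\<close> by simp
  with lim have "\<forall>\<^sub>F n in sequentially. outer_expectation ?D (\<lambda>d. h (?G d n)) < \<epsilon>"
    by (rule order_tendstoD)
  then have "likely ?D \<epsilon> (\<lambda>n d. h (?G d n) < 1)"
    unfolding likely_def
  proof (rule eventually_mono)
    fix n assume "outer_expectation ?D (\<lambda>d. h (?G d n)) < \<epsilon>"
    moreover have "{integral\<^sup>L ?D U |U. integrable ?D U \<and> (\<forall>d\<in>space ?D. h (?G d n) \<le> U d)} \<noteq> {}"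
    proof -
      have "integrable ?D (\<lambda>_. 1::real) \<and> (\<forall>d\<in>space ?D. h (?G d n) \<le> 1)" using h01(2) by simp
      then show ?thesis by blast
    qed
    ultimately have "\<exists>u\<in>{integral\<^sup>L ?D U |U. integrable ?D U \<and> (\<forall>d\<in>space ?D. h (?G d n) \<le> U d)}. u < \<epsilon>"
      unfolding outer_expectation_def by (intro cInf_lessD)
    then obtain U where U: "integrable ?D U" "\<And>d. d \<in> space ?D \<Longrightarrow> h (?G d n) \<le> U d"
        "integral\<^sup>L ?D U < \<epsilon>"
      by blast
    have [measurable]: "U \<in> borel_measurable ?D" using U(1) by simp
    have U0: "0 \<le> U d" if "d \<in> space ?D" for d using U(2)[OF that] h01(1) by (meson order_trans)
    have "{d \<in> space ?D. \<not> h (?G d n) < 1} \<subseteq> {d \<in> space ?D. 1 \<le> U d}"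
    proof clarify
      fix d assume "d \<in> space ?D" "\<not> h (?G d n) < 1"
      then show "1 \<le> U d" using U(2)[of d] by linarith
    qed
    then have "outer_prob ?D {d \<in> space ?D. \<not> h (?G d n) < 1} \<le> D.prob {d \<in> space ?D. 1 \<le> U d}"
      by (intro D.outer_prob_le) measurable
    also have "\<dots> \<le> integral\<^sup>L ?D U / 1"
      using U(1) U0 by (intro integral_Markov_inequality_measure[where A="space ?D"] AE_I2) simp_all
    finally show "outer_prob ?D {d \<in> space ?D. \<not> h (?G d n) < 1} \<le> \<epsilon>" using U(3) by simp
  qed
  then have *: "likely M \<epsilon> (\<lambda>n \<omega>. h (?G (X \<omega>) n) < 1)"
    by (rule likely_path[OF iid])
  have "AE x in P. bounded ((\<lambda>f. f x - (\<integral>y. f y \<partial>P)) ` F)"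
    using Donsker unfolding P_Donsker_def by blast
  then have **: "likely M 0 (\<lambda>n \<omega>. \<forall>i. bounded ((\<lambda>f. f (X \<omega> i) - (\<integral>y. f y \<partial>P)) ` F))"
    by (intro likely_AE[OF iid_sampleD(1)[OF iid]] iid_sample_AE[OF iid]) auto
  show ?thesis
  proof (intro exI allI impI)
    fix C assume "R + 1 \<le> C"
    show "likely M \<epsilon> (\<lambda>n \<omega>. \<forall>f\<in>F. \<bar>emp_process P (X \<omega>) n f\<bar> \<le> C)"
    proof (rule likely_mono[OF iid_sampleD(1)[OF iid] likely_conj[OF iid_sampleD(1)[OF iid] * **] _ always_eventually],
        simp, intro allI ballI impI)
      fix n \<omega> f
      assume a: "h (?G (X \<omega>) n) < 1 \<and> (\<forall>i. bounded ((\<lambda>f. f (X \<omega> i) - (\<integral>y. f y \<partial>P)) ` F))" and f: "f \<in> F"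
      from a have "\<forall>i. \<exists>B. \<forall>f\<in>F. \<bar>f (X \<omega> i) - (\<integral>y. f y \<partial>P)\<bar> \<le> B" unfolding bounded_real by simp
      then obtain B where B: "\<And>i f. f \<in> F \<Longrightarrow> \<bar>f (X \<omega> i) - (\<integral>y. f y \<partial>P)\<bar> \<le> B i" by metis
      have "\<bar>emp_process P (X \<omega>) n f\<bar> \<le> (\<Sum>i<n. B i) / sqrt (real n)" if "f \<in> F" for f
      proof -
        have "\<bar>\<Sum>i<n. f (X \<omega> i) - (\<integral>y. f y \<partial>P)\<bar> \<le> (\<Sum>i<n. B i)"
          by (rule order_trans[OF sum_abs]) (intro sum_mono B that)
        then show ?thesis unfolding emp_process_def by (simp add: divide_right_mono)
      qed
      then have G: "?G (X \<omega>) n \<in> mspace ?m"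
        unfolding ell_infty_iff bounded_real by (intro conjI exI[of _ "(\<Sum>i<n. B i) / sqrt (real n)"]) auto
      have "\<bar>z0 f - ?G (X \<omega>) n f\<bar> \<le> mdist ?m z0 (?G (X \<omega>) n)"
        by (rule ell_infty_dist_upper[OF z0 G f])
      also have "\<dots> \<le> R + 1" using a unfolding h_def by auto
      finally show "\<bar>emp_process P (X \<omega>) n f\<bar> \<le> C" using f \<open>R + 1 \<le> C\<close> by (simp add: z0_def)
    qed
  qed
qed

section \<open>Normal approximation of a density that is nearly Gaussian\<close>

lemma measure_density_eq_integral:
  assumes "integrable M f" "AE x in M. 0 \<le> f x" "A \<in> sets M"
  shows "measure (density M (\<lambda>x. ennreal (f x))) A = (\<integral>x. indicator A x * f x \<partial>M)"
proof -
  have [measurable]: "f \<in> borel_measurable M" "A \<in> sets M" using assms by auto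
  have i: "integrable M (\<lambda>x. indicator A x * f x)"
    using integrable_mult_indicator[OF assms(3,1)] by simp
  have "emeasure (density M (\<lambda>x. ennreal (f x))) A = (\<integral>\<^sup>+x. ennreal (indicator A x * f x) \<partial>M)"
    by (subst emeasure_density) (auto intro!: nn_integral_cong split: split_indicator)
  also have "\<dots> = ennreal (\<integral>x. indicator A x * f x \<partial>M)"
    using assms(2) by (intro nn_integral_eq_integral[OF i]) auto
  moreover have "0 \<le> (\<integral>x. indicator A x * f x \<partial>M)"
    by (rule integral_nonneg_AE) (use assms(2) in auto)
  ultimately show ?thesis by (simp add: measure_def)
qed

lemma normal_density_cdf:
  assumes "0 < \<sigma>"
  shows "(\<integral>x. indicator {x. (x - m) / \<sigma> \<le> \<xi>} x * normal_density m \<sigma> x \<partial>lborel)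
    = cdf std_normal_distribution \<xi>"
proof -
  have "(\<integral>x. indicator {x. (x - m) / \<sigma> \<le> \<xi>} x * normal_density m \<sigma> x \<partial>lborel)
      = \<sigma> * (\<integral>z. indicator {..\<xi>} z * normal_density m \<sigma> (m + \<sigma> * z) \<partial>lborel)"
    using lborel_integral_real_affine[of \<sigma> "\<lambda>x. indicator {x. (x - m) / \<sigma> \<le> \<xi>} x * normal_density m \<sigma> x" m]
      assms by (simp add: indicator_def)
  also have "\<dots> = (\<integral>z. indicator {..\<xi>} z * std_normal_density z \<partial>lborel)"
    using assms by (subst integral_mult_right_zero[symmetric], intro Bochner_Integration.integral_cong)
      (simp_all add: normal_density_def power_mult_distrib real_sqrt_mult)
  also have "\<dots> = cdf std_normal_distribution \<xi>"
    unfolding cdf_def by (subst measure_density_eq_integral) simp_all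
  finally show ?thesis .
qed

text \<open>Distances are measured in \<open>L\<^sub>1\<close> before normalisation: if an unnormalised density \<open>g\<close> is within
  \<open>e\<close> of \<open>Z\<close> times a normal density, then numerator and denominator of every posterior probability are
  both off by at most \<open>e\<close>, uniformly in the set.\<close>

lemma normalized_L1_close_imp_cdf_close:
  fixes g :: "real \<Rightarrow> real"
  assumes \<Theta>: "\<Theta> \<in> sets lebesgue" and g: "integrable (lebesgue_on \<Theta>) g" "\<And>\<theta>. \<theta> \<in> \<Theta> \<Longrightarrow> 0 \<le> g \<theta>"
    and \<sigma>: "0 < \<sigma>" and e: "e < Z"
    and L1: "(\<integral>\<theta>. \<bar>indicator \<Theta> \<theta> * g \<theta> - Z * normal_density m \<sigma> \<theta>\<bar> \<partial>lebesgue) \<le> e"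
  shows "\<bar>measure (density (lebesgue_on \<Theta>) (\<lambda>\<theta>. ennreal (g \<theta> / integral\<^sup>L (lebesgue_on \<Theta>) g)))
      {\<theta> \<in> \<Theta>. (\<theta> - m) / \<sigma> \<le> \<xi>} - cdf std_normal_distribution \<xi>\<bar> \<le> 2 * e / (Z - e)"
proof -
  define gi where "gi \<theta> = indicator \<Theta> \<theta> * g \<theta>" for \<theta>
  define q where "q \<theta> = Z * normal_density m \<sigma> \<theta>" for \<theta>
  define S where "S = {\<theta>. (\<theta> - m) / \<sigma> \<le> \<xi>}"
  have "S \<in> sets borel" unfolding S_def by measurable
  then have S: "S \<in> sets lebesgue" by auto
  have gi: "integrable lebesgue gi"
    using g(1) integrable_restrict_space[of \<Theta> lebesgue g] \<Theta> unfolding gi_def by simp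
  have nd: "integrable lebesgue (normal_density m \<sigma>)"
    using integrable_completion[of "normal_density m \<sigma>" lborel] integrable_normal_density[OF \<sigma>, of m] by simp
  then have q: "integrable lebesgue q" unfolding q_def by simp
  have close: "\<bar>(\<integral>\<theta>. indicator A \<theta> * gi \<theta> \<partial>lebesgue) - (\<integral>\<theta>. indicator A \<theta> * q \<theta> \<partial>lebesgue)\<bar> \<le> e"
    if "A \<in> sets lebesgue" for A
  proof -
    have i: "integrable lebesgue (\<lambda>\<theta>. indicator A \<theta> * gi \<theta>)" "integrable lebesgue (\<lambda>\<theta>. indicator A \<theta> * q \<theta>)"
      using integrable_mult_indicator[OF that gi] integrable_mult_indicator[OF that q] by simp_all
    have "\<bar>(\<integral>\<theta>. indicator A \<theta> * gi \<theta> \<partial>lebesgue) - (\<integral>\<theta>. indicator A \<theta> * q \<theta> \<partial>lebesgue)\<bar>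
        = \<bar>\<integral>\<theta>. indicator A \<theta> * gi \<theta> - indicator A \<theta> * q \<theta> \<partial>lebesgue\<bar>"
      using i by simp
    also have "\<dots> \<le> (\<integral>\<theta>. \<bar>indicator A \<theta> * gi \<theta> - indicator A \<theta> * q \<theta>\<bar> \<partial>lebesgue)"
      by (rule integral_abs_bound)
    also have "\<dots> \<le> (\<integral>\<theta>. \<bar>gi \<theta> - q \<theta>\<bar> \<partial>lebesgue)"
      using i gi q by (intro integral_mono integrable_abs Bochner_Integration.integrable_diff)
        (auto split: split_indicator)
    also have "\<dots> \<le> e" using L1 unfolding gi_def q_def .
    finally show ?thesis .
  qed
  define G where "G = integral\<^sup>L (lebesgue_on \<Theta>) g"
  define p where "p = cdf std_normal_distribution \<xi>"
  have "(\<integral>\<theta>. indicator S \<theta> * normal_density m \<sigma> \<theta> \<partial>lebesgue) = p"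
    unfolding p_def S_def using normal_density_cdf[OF \<sigma>, of m \<xi>]
    by (subst integral_completion) simp_all
  then have qS: "(\<integral>\<theta>. indicator S \<theta> * q \<theta> \<partial>lebesgue) = Z * p"
    unfolding q_def by (simp add: mult.left_commute)
  have "(\<integral>\<theta>. normal_density m \<sigma> \<theta> \<partial>lebesgue) = 1"
    using \<sigma> by (subst integral_completion) simp_all
  then have qU: "(\<integral>\<theta>. q \<theta> \<partial>lebesgue) = Z" unfolding q_def by simp
  have G: "G = (\<integral>\<theta>. gi \<theta> \<partial>lebesgue)"
    unfolding G_def gi_def using integral_restrict_space[of \<Theta> lebesgue g] \<Theta> by simp
  have "\<bar>G - Z\<bar> \<le> e" using close[of UNIV] qU G by simp
  then have Gpos: "Z - e \<le> G" "0 < G" using e by linarith+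
  have S\<Theta>: "S \<inter> \<Theta> \<in> sets (lebesgue_on \<Theta>)"
    using S \<Theta> by (auto simp: sets_restrict_space)
  have "measure (density (lebesgue_on \<Theta>) (\<lambda>\<theta>. ennreal (g \<theta> / G))) (S \<inter> \<Theta>)
      = (\<integral>\<theta>. indicator (S \<inter> \<Theta>) \<theta> * (g \<theta> / G) \<partial>lebesgue_on \<Theta>)"
    using g Gpos S\<Theta> by (intro measure_density_eq_integral) auto
  also have "\<dots> = (\<integral>\<theta>. indicator S \<theta> * gi \<theta> / G \<partial>lebesgue)"
    using \<Theta> by (subst integral_restrict_space)
      (auto simp: gi_def intro!: Bochner_Integration.integral_cong split: split_indicator)
  also have "\<dots> = (\<integral>\<theta>. indicator S \<theta> * gi \<theta> \<partial>lebesgue) / G" by simp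
  finally have m: "measure (density (lebesgue_on \<Theta>) (\<lambda>\<theta>. ennreal (g \<theta> / G))) (S \<inter> \<Theta>)
      = (\<integral>\<theta>. indicator S \<theta> * gi \<theta> \<partial>lebesgue) / G" (is "?m = ?gS / G") .
  interpret std: prob_space std_normal_distribution by (rule prob_space_normal_density) simp
  have p: "0 \<le> p" "p \<le> 1" unfolding p_def cdf_def by simp_all
  have "?gS - p * G = (?gS - Z * p) - p * (G - Z)" by (simp add: algebra_simps)
  then have "\<bar>?gS - p * G\<bar> \<le> \<bar>?gS - Z * p\<bar> + p * \<bar>G - Z\<bar>"
    using abs_triangle_ineq4[of "?gS - Z * p" "p * (G - Z)"] p(1) by (simp only: abs_mult abs_of_nonneg)
  also have "\<dots> \<le> e + 1 * e"
    using close[OF S] qS \<open>\<bar>G - Z\<bar> \<le> e\<close> p by (intro add_mono mult_mono) auto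
  finally have "\<bar>?gS - p * G\<bar> \<le> 2 * e" by simp
  then have "\<bar>?gS - p * G\<bar> / G \<le> 2 * e / G"
    using Gpos by (intro divide_right_mono) auto
  moreover have "?gS / G - p = (?gS - p * G) / G" using Gpos by (simp add: field_simps)
  ultimately have "\<bar>?gS / G - p\<bar> \<le> 2 * e / G" using Gpos by (simp add: abs_divide)
  also have "\<dots> \<le> 2 * e / (Z - e)"
    using Gpos e \<open>\<bar>G - Z\<bar> \<le> e\<close> by (intro divide_left_mono) auto
  finally have "\<bar>?m - p\<bar> \<le> 2 * e / (Z - e)" using m by simp
  moreover have "S \<inter> \<Theta> = {\<theta> \<in> \<Theta>. (\<theta> - m) / \<sigma> \<le> \<xi>}" unfolding S_def by auto
  ultimately show ?thesis unfolding G_def p_def by simp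
qed

lemma exp_eq_normal_density:
  assumes "0 < v"
  shows "exp (- (\<theta> - m)\<^sup>2 / (2 * v)) = sqrt (2 * pi * v) * normal_density m (sqrt v) \<theta>"
  using assms by (simp add: normal_density_def)

lemma poly_times_gaussian_bounded:
  fixes c :: real
  assumes "0 < c"
  shows "\<exists>B\<ge>0. \<forall>h\<ge>0. (1 + h) ^ 4 * exp (- c * h\<^sup>2) \<le> B"
proof (intro exI conjI allI impI)
  let ?B = "8 + 16 / c\<^sup>2"
  show "0 \<le> ?B" by simp
  fix h :: real assume h: "0 \<le> h"
  have "(1 + h)\<^sup>2 \<le> 2 * (1 + h\<^sup>2)" using zero_le_power2[of "h - 1"] by (simp add: power2_eq_square algebra_simps)
  then have "((1 + h)\<^sup>2)\<^sup>2 \<le> (2 * (1 + h\<^sup>2))\<^sup>2" using h by (intro power_mono) auto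
  also have "\<dots> \<le> 8 * (1 + h ^ 4)"
    using zero_le_power2[of "h\<^sup>2 - 1"] by (simp add: power2_eq_square algebra_simps power4_eq_xxxx)
  also have "\<dots> \<le> ?B * (1 + (c * h\<^sup>2)\<^sup>2 / 2)"
  proof -
    have "h ^ 4 * 8 = 16 / c\<^sup>2 * ((c * h\<^sup>2)\<^sup>2 / 2)"
      using assms by (simp add: power_mult_distrib field_simps flip: power_mult)
    moreover have "0 \<le> 8 * ((c * h\<^sup>2)\<^sup>2 / 2) + 16 / c\<^sup>2" by simp
    ultimately show ?thesis by (simp add: algebra_simps)
  qed
  also have "\<dots> \<le> ?B * exp (c * h\<^sup>2)"
  proof (rule mult_left_mono)
    have "0 \<le> c * h\<^sup>2" using assms by simp
    then show "1 + (c * h\<^sup>2)\<^sup>2 / 2 \<le> exp (c * h\<^sup>2)"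
      using exp_lower_Taylor_quadratic[of "c * h\<^sup>2"] by linarith
  qed simp
  finally have "(1 + h) ^ 4 \<le> ?B * exp (c * h\<^sup>2)" by (simp flip: power_mult)
  then show "(1 + h) ^ 4 * exp (- c * h\<^sup>2) \<le> ?B"
    by (simp add: exp_minus divide_simps)
qed

lemma abs_exp_minus_1_le: "\<bar>exp x - 1\<bar> \<le> \<bar>x\<bar> * exp \<bar>x\<bar>" for x :: real
proof (cases "0 \<le> x")
  case True
  have "(1 - x) * exp x \<le> exp (- x) * exp x"
    using exp_ge_add_one_self[of "- x"] by (intro mult_right_mono) auto
  then show ?thesis using True by (simp add: algebra_simps flip: exp_add)
next
  case False
  have "1 - exp x \<le> - x" using exp_ge_add_one_self[of x] by linarith
  also have "- x * 1 \<le> - x * exp (- x)" using False by (intro mult_left_mono) auto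
  finally show ?thesis using False by simp
qed

text \<open>The weight \<open>w\<close> plays the role of a likelihood ratio relative to the maximiser \<open>m\<close>. In the
  rescaled deviation \<open>h = \<surd>n \<bar>\<theta> - m\<bar>\<close> the error \<open>R\<close> is of order \<open>n\<^sup>-\<^sup>1\<^sup>/\<^sup>2 (1 + h)\<^sup>3\<close>.\<close>

definition nearly_gaussian_weight ::
  "real set \<Rightarrow> real \<Rightarrow> real \<Rightarrow> real \<Rightarrow> real \<Rightarrow> real \<Rightarrow> nat \<Rightarrow> real \<Rightarrow> (real \<Rightarrow> real) \<Rightarrow> bool" where
  "nearly_gaussian_weight \<Theta> I C \<delta> \<kappa> \<theta>0 n m w \<longleftrightarrow>
    \<bar>m - \<theta>0\<bar> \<le> C / sqrt n \<and>
    (\<forall>\<theta>. \<bar>\<theta> - \<theta>0\<bar> \<le> \<delta> \<longrightarrow> (\<exists>R. w \<theta> = exp (R - (n * I * (\<theta> - m)\<^sup>2) / 2) \<and> \<bar>R\<bar> \<le> C * n * (\<bar>\<theta> - m\<bar> + 1 / sqrt n) ^ 3)) \<and>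
    (\<forall>\<theta>\<in>\<Theta>. \<delta> < \<bar>\<theta> - \<theta>0\<bar> \<longrightarrow> 0 \<le> w \<theta> \<and> w \<theta> \<le> exp (- \<kappa> * n))"

text \<open>The cubic error carries a factor \<open>n\<^sup>-\<^sup>1\<^sup>/\<^sup>2\<close>; on a small neighbourhood it is moreover dominated
  by half of the quadratic term plus a constant, so that the Gaussian tail survives exponentiation. The
  polynomial factors are absorbed by giving up part of the exponent.\<close>

lemma weight_gaussian_pointwise:
  fixes \<Theta> :: "real set" and I C \<delta> \<kappa> K \<theta>0 :: real
  assumes I: "0 < I" and C: "0 \<le> C" and \<delta>: "0 < \<delta>" "24 * C * \<delta> \<le> I"
    and \<rho>: "\<forall>\<theta>\<in>\<Theta>. 0 \<le> \<rho> \<theta>" "0 < \<rho> \<theta>0" "0 \<le> K"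
      "\<forall>\<theta>. \<bar>\<theta> - \<theta>0\<bar> \<le> \<delta> \<longrightarrow> \<theta> \<in> \<Theta> \<and> \<bar>\<rho> \<theta> - \<rho> \<theta>0\<bar> \<le> K * \<bar>\<theta> - \<theta>0\<bar>"
  shows "\<exists>B\<ge>0. \<forall>n m w \<theta>. (0::nat) < n \<longrightarrow> 1 / sqrt n \<le> \<delta> \<longrightarrow> 2 * C / sqrt n \<le> \<delta> \<longrightarrow>
    nearly_gaussian_weight \<Theta> I C \<delta> \<kappa> \<theta>0 n m w \<longrightarrow>
    \<bar>indicator \<Theta> \<theta> * (\<rho> \<theta> * w \<theta>) - \<rho> \<theta>0 * exp (- (n * I * (\<theta> - m)\<^sup>2) / 2)\<bar>
      \<le> B / sqrt n * exp (- (n * I * (\<theta> - m)\<^sup>2) / 16) + exp (- \<kappa> * n) * (indicator \<Theta> \<theta> * \<rho> \<theta>)"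
proof -
  \<comment> \<open>The exponent \<open>3 I / 16 = I / 4 - I / 16\<close> is spent on polynomials in \<open>h\<close>; \<open>I / 16\<close> is kept.\<close>
  obtain A where A: "0 \<le> A" "\<And>h. 0 \<le> h \<Longrightarrow> (1 + h) ^ 4 * exp (- (3 * I / 16) * h\<^sup>2) \<le> A"
    using poly_times_gaussian_bounded[of "3 * I / 16"] I by auto
  define B1 where "B1 = (K * (1 + C) + \<rho> \<theta>0 * C) * exp (I / 4) * A"
  define B2 where "B2 = 2 * \<rho> \<theta>0 / \<delta> * A"
  have B: "0 \<le> B1" "0 \<le> B2" unfolding B1_def B2_def using A \<rho> C \<delta> by auto
  show ?thesis
  proof (intro exI[of _ "B1 + B2"] conjI allI impI)
    show "0 \<le> B1 + B2" using B by simp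
    fix n :: nat and m w \<theta>
    assume n: "0 < n" "1 / sqrt n \<le> \<delta>" "2 * C / sqrt n \<le> \<delta>"
      and "nearly_gaussian_weight \<Theta> I C \<delta> \<kappa> \<theta>0 n m w"
    then have m: "\<bar>m - \<theta>0\<bar> \<le> C / sqrt n"
      and near: "\<bar>\<theta> - \<theta>0\<bar> \<le> \<delta> \<longrightarrow> (\<exists>R. w \<theta> = exp (R - (n * I * (\<theta> - m)\<^sup>2) / 2) \<and> \<bar>R\<bar> \<le> C * n * (\<bar>\<theta> - m\<bar> + 1 / sqrt n) ^ 3)"
      and far: "\<theta> \<in> \<Theta> \<longrightarrow> \<delta> < \<bar>\<theta> - \<theta>0\<bar> \<longrightarrow> 0 \<le> w \<theta> \<and> w \<theta> \<le> exp (- \<kappa> * n)"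
      unfolding nearly_gaussian_weight_def by auto
    define h where "h = sqrt n * \<bar>\<theta> - m\<bar>"
    have sn: "0 < sqrt (real n)" using n(1) by simp
    have h: "0 \<le> h" "\<bar>\<theta> - m\<bar> = h / sqrt n" unfolding h_def using sn by auto
    have hsq: "n * (\<theta> - m)\<^sup>2 = h\<^sup>2" unfolding h_def by (simp add: power_mult_distrib)
    then have nI: "n * I * (\<theta> - m)\<^sup>2 = I * h\<^sup>2" by (simp add: mult.commute mult.left_commute)
    have split: "exp (- (I / 4) * h\<^sup>2) = exp (- (3 * I / 16) * h\<^sup>2) * exp (- (I * h\<^sup>2) / 16)"
      by (simp add: field_simps flip: exp_add)
    have tail: "0 \<le> exp (- \<kappa> * n) * (indicator \<Theta> \<theta> * \<rho> \<theta>)"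
      using \<rho>(1) by (auto split: split_indicator)
    have "\<bar>indicator \<Theta> \<theta> * (\<rho> \<theta> * w \<theta>) - \<rho> \<theta>0 * exp (- (I * h\<^sup>2) / 2)\<bar>
        \<le> (B1 + B2) / sqrt n * exp (- (I * h\<^sup>2) / 16) + exp (- \<kappa> * n) * (indicator \<Theta> \<theta> * \<rho> \<theta>)"
    proof (cases "\<bar>\<theta> - \<theta>0\<bar> \<le> \<delta>")
      case True
      then obtain R where R: "w \<theta> = exp (R - I * h\<^sup>2 / 2)" "\<bar>R\<bar> \<le> C * n * (\<bar>\<theta> - m\<bar> + 1 / sqrt n) ^ 3"
        using near nI by auto
      have "n * (\<bar>\<theta> - m\<bar> + 1 / sqrt n) ^ 3 = (h + 1) ^ 3 / sqrt n"
      proof -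
        have "\<bar>\<theta> - m\<bar> + 1 / sqrt n = (h + 1) / sqrt n" by (simp add: h(2) add_divide_distrib)
        moreover have "sqrt n ^ 3 = n * sqrt n" by (simp add: power3_eq_cube)
        ultimately show ?thesis using sn n(1) by (simp add: power_divide)
      qed
      then have R1: "\<bar>R\<bar> \<le> C * ((h + 1) ^ 3 / sqrt n)" using R(2) by (simp add: mult.assoc)
      have "h \<le> sqrt n * (2 * \<delta>)"
        unfolding h_def using True m n(3) C \<delta> by (intro mult_left_mono) (auto simp: field_simps)
      then have "(h + 1) / sqrt n \<le> 3 * \<delta>" using n(2) sn by (simp add: field_simps)
      then have "C * ((h + 1)\<^sup>2 * ((h + 1) / sqrt n)) \<le> C * ((h + 1)\<^sup>2 * (3 * \<delta>))"
        using C by (intro mult_left_mono) auto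
      also have "\<dots> = C * \<delta> * 3 * (h + 1)\<^sup>2" by simp
      also have "\<dots> \<le> (I / 24) * 3 * (2 * (h\<^sup>2 + 1))"
      proof (intro mult_mono)
        show "(h + 1)\<^sup>2 \<le> 2 * (h\<^sup>2 + 1)" using zero_le_power2[of "h - 1"] by (simp add: power2_eq_square algebra_simps)
      qed (use \<delta> C I in auto)
      also have "\<dots> = I / 4 * (h\<^sup>2 + 1)" by (simp add: field_simps)
      finally have "C * ((h + 1)\<^sup>2 * ((h + 1) / sqrt n)) \<le> I / 4 * (h\<^sup>2 + 1)" .
      moreover have "(h + 1)\<^sup>2 * ((h + 1) / sqrt n) = (h + 1) ^ 3 / sqrt n"
        by (simp add: power2_eq_square power3_eq_cube)
      ultimately have "C * ((h + 1) ^ 3 / sqrt n) \<le> I / 4 * (h\<^sup>2 + 1)" by (simp only:)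
      with R1 have R2: "\<bar>R\<bar> \<le> I / 4 * (h\<^sup>2 + 1)" by (rule order_trans)
      have E: "exp (\<bar>R\<bar> - I * h\<^sup>2 / 2) \<le> exp (I / 4) * exp (- (I / 4) * h\<^sup>2)"
        using R2 by (simp add: field_simps flip: exp_add)
      have w1: "w \<theta> \<le> exp (\<bar>R\<bar> - I * h\<^sup>2 / 2)" unfolding R(1) by simp
      have ea: "exp (r - I * h\<^sup>2 / 2) = exp (- (I * h\<^sup>2) / 2) * exp r" for r
        by (simp flip: exp_add)
      have "w \<theta> - exp (- (I * h\<^sup>2) / 2) = exp (- (I * h\<^sup>2) / 2) * (exp R - 1)"
        unfolding R(1) ea by (simp only: right_diff_distrib mult_1_right)
      then have "\<bar>w \<theta> - exp (- (I * h\<^sup>2) / 2)\<bar> \<le> exp (- (I * h\<^sup>2) / 2) * (\<bar>R\<bar> * exp \<bar>R\<bar>)"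
        using abs_exp_minus_1_le[of R] by (simp add: abs_mult)
      also have "\<dots> = \<bar>R\<bar> * exp (\<bar>R\<bar> - I * h\<^sup>2 / 2)" unfolding ea by simp
      finally have w2: "\<bar>w \<theta> - exp (- (I * h\<^sup>2) / 2)\<bar> \<le> \<bar>R\<bar> * exp (\<bar>R\<bar> - I * h\<^sup>2 / 2)" .
      have "\<bar>\<theta> - \<theta>0\<bar> \<le> h / sqrt n + C / sqrt n" using m h(2) by linarith
      also have "\<dots> \<le> (1 + C) * (h + 1) ^ 3 / sqrt n"
      proof -
        have "h + C \<le> (1 + C) * (h + 1)" using h(1) C by (simp add: algebra_simps)
        also have "\<dots> \<le> (1 + C) * (h + 1) ^ 3"
          using h(1) C self_le_power[of "h + 1" 3] by (intro mult_left_mono) auto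
        finally show ?thesis using sn by (simp add: divide_right_mono flip: add_divide_distrib)
      qed
      finally have d: "\<bar>\<theta> - \<theta>0\<bar> \<le> (1 + C) * ((h + 1) ^ 3 / sqrt n)" by simp
      have \<rho>\<theta>: "\<theta> \<in> \<Theta>" "\<bar>\<rho> \<theta> - \<rho> \<theta>0\<bar> \<le> K * \<bar>\<theta> - \<theta>0\<bar>" using \<rho>(4) True by auto
      have "\<bar>\<rho> \<theta> * w \<theta> - \<rho> \<theta>0 * exp (- (I * h\<^sup>2) / 2)\<bar>
          = \<bar>(\<rho> \<theta> - \<rho> \<theta>0) * w \<theta> + \<rho> \<theta>0 * (w \<theta> - exp (- (I * h\<^sup>2) / 2))\<bar>" by (simp add: algebra_simps)
      also have "\<dots> \<le> \<bar>\<rho> \<theta> - \<rho> \<theta>0\<bar> * w \<theta> + \<rho> \<theta>0 * \<bar>w \<theta> - exp (- (I * h\<^sup>2) / 2)\<bar>"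
        using \<rho>(2) R(1) by (intro order_trans[OF abs_triangle_ineq]) (simp add: abs_mult)
      also have "\<dots> \<le> (K * ((1 + C) * ((h + 1) ^ 3 / sqrt n))) * exp (\<bar>R\<bar> - I * h\<^sup>2 / 2)
          + \<rho> \<theta>0 * ((C * ((h + 1) ^ 3 / sqrt n)) * exp (\<bar>R\<bar> - I * h\<^sup>2 / 2))"
      proof (intro add_mono mult_mono w1)
        show "\<bar>\<rho> \<theta> - \<rho> \<theta>0\<bar> \<le> K * ((1 + C) * ((h + 1) ^ 3 / sqrt n))"
          using \<rho>\<theta>(2) mult_left_mono[OF d \<rho>(3)] by linarith
        show "\<bar>w \<theta> - exp (- (I * h\<^sup>2) / 2)\<bar> \<le> C * ((h + 1) ^ 3 / sqrt n) * exp (\<bar>R\<bar> - I * h\<^sup>2 / 2)"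
          using w2 mult_right_mono[OF R1, of "exp (\<bar>R\<bar> - I * h\<^sup>2 / 2)"] by simp
      qed (use \<rho> C h R in auto)
      also have "\<dots> = (K * (1 + C) + \<rho> \<theta>0 * C) / sqrt n * (h + 1) ^ 3 * exp (\<bar>R\<bar> - I * h\<^sup>2 / 2)"
        by (simp add: algebra_simps add_divide_distrib)
      also have "\<dots> \<le> (K * (1 + C) + \<rho> \<theta>0 * C) / sqrt n * (h + 1) ^ 4 * (exp (I / 4) * exp (- (I / 4) * h\<^sup>2))"
        using \<rho> C h E by (intro mult_mono power_increasing) auto
      also have "\<dots> = (K * (1 + C) + \<rho> \<theta>0 * C) * exp (I / 4) / sqrt n *
          ((1 + h) ^ 4 * exp (- (3 * I / 16) * h\<^sup>2)) * exp (- (I * h\<^sup>2) / 16)"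
        unfolding split by (simp add: algebra_simps)
      also have "\<dots> \<le> (K * (1 + C) + \<rho> \<theta>0 * C) * exp (I / 4) / sqrt n * A * exp (- (I * h\<^sup>2) / 16)"
        using \<rho> C A(2)[OF h(1)] by (intro mult_right_mono mult_left_mono) auto
      also have "\<dots> = B1 / sqrt n * exp (- (I * h\<^sup>2) / 16)" unfolding B1_def by simp
      also have "\<dots> \<le> (B1 + B2) / sqrt n * exp (- (I * h\<^sup>2) / 16)"
        using B by (intro mult_right_mono divide_right_mono) auto
      finally show ?thesis using \<rho>\<theta>(1) tail by simp
    next
      case False
      \<comment> \<open>Far from \<open>\<theta>0\<close>, \<open>h\<close> is at least of order \<open>\<surd>n\<close>, so that a factor \<open>n\<^sup>-\<^sup>1\<^sup>/\<^sup>2\<close> can be bought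
        with a power of \<open>h\<close>.\<close>
      have "C / sqrt n \<le> \<delta> / 2" using n(3) by (simp add: mult.commute)
      then have "\<delta> / 2 \<le> h / sqrt n" using False m h(2) by linarith
      from mult_left_mono[OF this, of "2 / \<delta>"] have "1 \<le> 2 / \<delta> * (h / sqrt n)" using \<delta>(1) by simp
      also have "\<dots> \<le> 2 / \<delta> / sqrt n * (1 + h) ^ 4"
      proof -
        have "h \<le> (1 + h) ^ 4" using self_le_power[of "1 + h" 4] h(1) by simp
        then show ?thesis using \<delta> sn by (simp add: divide_right_mono)
      qed
      finally have one: "1 \<le> 2 / \<delta> / sqrt n * (1 + h) ^ 4" .
      have "\<rho> \<theta>0 * exp (- (I * h\<^sup>2) / 2) \<le> \<rho> \<theta>0 * exp (- (I / 4) * h\<^sup>2)"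
        using I \<rho>(2) by (simp add: field_simps)
      also have "\<dots> \<le> (2 / \<delta> / sqrt n * (1 + h) ^ 4) * (\<rho> \<theta>0 * exp (- (I / 4) * h\<^sup>2))"
        using mult_right_mono[OF one, of "\<rho> \<theta>0 * exp (- (I / 4) * h\<^sup>2)"] \<rho>(2) by simp
      also have "\<dots> = 2 * \<rho> \<theta>0 / \<delta> / sqrt n * ((1 + h) ^ 4 * exp (- (3 * I / 16) * h\<^sup>2)) * exp (- (I * h\<^sup>2) / 16)"
        unfolding split by (simp add: algebra_simps)
      also have "\<dots> \<le> 2 * \<rho> \<theta>0 / \<delta> / sqrt n * A * exp (- (I * h\<^sup>2) / 16)"
        using \<rho> \<delta> A(2)[OF h(1)] by (intro mult_right_mono mult_left_mono) auto
      also have "\<dots> = B2 / sqrt n * exp (- (I * h\<^sup>2) / 16)" unfolding B2_def by simp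
      also have "\<dots> \<le> (B1 + B2) / sqrt n * exp (- (I * h\<^sup>2) / 16)"
        using B by (intro mult_right_mono divide_right_mono) auto
      finally have q: "\<rho> \<theta>0 * exp (- (I * h\<^sup>2) / 2) \<le> (B1 + B2) / sqrt n * exp (- (I * h\<^sup>2) / 16)" .
      have "0 \<le> indicator \<Theta> \<theta> * (\<rho> \<theta> * w \<theta>) \<and> indicator \<Theta> \<theta> * (\<rho> \<theta> * w \<theta>) \<le> exp (- \<kappa> * n) * (indicator \<Theta> \<theta> * \<rho> \<theta>)"
        using far False \<rho>(1) by (auto split: split_indicator simp: mult.commute[of "\<rho> \<theta>"] mult_right_mono)
      moreover have "0 \<le> \<rho> \<theta>0 * exp (- (I * h\<^sup>2) / 2)" using \<rho>(2) by simp
      ultimately show ?thesis using q by linarith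
    qed
    then show "\<bar>indicator \<Theta> \<theta> * (\<rho> \<theta> * w \<theta>) - \<rho> \<theta>0 * exp (- (n * I * (\<theta> - m)\<^sup>2) / 2)\<bar>
      \<le> (B1 + B2) / sqrt n * exp (- (n * I * (\<theta> - m)\<^sup>2) / 16) + exp (- \<kappa> * n) * (indicator \<Theta> \<theta> * \<rho> \<theta>)"
      by (simp add: nI)
  qed
qed


text \<open>Integrating the pointwise bound: the Gaussian piece has \<open>L\<^sub>1\<close> norm of order
  \<open>n\<^sup>-\<^sup>1\<^sup>/\<^sup>2 \<cdot> n\<^sup>-\<^sup>1\<^sup>/\<^sup>2\<close> and the exponentially small piece is even smaller, whereas the total mass
  is of order \<open>n\<^sup>-\<^sup>1\<^sup>/\<^sup>2\<close>. The relative error, which is what normalisation sees, is therefore of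
  order \<open>n\<^sup>-\<^sup>1\<^sup>/\<^sup>2\<close>.\<close>

lemma nearly_gaussian_weight_imp_normal_posterior:
  fixes \<Theta> :: "real set" and I C \<delta> \<kappa> K \<theta>0 :: real
  assumes \<Theta>: "\<Theta> \<in> sets lebesgue"
    and I: "0 < I" and C: "0 \<le> C" and \<delta>: "0 < \<delta>" "24 * C * \<delta> \<le> I" and \<kappa>: "0 < \<kappa>"
    and prior: "proper_prior_density \<Theta> \<rho>" "0 < \<rho> \<theta>0" and K: "0 \<le> K"
    and \<rho>: "\<forall>\<theta>. \<bar>\<theta> - \<theta>0\<bar> \<le> \<delta> \<longrightarrow> \<theta> \<in> \<Theta> \<and> \<bar>\<rho> \<theta> - \<rho> \<theta>0\<bar> \<le> K * \<bar>\<theta> - \<theta>0\<bar>"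
  shows "\<exists>A. \<forall>\<^sub>F n in sequentially. \<forall>m w \<xi>.
    nearly_gaussian_weight \<Theta> I C \<delta> \<kappa> \<theta>0 n m w \<longrightarrow> w \<in> borel_measurable (lebesgue_on \<Theta>) \<longrightarrow>
    \<bar>measure (density (lebesgue_on \<Theta>) (\<lambda>\<theta>. ennreal (\<rho> \<theta> * w \<theta> / (\<integral>\<theta>'. \<rho> \<theta>' * w \<theta>' \<partial>lebesgue_on \<Theta>))))
      {\<theta> \<in> \<Theta>. sqrt n * (\<theta> - m) * sqrt I \<le> \<xi>} - cdf std_normal_distribution \<xi>\<bar> \<le> A / sqrt n"
proof -
  have \<rho>nn: "\<forall>\<theta>\<in>\<Theta>. 0 \<le> \<rho> \<theta>" and \<rho>int: "integrable (lebesgue_on \<Theta>) \<rho>"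
    and \<rho>1: "(\<integral>\<theta>. \<rho> \<theta> \<partial>lebesgue_on \<Theta>) = 1"
    using prior(1) unfolding proper_prior_density_def by auto
  obtain B where B: "0 \<le> B" and pointwise: "\<And>n m w \<theta>. (0::nat) < n \<Longrightarrow> 1 / sqrt n \<le> \<delta> \<Longrightarrow>
    2 * C / sqrt n \<le> \<delta> \<Longrightarrow> nearly_gaussian_weight \<Theta> I C \<delta> \<kappa> \<theta>0 n m w \<Longrightarrow>
    \<bar>indicator \<Theta> \<theta> * (\<rho> \<theta> * w \<theta>) - \<rho> \<theta>0 * exp (- (n * I * (\<theta> - m)\<^sup>2) / 2)\<bar>
      \<le> B / sqrt n * exp (- (n * I * (\<theta> - m)\<^sup>2) / 16) + exp (- \<kappa> * n) * (indicator \<Theta> \<theta> * \<rho> \<theta>)"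
    using weight_gaussian_pointwise[OF I C \<delta> \<rho>nn prior(2) K \<rho>, of \<kappa>] by blast
  \<comment> \<open>\<open>E / n\<close> is the \<open>L\<^sub>1\<close> error and \<open>z / \<surd>n\<close> the mass of the Gaussian approximation.\<close>
  define E where "E = B * sqrt (16 * pi / I) + 1 / \<kappa>"
  define z where "z = \<rho> \<theta>0 * sqrt (2 * pi / I)"
  have E: "0 \<le> E" unfolding E_def using B I \<kappa> by simp
  have z: "0 < z" unfolding z_def using prior I by simp
  have lim: "(\<lambda>n. c / sqrt (real n)) \<longlonglongrightarrow> 0" for c :: real by real_asymp
  have ev: "\<forall>\<^sub>F n in sequentially. 0 < n \<and> 1 / sqrt n < \<delta> \<and> 2 * C / sqrt n < \<delta> \<and> E / sqrt n < z / 2"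
    using order_tendstoD(2)[OF lim] \<delta> z
    by (intro eventually_conj eventually_gt_at_top) simp_all
  show ?thesis
  proof (intro exI[of _ "4 * E / z"] eventually_mono[OF ev] allI impI)
    fix n :: nat and m \<xi> :: real and w
    assume n: "0 < n \<and> 1 / sqrt n < \<delta> \<and> 2 * C / sqrt n < \<delta> \<and> E / sqrt n < z / 2"
      and w: "w \<in> borel_measurable (lebesgue_on \<Theta>)"
      and ngw: "nearly_gaussian_weight \<Theta> I C \<delta> \<kappa> \<theta>0 n m w"
    have sn: "0 < sqrt (real n)" using n by simp
    define g where "g \<theta> = \<rho> \<theta> * w \<theta>" for \<theta>
    define \<sigma> where "\<sigma> = sqrt (1 / (n * I))"
    define \<tau> where "\<tau> = sqrt (8 / (n * I))"
    have nI: "0 < n * I" using n I by simp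
    have \<sigma>: "0 < \<sigma>" "0 < \<tau>" unfolding \<sigma>_def \<tau>_def using nI by simp_all
    have gauss: "exp (- (n * I * (\<theta> - m)\<^sup>2) / 2) = sqrt (2 * pi / I) / sqrt n * normal_density m \<sigma> \<theta>"
      "exp (- (n * I * (\<theta> - m)\<^sup>2) / 16) = sqrt (16 * pi / I) / sqrt n * normal_density m \<tau> \<theta>" for \<theta>
      using exp_eq_normal_density[of "1 / (n * I)" \<theta> m] exp_eq_normal_density[of "8 / (n * I)" \<theta> m] nI
      unfolding \<sigma>_def \<tau>_def by (simp_all add: mult.commute flip: real_sqrt_divide)
    have bound: "\<bar>indicator \<Theta> \<theta> * g \<theta> - z / sqrt n * normal_density m \<sigma> \<theta>\<bar>
        \<le> B / sqrt n * (sqrt (16 * pi / I) / sqrt n) * normal_density m \<tau> \<theta> + exp (- \<kappa> * n) * (indicator \<Theta> \<theta> * \<rho> \<theta>)" for \<theta>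
      using pointwise[of n m w \<theta>] n ngw gauss unfolding g_def z_def by simp
    have \<rho>i: "integrable lebesgue (\<lambda>\<theta>. indicator \<Theta> \<theta> * \<rho> \<theta>)"
      using integrable_restrict_space[of \<Theta> lebesgue \<rho>] \<rho>int \<Theta> by simp
    have \<rho>i1: "(\<integral>\<theta>. indicator \<Theta> \<theta> * \<rho> \<theta> \<partial>lebesgue) = 1"
      using integral_restrict_space[of \<Theta> lebesgue \<rho>] \<rho>1 \<Theta> by simp
    have nd: "integrable lebesgue (normal_density m s)" "(\<integral>\<theta>. normal_density m s \<theta> \<partial>lebesgue) = 1" if "0 < s" for s
      using integrable_completion[of "normal_density m s" lborel] integrable_normal_density[OF that, of m]
        integral_completion[of "normal_density m s" lborel] integral_normal_density[OF that, of m] by simp_all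
    let ?dom = "\<lambda>\<theta>. B / sqrt n * (sqrt (16 * pi / I) / sqrt n) * normal_density m \<tau> \<theta> + exp (- \<kappa> * n) * (indicator \<Theta> \<theta> * \<rho> \<theta>)"
    have dom: "integrable lebesgue ?dom" using \<rho>i nd(1)[OF \<sigma>(2)] by simp
    have gm: "(\<lambda>\<theta>. indicator \<Theta> \<theta> * g \<theta>) \<in> borel_measurable lebesgue"
      using w \<rho>int borel_measurable_restrict_space_iff[of \<Theta> lebesgue g] \<Theta> unfolding g_def by simp
    have diff: "integrable lebesgue (\<lambda>\<theta>. indicator \<Theta> \<theta> * g \<theta> - z / sqrt n * normal_density m \<sigma> \<theta>)"
    proof (rule Bochner_Integration.integrable_bound[OF dom])
      show "(\<lambda>\<theta>. indicator \<Theta> \<theta> * g \<theta> - z / sqrt n * normal_density m \<sigma> \<theta>) \<in> borel_measurable lebesgue"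
        using gm nd(1)[OF \<sigma>(1)] by (intro borel_measurable_diff) simp_all
      show "AE \<theta> in lebesgue. norm (indicator \<Theta> \<theta> * g \<theta> - z / sqrt n * normal_density m \<sigma> \<theta>) \<le> norm (?dom \<theta>)"
        unfolding real_norm_def by (intro AE_I2 order_trans[OF bound abs_ge_self])
    qed
    have "integrable lebesgue (\<lambda>\<theta>. (indicator \<Theta> \<theta> * g \<theta> - z / sqrt n * normal_density m \<sigma> \<theta>) + z / sqrt n * normal_density m \<sigma> \<theta>)"
      using nd(1)[OF \<sigma>(1)] by (intro Bochner_Integration.integrable_add[OF diff]) simp
    then have gint: "integrable (lebesgue_on \<Theta>) g"
      using integrable_restrict_space[of \<Theta> lebesgue g] \<Theta> by simp
    have wnn: "0 \<le> w \<theta>" if "\<theta> \<in> \<Theta>" for \<theta>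
      using ngw that unfolding nearly_gaussian_weight_def by (cases "\<bar>\<theta> - \<theta>0\<bar> \<le> \<delta>") force+
    define e where "e = E / n"
    have "(\<integral>\<theta>. \<bar>indicator \<Theta> \<theta> * g \<theta> - z / sqrt n * normal_density m \<sigma> \<theta>\<bar> \<partial>lebesgue) \<le> (\<integral>\<theta>. ?dom \<theta> \<partial>lebesgue)"
      by (intro integral_mono integrable_abs diff dom bound)
    also have "\<dots> = B / sqrt n * (sqrt (16 * pi / I) / sqrt n) + exp (- \<kappa> * n)"
      using \<rho>i \<rho>i1 nd[OF \<sigma>(2)] by simp
    also have "\<dots> \<le> e"
    proof -
      have "\<kappa> * n \<le> exp (\<kappa> * n)" using exp_ge_add_one_self[of "\<kappa> * n"] by linarith
      then have "exp (- \<kappa> * n) \<le> 1 / \<kappa> / n"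
        using n \<kappa> by (simp add: exp_minus field_simps)
      moreover have "B / sqrt n * (sqrt (16 * pi / I) / sqrt n) = B * sqrt (16 * pi / I) / n"
        using n by simp
      ultimately show ?thesis unfolding e_def E_def by (simp add: add_divide_distrib)
    qed
    finally have L1: "(\<integral>\<theta>. \<bar>indicator \<Theta> \<theta> * g \<theta> - z / sqrt n * normal_density m \<sigma> \<theta>\<bar> \<partial>lebesgue) \<le> e" .
    have "E / sqrt n / sqrt n \<le> z / 2 / sqrt n" using n sn by (intro divide_right_mono) auto
    then have e: "e \<le> z / sqrt n / 2" unfolding e_def using n by simp
    have zn: "0 < z / sqrt n" using z sn by simp
    have "\<bar>measure (density (lebesgue_on \<Theta>) (\<lambda>\<theta>. ennreal (g \<theta> / integral\<^sup>L (lebesgue_on \<Theta>) g)))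
      {\<theta> \<in> \<Theta>. (\<theta> - m) / \<sigma> \<le> \<xi>} - cdf std_normal_distribution \<xi>\<bar> \<le> 2 * e / (z / sqrt n - e)"
      using e zn \<rho>nn wnn
      by (intro normalized_L1_close_imp_cdf_close[OF \<Theta> gint _ \<sigma>(1) _ L1]) (simp_all add: g_def)
    also have "\<dots> \<le> 2 * e / (z / sqrt n / 2)"
      using e zn E n unfolding e_def by (intro divide_left_mono mult_pos_pos) auto
    also have "\<dots> = 4 * E / z / sqrt n"
    proof -
      have "real n = sqrt n * sqrt n" by simp
      then show ?thesis unfolding e_def using z sn by (simp add: field_simps)
    qed
    finally have *: "\<bar>measure (density (lebesgue_on \<Theta>) (\<lambda>\<theta>. ennreal (g \<theta> / integral\<^sup>L (lebesgue_on \<Theta>) g)))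
      {\<theta> \<in> \<Theta>. (\<theta> - m) / \<sigma> \<le> \<xi>} - cdf std_normal_distribution \<xi>\<bar> \<le> 4 * E / z / sqrt n" .
    show "\<bar>measure (density (lebesgue_on \<Theta>) (\<lambda>\<theta>. ennreal (\<rho> \<theta> * w \<theta> / (\<integral>\<theta>'. \<rho> \<theta>' * w \<theta>' \<partial>lebesgue_on \<Theta>))))
      {\<theta> \<in> \<Theta>. sqrt n * (\<theta> - m) * sqrt I \<le> \<xi>} - cdf std_normal_distribution \<xi>\<bar> \<le> 4 * E / z / sqrt n"
    proof -
      have "(\<theta> - m) / \<sigma> = sqrt n * (\<theta> - m) * sqrt I" for \<theta>
        unfolding \<sigma>_def by (simp add: real_sqrt_divide real_sqrt_mult)
      then show ?thesis using * unfolding g_def by simp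
    qed
  qed
qed

section \<open>Expansion of the log-likelihood along the least favourable submodel\<close>

lemma taylor_remainder_le:
  fixes diff :: "nat \<Rightarrow> real \<Rightarrow> real"
  assumes deriv: "\<And>m u. m < n \<Longrightarrow> \<bar>u - a\<bar> \<le> \<bar>t - a\<bar> \<Longrightarrow> (diff m has_real_derivative diff (Suc m) u) (at u)"
    and bound: "\<And>u. \<bar>u - a\<bar> \<le> \<bar>t - a\<bar> \<Longrightarrow> \<bar>diff n u\<bar> \<le> B"
  shows "\<bar>diff 0 t - (\<Sum>m<n. diff m a / fact m * (t - a) ^ m)\<bar> \<le> B * \<bar>t - a\<bar> ^ n"
proof -
  have "\<forall>m u. m < n \<and> \<bar>u\<bar> \<le> \<bar>t - a\<bar> \<longrightarrow>
      ((\<lambda>u. diff m (a + u)) has_real_derivative diff (Suc m) (a + u)) (at u)"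
  proof (intro allI impI)
    fix m u assume "m < n \<and> \<bar>u\<bar> \<le> \<bar>t - a\<bar>"
    then have "(diff m has_real_derivative diff (Suc m) (u + a)) (at (u + a))"
      by (intro deriv) auto
    then have "((\<lambda>u. diff m (u + a)) has_real_derivative diff (Suc m) (u + a)) (at u)"
      by (subst DERIV_shift[symmetric])
    then show "((\<lambda>u. diff m (a + u)) has_real_derivative diff (Suc m) (a + u)) (at u)"
      by (simp add: add.commute)
  qed
  from Maclaurin_bi_le[of "\<lambda>m u. diff m (a + u)", OF refl this]
  obtain u where u: "\<bar>u\<bar> \<le> \<bar>t - a\<bar>"
    "diff 0 t = (\<Sum>m<n. diff m a / fact m * (t - a) ^ m) + diff n (a + u) / fact n * (t - a) ^ n"
    by auto
  have "\<bar>diff 0 t - (\<Sum>m<n. diff m a / fact m * (t - a) ^ m)\<bar> = \<bar>diff n (a + u)\<bar> / fact n * \<bar>t - a\<bar> ^ n"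
    using u(2) by (simp add: abs_mult power_abs)
  also have "\<dots> \<le> B * \<bar>t - a\<bar> ^ n"
  proof (rule mult_right_mono)
    have "\<bar>diff n (a + u)\<bar> / fact n \<le> \<bar>diff n (a + u)\<bar> / 1"
      by (intro divide_left_mono) auto
    then show "\<bar>diff n (a + u)\<bar> / fact n \<le> B" using bound[of "a + u"] u(1) by simp
  qed simp
  finally show ?thesis .
qed

lemma emp_mean_has_derivative:
  assumes "\<And>i. i < n \<Longrightarrow> ((\<lambda>s. f s (d i)) has_real_derivative f' (d i)) (at t)"
  shows "((\<lambda>s. emp_mean d n (f s)) has_real_derivative emp_mean d n f') (at t)"
  unfolding emp_mean_def using assms by (intro DERIV_cdivide DERIV_sum) auto

lemma abs_emp_mean_le:
  assumes "\<And>i. i < n \<Longrightarrow> \<bar>f (d i)\<bar> \<le> F (d i)"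
  shows "\<bar>emp_mean d n f\<bar> \<le> emp_mean d n F"
proof -
  have "\<bar>\<Sum>i<n. f (d i)\<bar> \<le> (\<Sum>i<n. F (d i))"
    by (rule order_trans[OF sum_abs]) (intro sum_mono assms, simp)
  then show ?thesis unfolding emp_mean_def by (simp add: divide_right_mono)
qed

lemma emp_mean_minus_integral:
  assumes "0 < n"
  shows "emp_mean d n f - integral\<^sup>L P f = emp_process P d n f / sqrt n"
proof -
  have "(\<Sum>i<n. f (d i) - integral\<^sup>L P f) / sqrt n / sqrt n = (\<Sum>i<n. f (d i) - integral\<^sup>L P f) / n"
    by simp
  also have "\<dots> = emp_mean d n f - integral\<^sup>L P f"
    unfolding emp_mean_def using assms by (simp add: sum_subtractf diff_divide_distrib)
  finally show ?thesis unfolding emp_process_def by simp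
qed

lemma abs_emp_mean_minus_integral_le:
  assumes "0 < n" "\<bar>emp_process P d n f\<bar> \<le> B"
  shows "\<bar>emp_mean d n f - integral\<^sup>L P f\<bar> \<le> B / sqrt n"
  using assms unfolding emp_mean_minus_integral[OF assms(1)] by (simp add: abs_divide divide_right_mono)

lemma ell_deriv_has_derivative:
  shows "(\<lambda>s. ell_deriv lik lfs l 0 s \<theta> \<eta> x) field_differentiable at t \<Longrightarrow>
      ((\<lambda>s. ell_deriv lik lfs l 0 s \<theta> \<eta> x) has_real_derivative ell_deriv lik lfs (Suc l) 0 t \<theta> \<eta> x) (at t)"
    and "(\<lambda>\<theta>'. ell_deriv lik lfs l m t \<theta>' \<eta> x) field_differentiable at \<theta> \<Longrightarrow>
      ((\<lambda>\<theta>'. ell_deriv lik lfs l m t \<theta>' \<eta> x) has_real_derivative ell_deriv lik lfs l (Suc m) t \<theta> \<eta> x) (at \<theta>)"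
  unfolding ell_deriv_def by (auto dest!: field_differentiable_derivI)

text \<open>Almost every observation is regular; the listed orders are those of the remainder terms in the
  Taylor expansions below.\<close>

definition regular_obs ::
  "(real \<Rightarrow> 'h \<Rightarrow> 'x \<Rightarrow> real) \<Rightarrow> (real \<Rightarrow> real \<Rightarrow> 'h \<Rightarrow> 'h) \<Rightarrow> (real \<times> real \<times> 'h) set \<Rightarrow> ('x \<Rightarrow> real) \<Rightarrow> 'x \<Rightarrow> bool" where
  "regular_obs lik lfs V F x \<longleftrightarrow>
     (\<forall>(t, \<theta>, \<eta>)\<in>V. ell_derivs_exist lik lfs t \<theta> \<eta> x \<and>
       (\<forall>(l, m)\<in>{(3,0), (1,2), (2,1)}. \<bar>ell_deriv lik lfs l m t \<theta> \<eta> x\<bar> \<le> F x))"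

text \<open>Taylor's formula at \<open>\<theta>0\<close> for sample means, in the running parameter \<open>t\<close> of the submodel and in its
  base parameter \<open>\<psi>\<close>. A base parameter other than \<open>\<theta>0\<close> enters through mixed derivatives only.\<close>

lemma sample_mean_expansions:
  fixes lik :: "real \<Rightarrow> 'h::real_normed_vector \<Rightarrow> 'x \<Rightarrow> real" and lfs :: "real \<Rightarrow> real \<Rightarrow> 'h \<Rightarrow> 'h"
  defines "D \<equiv> ell_deriv lik lfs"
  assumes ball: "ball \<theta>0 \<delta> \<subseteq> \<Theta>" and reg: "\<And>i. i < n \<Longrightarrow> regular_obs lik lfs (param_nbhd \<Theta> H \<theta>0 \<eta>0 \<delta>) F (d i)"
    and C: "emp_mean d n F \<le> C"
    and t: "t \<in> ball \<theta>0 \<delta>" and \<psi>: "\<psi> \<in> ball \<theta>0 \<delta>" and \<eta>: "\<eta> \<in> H \<inter> ball \<eta>0 \<delta>"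
  shows "\<bar>emp_mean d n (D 0 0 t \<psi> \<eta>) - emp_mean d n (D 0 0 \<theta>0 \<psi> \<eta>) - (t - \<theta>0) * emp_mean d n (D 1 0 \<theta>0 \<psi> \<eta>)
      - (t - \<theta>0)\<^sup>2 / 2 * emp_mean d n (D 2 0 \<theta>0 \<psi> \<eta>)\<bar> \<le> C * \<bar>t - \<theta>0\<bar> ^ 3" (is ?A)
    and "\<bar>emp_mean d n (D 1 0 t \<psi> \<eta>) - emp_mean d n (D 1 0 \<theta>0 \<psi> \<eta>) - (t - \<theta>0) * emp_mean d n (D 2 0 \<theta>0 \<psi> \<eta>)\<bar>
      \<le> C * \<bar>t - \<theta>0\<bar>\<^sup>2" (is ?B)
    and "\<bar>emp_mean d n (D 1 0 \<theta>0 \<psi> \<eta>) - emp_mean d n (D 1 0 \<theta>0 \<theta>0 \<eta>) - (\<psi> - \<theta>0) * emp_mean d n (D 1 1 \<theta>0 \<theta>0 \<eta>)\<bar>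
      \<le> C * \<bar>\<psi> - \<theta>0\<bar>\<^sup>2" (is ?C)
    and "\<bar>emp_mean d n (D 2 0 \<theta>0 \<psi> \<eta>) - emp_mean d n (D 2 0 \<theta>0 \<theta>0 \<eta>)\<bar> \<le> C * \<bar>\<psi> - \<theta>0\<bar>" (is ?D)
    and "((\<lambda>s. emp_mean d n (D 0 0 s \<psi> \<eta>)) has_real_derivative emp_mean d n (D 1 0 t \<psi> \<eta>)) (at t)" (is ?E)
proof -
  have exist: "ell_derivs_exist lik lfs u \<theta> \<eta> (d i)" and
    env: "\<bar>D 3 0 u \<theta> \<eta> (d i)\<bar> \<le> F (d i)" "\<bar>D 1 2 u \<theta> \<eta> (d i)\<bar> \<le> F (d i)" "\<bar>D 2 1 u \<theta> \<eta> (d i)\<bar> \<le> F (d i)"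
    if "i < n" "u \<in> ball \<theta>0 \<delta>" "\<theta> \<in> ball \<theta>0 \<delta>" for i u \<theta>
  proof -
    have "(u, \<theta>, \<eta>) \<in> param_nbhd \<Theta> H \<theta>0 \<eta>0 \<delta>"
      using that ball \<eta> unfolding param_nbhd_def by auto
    from bspec[OF reg[OF that(1), unfolded regular_obs_def] this]
    show "ell_derivs_exist lik lfs u \<theta> \<eta> (d i)" "\<bar>D 3 0 u \<theta> \<eta> (d i)\<bar> \<le> F (d i)"
      "\<bar>D 1 2 u \<theta> \<eta> (d i)\<bar> \<le> F (d i)" "\<bar>D 2 1 u \<theta> \<eta> (d i)\<bar> \<le> F (d i)"
      by (auto simp: D_def)
  qed
  have seg: "u \<in> ball \<theta>0 \<delta>" if "\<bar>u - \<theta>0\<bar> \<le> \<bar>v - \<theta>0\<bar>" "v \<in> ball \<theta>0 \<delta>" for u v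
    using that by (auto simp: dist_real_def)
  \<comment> \<open>The ball is nonempty, so its radius is positive.\<close>
  have \<theta>0: "\<theta>0 \<in> ball \<theta>0 \<delta>" using t zero_le_dist[of \<theta>0 t] unfolding mem_ball dist_self by linarith
  have dt: "((\<lambda>s. emp_mean d n (D l 0 s \<psi> \<eta>)) has_real_derivative emp_mean d n (D (Suc l) 0 u \<psi> \<eta>)) (at u)"
    if "l < 3" "u \<in> ball \<theta>0 \<delta>" for l u
  proof (rule emp_mean_has_derivative)
    fix i assume "i < n"
    from that(1) have "l \<in> {0, 1, 2}" by auto
    then have "(\<lambda>s. ell_deriv lik lfs l 0 s \<psi> \<eta> (d i)) field_differentiable at u"
      using exist[OF \<open>i < n\<close> that(2) \<psi>] unfolding ell_derivs_exist_def by blast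
    then show "((\<lambda>s. D l 0 s \<psi> \<eta> (d i)) has_real_derivative D (Suc l) 0 u \<psi> \<eta> (d i)) (at u)"
      unfolding D_def by (rule ell_deriv_has_derivative(1))
  qed
  have d\<theta>: "((\<lambda>\<theta>. emp_mean d n (D l m \<theta>0 \<theta> \<eta>)) has_real_derivative emp_mean d n (D l (Suc m) \<theta>0 u \<eta>)) (at u)"
    if "(l, m) \<in> {(1,0), (1,1), (2,0)}" "u \<in> ball \<theta>0 \<delta>" for l m u
  proof (rule emp_mean_has_derivative)
    fix i assume "i < n"
    have "(\<lambda>\<theta>'. ell_deriv lik lfs l m \<theta>0 \<theta>' \<eta> (d i)) field_differentiable at u"
      using exist[OF \<open>i < n\<close> \<theta>0 that(2)] that(1) unfolding ell_derivs_exist_def by blast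
    then show "((\<lambda>\<theta>. D l m \<theta>0 \<theta> \<eta> (d i)) has_real_derivative D l (Suc m) \<theta>0 u \<eta> (d i)) (at u)"
      unfolding D_def by (rule ell_deriv_has_derivative(2))
  qed
  have third: "\<bar>emp_mean d n (D 3 0 u \<psi> \<eta>)\<bar> \<le> C" if "u \<in> ball \<theta>0 \<delta>" for u
    using abs_emp_mean_le[of n "D 3 0 u \<psi> \<eta>" d F, OF env(1)[OF _ that \<psi>]] C by linarith
  have mixed: "\<bar>emp_mean d n (D 1 2 \<theta>0 u \<eta>)\<bar> \<le> C" "\<bar>emp_mean d n (D 2 1 \<theta>0 u \<eta>)\<bar> \<le> C" if "u \<in> ball \<theta>0 \<delta>" for u
    using abs_emp_mean_le[of n "D 1 2 \<theta>0 u \<eta>" d F, OF env(2)[OF _ \<theta>0 that]] abs_emp_mean_le[of n "D 2 1 \<theta>0 u \<eta>" d F, OF env(3)[OF _ \<theta>0 that]] C by linarith+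
  have "\<bar>emp_mean d n (D 0 0 t \<psi> \<eta>)
      - (\<Sum>m<3. emp_mean d n (D m 0 \<theta>0 \<psi> \<eta>) / fact m * (t - \<theta>0) ^ m)\<bar> \<le> C * \<bar>t - \<theta>0\<bar> ^ 3"
    using dt third seg[OF _ t]
    by (intro taylor_remainder_le[where diff = "\<lambda>m u. emp_mean d n (D m 0 u \<psi> \<eta>)"]) auto
  then show ?A by (simp add: numeral_3_eq_3 numeral_2_eq_2 algebra_simps)
  have "\<bar>emp_mean d n (D (Suc 0) 0 t \<psi> \<eta>)
      - (\<Sum>m<2. emp_mean d n (D (Suc m) 0 \<theta>0 \<psi> \<eta>) / fact m * (t - \<theta>0) ^ m)\<bar> \<le> C * \<bar>t - \<theta>0\<bar> ^ 2"
    using dt third seg[OF _ t]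
    by (intro taylor_remainder_le[where diff = "\<lambda>m u. emp_mean d n (D (Suc m) 0 u \<psi> \<eta>)"])
      (auto simp: numeral_3_eq_3 numeral_2_eq_2)
  then show ?B by (simp add: numeral_2_eq_2 algebra_simps)
  have "\<bar>emp_mean d n (D 1 0 \<theta>0 \<psi> \<eta>)
      - (\<Sum>m<2. emp_mean d n (D 1 m \<theta>0 \<theta>0 \<eta>) / fact m * (\<psi> - \<theta>0) ^ m)\<bar> \<le> C * \<bar>\<psi> - \<theta>0\<bar> ^ 2"
    using d\<theta> mixed seg[OF _ \<psi>]
    by (intro taylor_remainder_le[where diff = "\<lambda>m u. emp_mean d n (D 1 m \<theta>0 u \<eta>)"])
      (auto simp: less_2_cases_iff)
  then show ?C by (simp add: numeral_2_eq_2 algebra_simps)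
  have "\<bar>emp_mean d n (D 2 0 \<theta>0 \<psi> \<eta>)
      - (\<Sum>m<1. emp_mean d n (D 2 m \<theta>0 \<theta>0 \<eta>) / fact m * (\<psi> - \<theta>0) ^ m)\<bar> \<le> C * \<bar>\<psi> - \<theta>0\<bar> ^ 1"
    using d\<theta> mixed seg[OF _ \<psi>]
    by (intro taylor_remainder_le[where diff = "\<lambda>m u. emp_mean d n (D 2 m \<theta>0 u \<eta>)"]) auto
  then show ?D by simp
  show ?E using dt[of 0 t] t by simp
qed

text \<open>The bookkeeping behind the expansion. Here \<open>a = t - \<theta>0\<close> and \<open>b = \<psi> - \<theta>0\<close> are the deviations of the
  running and of the base parameter, \<open>k = n\<^sup>-\<^sup>1\<^sup>/\<^sup>2\<close>, and \<open>e\<close> is the distance of the nuisance parameter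
  from the truth. Each error is a product of these quantities, of second order for the derivative and of
  third order for the increment, because the coefficient errors get multiplied by powers of \<open>a\<close>.\<close>

lemma expansion_arithmetic:
  fixes a b k e C I s :: real
  assumes C: "1 \<le> C" and k: "0 \<le> k" and e: "0 \<le> e" "e \<le> C * (k + \<bar>b\<bar>)"
    and S3: "\<bar>St - S0 - a * P10\<psi> - a\<^sup>2 / 2 * P20\<psi>\<bar> \<le> C * \<bar>a\<bar> ^ 3"
    and S2: "\<bar>S1t - P10\<psi> - a * P20\<psi>\<bar> \<le> C * \<bar>a\<bar>\<^sup>2"
    and "\<bar>P10\<psi> - P10 - b * P11\<bar> \<le> C * \<bar>b\<bar>\<^sup>2" "\<bar>P20\<psi> - P20\<bar> \<le> C * \<bar>b\<bar>"
    and "\<bar>P11\<bar> \<le> C * k + C * e" "\<bar>P20 + I\<bar> \<le> C * k + C * e"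
    and "\<bar>P10 - s\<bar> \<le> C * e * k + C * e\<^sup>2"
  shows "\<bar>St - S0 - (a * s - I * a\<^sup>2 / 2)\<bar> \<le> 11 * C ^ 3 * (k + \<bar>b\<bar> + \<bar>a\<bar>) ^ 3"
    and "\<bar>S1t - (s - I * a)\<bar> \<le> 11 * C ^ 3 * (k + \<bar>b\<bar> + \<bar>a\<bar>)\<^sup>2"
proof -
  define r where "r = k + \<bar>b\<bar>"
  define q where "q = r + \<bar>a\<bar>"
  have r: "0 \<le> r" "k \<le> r" "\<bar>b\<bar> \<le> r" "e \<le> C * r" and q: "0 \<le> q" "r \<le> q" "\<bar>a\<bar> \<le> q"
    using k e unfolding r_def q_def by auto
  have C12: "C \<le> C\<^sup>2" "C\<^sup>2 \<le> C ^ 3" "0 \<le> C" "C \<le> C ^ 3"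
    using C power_increasing[of 1 2 C] power_increasing[of 2 3 C] power_increasing[of 1 3 C] by auto
  have lin: "C * k + C * e \<le> (C + C\<^sup>2) * r"
    using mult_left_mono[OF r(2) C12(3)] mult_left_mono[OF r(4) C12(3)]
    by (simp add: power2_eq_square algebra_simps)
  have "\<bar>P10\<psi> - s\<bar> \<le> \<bar>P10\<psi> - P10 - b * P11\<bar> + \<bar>b\<bar> * \<bar>P11\<bar> + \<bar>P10 - s\<bar>"
    unfolding abs_mult[symmetric] by linarith
  also have "\<dots> \<le> C * r\<^sup>2 + r * ((C + C\<^sup>2) * r) + (C * (C * r) * r + C * (C * r)\<^sup>2)"
  proof (intro add_mono)
    show "\<bar>P10\<psi> - P10 - b * P11\<bar> \<le> C * r\<^sup>2"
      using assms(7) mult_left_mono[OF power_mono[OF r(3), of 2] C12(3)] by simp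
    show "\<bar>b\<bar> * \<bar>P11\<bar> \<le> r * ((C + C\<^sup>2) * r)"
      using assms(9) lin r by (intro mult_mono) auto
    have "C * e * k \<le> C * (C * r) * r" "C * e\<^sup>2 \<le> C * (C * r)\<^sup>2"
      using r e k C12 by (auto intro!: mult_mono power_mono)
    then show "\<bar>P10 - s\<bar> \<le> C * (C * r) * r + C * (C * r)\<^sup>2" using assms(11) by linarith
  qed
  also have "\<dots> = (2 * C + 2 * C\<^sup>2 + C ^ 3) * r\<^sup>2"
    by (simp add: power2_eq_square power3_eq_cube algebra_simps)
  also have "\<dots> \<le> 5 * C ^ 3 * r\<^sup>2"
    using C12 by (intro mult_right_mono) auto
  finally have X: "\<bar>P10\<psi> - s\<bar> \<le> 5 * C ^ 3 * r\<^sup>2" .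
  have "\<bar>P20\<psi> + I\<bar> \<le> C * r + (C + C\<^sup>2) * r"
    using assms(8,10) lin mult_left_mono[OF r(3) C12(3)] by linarith
  also have "\<dots> = (2 * C + C\<^sup>2) * r" by (simp add: algebra_simps)
  also have "\<dots> \<le> 5 * C ^ 3 * r" using C12 r by (intro mult_right_mono) auto
  finally have Y: "\<bar>P20\<psi> + I\<bar> \<le> 5 * C ^ 3 * r" .
  have X': "\<bar>P10\<psi> - s\<bar> \<le> 5 * C ^ 3 * q\<^sup>2" and Y': "\<bar>P20\<psi> + I\<bar> \<le> 5 * C ^ 3 * q"
    using X Y q r C12 mult_left_mono[OF power_mono[OF q(2) r(1), of 2], of "5 * C ^ 3"]
      mult_left_mono[OF q(2), of "5 * C ^ 3"] by auto
  have a3: "C * \<bar>a\<bar> ^ 3 \<le> C ^ 3 * q ^ 3" and a2: "C * \<bar>a\<bar>\<^sup>2 \<le> C ^ 3 * q\<^sup>2"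
    by (intro mult_mono[OF C12(4) power_mono[OF q(3)]]; use C12 in simp)+
  have "St - S0 - (a * s - I * a\<^sup>2 / 2)
      = (St - S0 - a * P10\<psi> - a\<^sup>2 / 2 * P20\<psi>) + a * (P10\<psi> - s) + a\<^sup>2 / 2 * (P20\<psi> + I)"
    by (simp add: algebra_simps)
  then have "\<bar>St - S0 - (a * s - I * a\<^sup>2 / 2)\<bar>
      \<le> \<bar>St - S0 - a * P10\<psi> - a\<^sup>2 / 2 * P20\<psi>\<bar> + \<bar>a\<bar> * \<bar>P10\<psi> - s\<bar> + a\<^sup>2 / 2 * \<bar>P20\<psi> + I\<bar>"
    using abs_triangle_ineq[of "(St - S0 - a * P10\<psi> - a\<^sup>2 / 2 * P20\<psi>) + a * (P10\<psi> - s)" "a\<^sup>2 / 2 * (P20\<psi> + I)"]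
      abs_triangle_ineq[of "St - S0 - a * P10\<psi> - a\<^sup>2 / 2 * P20\<psi>" "a * (P10\<psi> - s)"]
    by (simp only: abs_mult) (simp add: abs_mult)
  also have "\<dots> \<le> C ^ 3 * q ^ 3 + q * (5 * C ^ 3 * q\<^sup>2) + q\<^sup>2 * (5 * C ^ 3 * q)"
  proof (intro add_mono)
    show "\<bar>St - S0 - a * P10\<psi> - a\<^sup>2 / 2 * P20\<psi>\<bar> \<le> C ^ 3 * q ^ 3" using S3 a3 by linarith
    show "\<bar>a\<bar> * \<bar>P10\<psi> - s\<bar> \<le> q * (5 * C ^ 3 * q\<^sup>2)" using X' q by (intro mult_mono) auto
    have "a\<^sup>2 / 2 \<le> \<bar>a\<bar>\<^sup>2" by simp
    also have "\<dots> \<le> q\<^sup>2" using q by (intro power_mono) auto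
    finally show "a\<^sup>2 / 2 * \<bar>P20\<psi> + I\<bar> \<le> q\<^sup>2 * (5 * C ^ 3 * q)" using Y' by (intro mult_mono) auto
  qed
  also have "\<dots> = 11 * C ^ 3 * q ^ 3" by (simp add: power2_eq_square power3_eq_cube)
  finally show "\<bar>St - S0 - (a * s - I * a\<^sup>2 / 2)\<bar> \<le> 11 * C ^ 3 * (k + \<bar>b\<bar> + \<bar>a\<bar>) ^ 3"
    unfolding q_def r_def .
  have "S1t - (s - I * a) = (S1t - P10\<psi> - a * P20\<psi>) + (P10\<psi> - s) + a * (P20\<psi> + I)"
    by (simp add: algebra_simps)
  then have "\<bar>S1t - (s - I * a)\<bar> \<le> \<bar>S1t - P10\<psi> - a * P20\<psi>\<bar> + \<bar>P10\<psi> - s\<bar> + \<bar>a\<bar> * \<bar>P20\<psi> + I\<bar>"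
    unfolding abs_mult[symmetric] by linarith
  also have "\<dots> \<le> C ^ 3 * q\<^sup>2 + 5 * C ^ 3 * q\<^sup>2 + q * (5 * C ^ 3 * q)"
    using S2 a2 X' Y' q by (intro add_mono mult_mono) auto
  also have "\<dots> = 11 * C ^ 3 * q\<^sup>2" by (simp add: power2_eq_square)
  finally show "\<bar>S1t - (s - I * a)\<bar> \<le> 11 * C ^ 3 * (k + \<bar>b\<bar> + \<bar>a\<bar>)\<^sup>2"
    unfolding q_def r_def .
qed

text \<open>The quadratic bound on the mean score expresses that the submodel is least favourable: to first
  order, a wrong nuisance parameter does not bias the score for \<open>\<theta>\<close>.\<close>

definition population_conditions ::
  "'x measure \<Rightarrow> (real \<Rightarrow> 'h::real_normed_vector \<Rightarrow> 'x \<Rightarrow> real) \<Rightarrow> (real \<Rightarrow> real \<Rightarrow> 'h \<Rightarrow> 'h) \<Rightarrow> 'h set \<Rightarrow>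
   real \<Rightarrow> 'h \<Rightarrow> real \<Rightarrow> real \<Rightarrow> real \<Rightarrow> bool" where
  "population_conditions P lik lfs H \<theta>0 \<eta>0 \<delta> I C \<longleftrightarrow>
    (\<forall>\<eta>\<in>H \<inter> ball \<eta>0 \<delta>.
      integrable P (ell_deriv lik lfs 1 0 \<theta>0 \<theta>0 \<eta>) \<and>
      \<bar>integral\<^sup>L P (ell_deriv lik lfs 1 0 \<theta>0 \<theta>0 \<eta>)\<bar> \<le> C * (norm (\<eta> - \<eta>0))\<^sup>2 \<and>
      \<bar>integral\<^sup>L P (ell_deriv lik lfs 1 1 \<theta>0 \<theta>0 \<eta>)\<bar> \<le> C * norm (\<eta> - \<eta>0) \<and>
      \<bar>integral\<^sup>L P (ell_deriv lik lfs 2 0 \<theta>0 \<theta>0 \<eta>) + I\<bar> \<le> C * norm (\<eta> - \<eta>0))"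

text \<open>The stochastic input of the expansion, as an event. For every \<open>\<epsilon>\<close> it is likely at level \<open>\<epsilon>\<close> once
  \<open>C\<close> is large enough.\<close>

definition regular_path ::
  "'x measure \<Rightarrow> (real \<Rightarrow> 'h::real_normed_vector \<Rightarrow> 'x \<Rightarrow> real) \<Rightarrow> (real \<Rightarrow> real \<Rightarrow> 'h \<Rightarrow> 'h) \<Rightarrow> real set \<Rightarrow> 'h set \<Rightarrow>
   real \<Rightarrow> 'h \<Rightarrow> real \<Rightarrow> ('x \<Rightarrow> real) \<Rightarrow> real \<Rightarrow> nat \<Rightarrow> (nat \<Rightarrow> 'x) \<Rightarrow> bool" where
  "regular_path P lik lfs \<Theta> H \<theta>0 \<eta>0 \<delta> F C n d \<longleftrightarrow>
    (\<forall>i. regular_obs lik lfs (param_nbhd \<Theta> H \<theta>0 \<eta>0 \<delta>) F (d i)) \<and>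
    emp_mean d n F \<le> C \<and>
    (\<forall>\<eta>\<in>H \<inter> ball \<eta>0 \<delta>.
      \<bar>emp_process P d n (ell_deriv lik lfs 2 0 \<theta>0 \<theta>0 \<eta>)\<bar> \<le> C \<and>
      \<bar>emp_process P d n (ell_deriv lik lfs 1 1 \<theta>0 \<theta>0 \<eta>)\<bar> \<le> C \<and>
      \<bar>emp_process P d n (\<lambda>x. ell_deriv lik lfs 1 0 \<theta>0 \<theta>0 \<eta> x - ell_deriv lik lfs 1 0 \<theta>0 \<theta>0 \<eta>0 x)\<bar>
        \<le> C * norm (\<eta> - \<eta>0)) \<and>
    \<bar>emp_mean d n (ell_deriv lik lfs 1 0 \<theta>0 \<theta>0 \<eta>0)\<bar> \<le> C / sqrt n"

text \<open>Centring every sample mean at its expectation turns the Taylor coefficients into the score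
  mean and \<open>- I\<close>, up to errors that are small with the deviations.
  With a nuisance parameter at distance \<open>O(n\<^sup>-\<^sup>1\<^sup>/\<^sup>2 + \<bar>\<psi> - \<theta>0\<bar>)\<close> from the truth, the log-likelihood along the
  submodel is quadratic with the efficient score and information as coefficients, whatever that
  nuisance parameter is.\<close>

lemma submodel_expansion:
  fixes lik :: "real \<Rightarrow> 'h::real_normed_vector \<Rightarrow> 'x \<Rightarrow> real" and lfs :: "real \<Rightarrow> real \<Rightarrow> 'h \<Rightarrow> 'h"
  defines "D \<equiv> ell_deriv lik lfs"
  assumes ball: "ball \<theta>0 \<delta> \<subseteq> \<Theta>" and n: "(0::nat) < n" and C: "1 \<le> C" and \<eta>0: "\<eta>0 \<in> H"
    and pop: "population_conditions P lik lfs H \<theta>0 \<eta>0 \<delta> I C"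
    and path: "regular_path P lik lfs \<Theta> H \<theta>0 \<eta>0 \<delta> F C n d"
    and t: "t \<in> ball \<theta>0 \<delta>" and \<psi>: "\<psi> \<in> ball \<theta>0 \<delta>" and \<eta>: "\<eta> \<in> H \<inter> ball \<eta>0 \<delta>"
    and rate: "norm (\<eta> - \<eta>0) \<le> C * (1 / sqrt n + \<bar>\<psi> - \<theta>0\<bar>)"
  shows "\<bar>emp_mean d n (D 0 0 t \<psi> \<eta>) - emp_mean d n (D 0 0 \<theta>0 \<psi> \<eta>)
      - ((t - \<theta>0) * emp_mean d n (D 1 0 \<theta>0 \<theta>0 \<eta>0) - I * (t - \<theta>0)\<^sup>2 / 2)\<bar>
      \<le> 11 * C ^ 3 * (1 / sqrt n + \<bar>\<psi> - \<theta>0\<bar> + \<bar>t - \<theta>0\<bar>) ^ 3" (is ?A)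
    and "\<bar>emp_mean d n (D 1 0 t \<psi> \<eta>) - (emp_mean d n (D 1 0 \<theta>0 \<theta>0 \<eta>0) - I * (t - \<theta>0))\<bar>
      \<le> 11 * C ^ 3 * (1 / sqrt n + \<bar>\<psi> - \<theta>0\<bar> + \<bar>t - \<theta>0\<bar>)\<^sup>2" (is ?B)
proof -
  let ?e = "norm (\<eta> - \<eta>0)" and ?k = "1 / sqrt n"
  have reg: "regular_obs lik lfs (param_nbhd \<Theta> H \<theta>0 \<eta>0 \<delta>) F (d i)" and F: "emp_mean d n F \<le> C"
    and G20: "\<bar>emp_process P d n (D 2 0 \<theta>0 \<theta>0 \<eta>)\<bar> \<le> C" and G11: "\<bar>emp_process P d n (D 1 1 \<theta>0 \<theta>0 \<eta>)\<bar> \<le> C"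
    and G10: "\<bar>emp_process P d n (\<lambda>x. D 1 0 \<theta>0 \<theta>0 \<eta> x - D 1 0 \<theta>0 \<theta>0 \<eta>0 x)\<bar> \<le> C * ?e" for i
    using path \<eta> unfolding regular_path_def D_def by blast+
  have \<eta>0': "\<eta>0 \<in> H \<inter> ball \<eta>0 \<delta>"
    using \<eta>0 t zero_le_dist[of \<theta>0 t] by (simp, linarith)
  have int: "integrable P (D 1 0 \<theta>0 \<theta>0 \<eta>)" "integrable P (D 1 0 \<theta>0 \<theta>0 \<eta>0)"
    and m10: "\<bar>integral\<^sup>L P (D 1 0 \<theta>0 \<theta>0 \<eta>)\<bar> \<le> C * ?e\<^sup>2" and m11: "\<bar>integral\<^sup>L P (D 1 1 \<theta>0 \<theta>0 \<eta>)\<bar> \<le> C * ?e"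
    and m20: "\<bar>integral\<^sup>L P (D 2 0 \<theta>0 \<theta>0 \<eta>) + I\<bar> \<le> C * ?e"
    using pop \<eta> \<eta>0' unfolding population_conditions_def D_def by blast+
  have "\<bar>integral\<^sup>L P (D 1 0 \<theta>0 \<theta>0 \<eta>0)\<bar> \<le> C * (norm (\<eta>0 - \<eta>0))\<^sup>2"
    using pop \<eta>0' unfolding population_conditions_def D_def by blast
  then have mean0: "integral\<^sup>L P (D 1 0 \<theta>0 \<theta>0 \<eta>0) = 0" by simp
  have P11: "\<bar>emp_mean d n (D 1 1 \<theta>0 \<theta>0 \<eta>)\<bar> \<le> C * ?k + C * ?e"
    using abs_emp_mean_minus_integral_le[OF n G11] m11 by simp
  have P20: "\<bar>emp_mean d n (D 2 0 \<theta>0 \<theta>0 \<eta>) + I\<bar> \<le> C * ?k + C * ?e"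
    using abs_emp_mean_minus_integral_le[OF n G20] m20 by simp
  have "emp_mean d n (D 1 0 \<theta>0 \<theta>0 \<eta>) - emp_mean d n (D 1 0 \<theta>0 \<theta>0 \<eta>0)
      = emp_mean d n (\<lambda>x. D 1 0 \<theta>0 \<theta>0 \<eta> x - D 1 0 \<theta>0 \<theta>0 \<eta>0 x)"
    unfolding emp_mean_def by (simp add: sum_subtractf diff_divide_distrib)
  then have P10: "\<bar>emp_mean d n (D 1 0 \<theta>0 \<theta>0 \<eta>) - emp_mean d n (D 1 0 \<theta>0 \<theta>0 \<eta>0)\<bar> \<le> C * ?e * ?k + C * ?e\<^sup>2"
    using abs_emp_mean_minus_integral_le[OF n G10] m10 mean0 int by simp
  note expansions = sample_mean_expansions[where lik = lik and lfs = lfs, folded D_def, OF ball reg F t \<psi> \<eta>]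
  show ?A ?B
    by (rule expansion_arithmetic[where e = ?e, OF C _ norm_ge_zero rate expansions(1,2,3,4) P11 P20 P10]; simp)+
qed

section \<open>Expansion of the profile likelihood\<close>

lemma profile_lik_eq:
  assumes "is_arg_max (lik_n lik d n \<theta>) (\<lambda>\<eta>. \<eta> \<in> H) \<eta>"
  shows "profile_lik lik H d n \<theta> = lik_n lik d n \<theta> \<eta>"
    and "\<eta>' \<in> H \<Longrightarrow> lik_n lik d n \<theta> \<eta>' \<le> profile_lik lik H d n \<theta>"
proof -
  have *: "\<eta> \<in> H" "\<And>\<eta>'. \<eta>' \<in> H \<Longrightarrow> lik_n lik d n \<theta> \<eta>' \<le> lik_n lik d n \<theta> \<eta>"
    using assms unfolding is_arg_max_def by (auto simp: not_less)
  then show "profile_lik lik H d n \<theta> = lik_n lik d n \<theta> \<eta>"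
    unfolding profile_lik_def by (intro cSup_eq_maximum) auto
  then show "\<eta>' \<in> H \<Longrightarrow> lik_n lik d n \<theta> \<eta>' \<le> profile_lik lik H d n \<theta>" using * by simp
qed

lemma ln_lik_n_submodel:
  assumes "\<And>i. i < n \<Longrightarrow> 0 < lik t (lfs t \<theta> \<eta>) (d i)" "0 < n"
  shows "0 < lik_n lik d n t (lfs t \<theta> \<eta>)"
    and "ln (lik_n lik d n t (lfs t \<theta> \<eta>)) = n * emp_mean d n (ell_deriv lik lfs 0 0 t \<theta> \<eta>)"
proof -
  show "0 < lik_n lik d n t (lfs t \<theta> \<eta>)"
    unfolding lik_n_def using assms by (intro prod_pos) auto
  have ne: "lik t (lfs t \<theta> \<eta>) (d i) \<noteq> 0" if "i < n" for i using assms(1)[OF that] by simp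
  have "ln (lik_n lik d n t (lfs t \<theta> \<eta>)) = (\<Sum>i<n. ln (lik t (lfs t \<theta> \<eta>) (d i)))"
    unfolding lik_n_def by (subst ln_prod) (auto simp: ne)
  also have "\<dots> = n * emp_mean d n (ell_deriv lik lfs 0 0 t \<theta> \<eta>)"
    unfolding emp_mean_def ell_deriv_def ell_def using assms by simp
  finally show "ln (lik_n lik d n t (lfs t \<theta> \<eta>)) = n * emp_mean d n (ell_deriv lik lfs 0 0 t \<theta> \<eta>)" .
qed

text \<open>The profile likelihood is sandwiched between likelihoods along submodels: for any \<open>\<psi>\<close>, the submodel
  through \<open>(\<psi>, \<eta>\<^sub>\<psi>)\<close> with \<open>\<eta>\<^sub>\<psi>\<close> the profile maximiser lies below the profile likelihood and touches it at
  \<open>\<psi>\<close>. Using the submodels through both end points bounds an increment from both sides. Moreover the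
  submodel through the overall maximiser has a vanishing derivative there; this first-order condition is
  sharper than comparing values: it locates the maximiser up to \<open>O(1/n)\<close> once it is known to be within
  \<open>O(n\<^sup>-\<^sup>1\<^sup>/\<^sup>2)\<close> of \<open>\<theta>0\<close>.\<close>

lemma profile_likelihood_expansion:
  fixes lik :: "real \<Rightarrow> 'h::real_normed_vector \<Rightarrow> 'x \<Rightarrow> real" and lfs :: "real \<Rightarrow> real \<Rightarrow> 'h \<Rightarrow> 'h"
    and d :: "nat \<Rightarrow> 'x" and H :: "'h set" and n :: nat and \<theta>0 :: real and \<eta>0 :: 'h
  defines "pl \<equiv> profile_lik lik H d n" and "s \<equiv> emp_mean d n (ell_deriv lik lfs 1 0 \<theta>0 \<theta>0 \<eta>0)"
  assumes ball: "ball \<theta>0 \<delta> \<subseteq> \<Theta>" and n: "0 < n" and C: "1 \<le> C" and \<eta>0: "\<eta>0 \<in> H"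
    and pop: "population_conditions P lik lfs H \<theta>0 \<eta>0 \<delta> I C"
    and path: "regular_path P lik lfs \<Theta> H \<theta>0 \<eta>0 \<delta> F C n d"
    and argmax: "\<And>\<theta>. \<theta> \<in> \<Theta> \<Longrightarrow> is_arg_max (lik_n lik d n \<theta>) (\<lambda>\<eta>. \<eta> \<in> H) (\<eta>h \<theta>)"
    and lfs: "\<And>\<theta> \<eta>. \<theta> \<in> \<Theta> \<Longrightarrow> \<eta> \<in> H \<Longrightarrow> lfs \<theta> \<theta> \<eta> = \<eta>"
    and lfsH: "\<And>t \<theta> \<eta>. (t, \<theta>, \<eta>) \<in> param_nbhd \<Theta> H \<theta>0 \<eta>0 \<delta> \<Longrightarrow> lfs t \<theta> \<eta> \<in> H"
    and \<delta>': "\<delta>' \<le> \<delta>" "C * (1 / sqrt n + \<delta>') \<le> \<delta>"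
    and rate: "\<And>\<theta>. \<bar>\<theta> - \<theta>0\<bar> < \<delta>' \<Longrightarrow> norm (\<eta>h \<theta> - \<eta>0) \<le> C * (1 / sqrt n + \<bar>\<theta> - \<theta>0\<bar>)"
  shows "\<And>\<theta>. \<bar>\<theta> - \<theta>0\<bar> < \<delta>' \<Longrightarrow> 0 < pl \<theta>"
    and "\<And>\<theta> \<psi>. \<bar>\<theta> - \<theta>0\<bar> < \<delta>' \<Longrightarrow> \<bar>\<psi> - \<theta>0\<bar> < \<delta>' \<Longrightarrow>
      \<bar>(ln (pl \<theta>) - ln (pl \<psi>)) / n - (((\<theta> - \<theta>0) * s - I * (\<theta> - \<theta>0)\<^sup>2 / 2) - ((\<psi> - \<theta>0) * s - I * (\<psi> - \<theta>0)\<^sup>2 / 2))\<bar>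
      \<le> 99 * C ^ 3 * ((1 / sqrt n + \<bar>\<theta> - \<theta>0\<bar>) + (1 / sqrt n + \<bar>\<psi> - \<theta>0\<bar>)) ^ 3"
    and "\<And>m. \<bar>m - \<theta>0\<bar> < \<delta>' \<Longrightarrow> (\<forall>\<theta>\<in>\<Theta>. pl \<theta> \<le> pl m) \<Longrightarrow>
      \<bar>s - I * (m - \<theta>0)\<bar> \<le> 44 * C ^ 3 * (1 / sqrt n + \<bar>m - \<theta>0\<bar>)\<^sup>2"
proof -
  define S where "S t \<psi> = emp_mean d n (ell_deriv lik lfs 0 0 t \<psi> (\<eta>h \<psi>))" for t \<psi>
  define r where "r \<theta> = 1 / sqrt n + \<bar>\<theta> - \<theta>0\<bar>" for \<theta>
  have r0: "0 \<le> r \<theta>" "\<bar>\<theta> - \<theta>0\<bar> \<le> r \<theta>" for \<theta> unfolding r_def by simp_all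
  have in_ball: "\<theta> \<in> ball \<theta>0 \<delta>" if "\<bar>\<theta> - \<theta>0\<bar> < \<delta>'" for \<theta>
    using that \<delta>'(1) by (simp add: dist_real_def)
  then have in\<Theta>: "\<theta> \<in> \<Theta>" if "\<bar>\<theta> - \<theta>0\<bar> < \<delta>'" for \<theta>
    using that ball by blast
  have \<eta>h: "\<eta>h \<theta> \<in> H \<inter> ball \<eta>0 \<delta>" if "\<bar>\<theta> - \<theta>0\<bar> < \<delta>'" for \<theta>
  proof -
    have "norm (\<eta>h \<theta> - \<eta>0) \<le> C * (1 / sqrt n + \<bar>\<theta> - \<theta>0\<bar>)" by (rule rate[OF that])
    also have "\<dots> < C * (1 / sqrt n + \<delta>')" using that C by simp
    also have "\<dots> \<le> \<delta>" by fact
    finally show ?thesis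
      using argmax[OF in\<Theta>[OF that]] by (simp add: is_arg_max_def dist_norm norm_minus_commute)
  qed
  have nbhd: "(t, \<psi>, \<eta>h \<psi>) \<in> param_nbhd \<Theta> H \<theta>0 \<eta>0 \<delta>" if "t \<in> ball \<theta>0 \<delta>" "\<bar>\<psi> - \<theta>0\<bar> < \<delta>'" for t \<psi>
    using that in_ball \<eta>h in\<Theta> ball unfolding param_nbhd_def by auto
  have pos: "0 < lik t (lfs t \<psi> (\<eta>h \<psi>)) (d i)" if "t \<in> ball \<theta>0 \<delta>" "\<bar>\<psi> - \<theta>0\<bar> < \<delta>'" for t \<psi> i
  proof -
    have "regular_obs lik lfs (param_nbhd \<Theta> H \<theta>0 \<eta>0 \<delta>) F (d i)"
      using path unfolding regular_path_def by blast
    from bspec[OF this[unfolded regular_obs_def] nbhd[OF that]] show ?thesis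
      by (simp add: ell_derivs_exist_def)
  qed
  have touch: "pl \<psi> = lik_n lik d n \<psi> (lfs \<psi> \<psi> (\<eta>h \<psi>))" if "\<bar>\<psi> - \<theta>0\<bar> < \<delta>'" for \<psi>
    unfolding pl_def using profile_lik_eq(1)[OF argmax[OF in\<Theta>[OF that]]] lfs[OF in\<Theta>[OF that]] \<eta>h[OF that] by simp
  show plpos: "0 < pl \<theta>" if "\<bar>\<theta> - \<theta>0\<bar> < \<delta>'" for \<theta>
    unfolding touch[OF that] using ln_lik_n_submodel(1)[of n lik \<theta> lfs \<theta> "\<eta>h \<theta>" d] pos[OF in_ball[OF that] that] n by blast
  have lnpl: "ln (pl \<psi>) = n * S \<psi> \<psi>" if "\<bar>\<psi> - \<theta>0\<bar> < \<delta>'" for \<psi>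
    unfolding touch[OF that] S_def
    using ln_lik_n_submodel(2)[of n lik \<psi> lfs \<psi> "\<eta>h \<psi>" d] pos[OF in_ball[OF that] that] n by blast
  have below: "n * S t \<psi> \<le> ln (pl t)" if "t \<in> ball \<theta>0 \<delta>" "\<bar>\<psi> - \<theta>0\<bar> < \<delta>'" for t \<psi>
  proof -
    have "lik_n lik d n t (lfs t \<psi> (\<eta>h \<psi>)) \<le> pl t"
      unfolding pl_def using that ball by (intro profile_lik_eq(2)[OF argmax] lfsH[OF nbhd]) auto
    then show ?thesis
      unfolding S_def using ln_lik_n_submodel[of n lik t lfs \<psi> "\<eta>h \<psi>" d] pos[OF that] n by (metis ln_mono)
  qed
  define Q where "Q t = (t - \<theta>0) * s - I * (t - \<theta>0)\<^sup>2 / 2" for t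
  have Sexp: "\<bar>S t \<psi> - S \<theta>0 \<psi> - Q t\<bar> \<le> 11 * C ^ 3 * (r \<psi> + \<bar>t - \<theta>0\<bar>) ^ 3"
    if "t \<in> ball \<theta>0 \<delta>" "\<bar>\<psi> - \<theta>0\<bar> < \<delta>'" for t \<psi>
    unfolding S_def Q_def r_def s_def
    by (rule submodel_expansion(1)[OF ball n C \<eta>0 pop path that(1) in_ball[OF that(2)] \<eta>h[OF that(2)] rate[OF that(2)]])
  have incr: "Q t - Q \<psi> - 99 * C ^ 3 * (r t + r \<psi>) ^ 3 \<le> (ln (pl t) - ln (pl \<psi>)) / n"
    if "\<bar>t - \<theta>0\<bar> < \<delta>'" "\<bar>\<psi> - \<theta>0\<bar> < \<delta>'" for t \<psi>
  proof -
    have C3: "0 \<le> C ^ 3" using C by simp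
    have "(r \<psi> + \<bar>t - \<theta>0\<bar>) ^ 3 \<le> (r t + r \<psi>) ^ 3"
      using r0 by (intro power_mono) (auto intro: add_nonneg_nonneg simp: add.commute add_left_mono)
    then have a: "11 * C ^ 3 * (r \<psi> + \<bar>t - \<theta>0\<bar>) ^ 3 \<le> 11 * C ^ 3 * (r t + r \<psi>) ^ 3"
      using C3 by (intro mult_left_mono) auto
    have "r \<psi> + \<bar>\<psi> - \<theta>0\<bar> \<le> 2 * (r t + r \<psi>)" using r0(2)[of \<psi>] r0(1)[of t] r0(1)[of \<psi>]
      by simp
    then have "(r \<psi> + \<bar>\<psi> - \<theta>0\<bar>) ^ 3 \<le> (2 * (r t + r \<psi>)) ^ 3"
      using r0 by (intro power_mono) (auto intro: add_nonneg_nonneg)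
    also have "\<dots> = 8 * (r t + r \<psi>) ^ 3" by (simp only: power_mult_distrib) simp
    finally have b: "11 * C ^ 3 * (r \<psi> + \<bar>\<psi> - \<theta>0\<bar>) ^ 3 \<le> 11 * C ^ 3 * (8 * (r t + r \<psi>) ^ 3)"
      using C3 by (intro mult_left_mono) auto
    have "n * (S t \<psi> - S \<psi> \<psi>) \<le> ln (pl t) - ln (pl \<psi>)"
      using below[OF in_ball[OF that(1)] that(2)] lnpl[OF that(2)] by (simp add: algebra_simps)
    then have "S t \<psi> - S \<psi> \<psi> \<le> (ln (pl t) - ln (pl \<psi>)) / n" using n by (simp add: field_simps)
    moreover have "Q t - Q \<psi> - 11 * C ^ 3 * (r t + r \<psi>) ^ 3 - 11 * C ^ 3 * (8 * (r t + r \<psi>) ^ 3) \<le> S t \<psi> - S \<psi> \<psi>"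
      using Sexp[OF in_ball[OF that(1)] that(2)] Sexp[OF in_ball[OF that(2)] that(2)] a b
      unfolding abs_le_iff by linarith
    ultimately show ?thesis by simp
  qed
  show "\<bar>(ln (pl \<theta>) - ln (pl \<psi>)) / n - (((\<theta> - \<theta>0) * s - I * (\<theta> - \<theta>0)\<^sup>2 / 2) - ((\<psi> - \<theta>0) * s - I * (\<psi> - \<theta>0)\<^sup>2 / 2))\<bar>
      \<le> 99 * C ^ 3 * ((1 / sqrt n + \<bar>\<theta> - \<theta>0\<bar>) + (1 / sqrt n + \<bar>\<psi> - \<theta>0\<bar>)) ^ 3"
    if "\<bar>\<theta> - \<theta>0\<bar> < \<delta>'" "\<bar>\<psi> - \<theta>0\<bar> < \<delta>'" for \<theta> \<psi>
  proof -
    have "(ln (pl \<psi>) - ln (pl \<theta>)) / n = - ((ln (pl \<theta>) - ln (pl \<psi>)) / n)" by (simp add: diff_divide_distrib)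
    then have "\<bar>(ln (pl \<theta>) - ln (pl \<psi>)) / n - (Q \<theta> - Q \<psi>)\<bar> \<le> 99 * C ^ 3 * (r \<theta> + r \<psi>) ^ 3"
      using incr[OF that] incr[OF that(2,1)] unfolding add.commute[of "r \<psi>"] by linarith
    then show ?thesis unfolding Q_def r_def .
  qed
  show "\<bar>s - I * (m - \<theta>0)\<bar> \<le> 44 * C ^ 3 * (1 / sqrt n + \<bar>m - \<theta>0\<bar>)\<^sup>2"
    if m: "\<bar>m - \<theta>0\<bar> < \<delta>'" and max: "\<forall>\<theta>\<in>\<Theta>. pl \<theta> \<le> pl m" for m
  proof -
    have sme: "((\<lambda>t. S t m) has_real_derivative emp_mean d n (ell_deriv lik lfs 1 0 m m (\<eta>h m))) (at m)"
      unfolding S_def using path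
      by (intro sample_mean_expansions(5)[where F = F and C = C, OF ball _ _ in_ball[OF m] in_ball[OF m] \<eta>h[OF m]])
        (auto simp: regular_path_def)
    have "0 < \<delta> - \<bar>m - \<theta>0\<bar>" using in_ball[OF m] by (simp add: dist_real_def)
    moreover have "S t m \<le> S m m" if "\<bar>m - t\<bar> < \<delta> - \<bar>m - \<theta>0\<bar>" for t
    proof -
      have t: "t \<in> ball \<theta>0 \<delta>" using that by (simp add: dist_real_def)
      have "0 < lik_n lik d n t (lfs t m (\<eta>h m))" using pos[OF t m] n by (intro ln_lik_n_submodel(1))
      moreover have "lik_n lik d n t (lfs t m (\<eta>h m)) \<le> pl t"
        unfolding pl_def using t m ball by (intro profile_lik_eq(2)[OF argmax] lfsH[OF nbhd]) auto
      ultimately have "ln (pl t) \<le> ln (pl m)" using max t ball by (intro ln_mono) (auto intro: less_le_trans)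
      then have "n * S t m \<le> n * S m m" using below[OF t m] lnpl[OF m] by linarith
      then show ?thesis using n by simp
    qed
    ultimately have "emp_mean d n (ell_deriv lik lfs 1 0 m m (\<eta>h m)) = 0"
      by (intro DERIV_local_max[OF sme]) auto
    then have "\<bar>s - I * (m - \<theta>0)\<bar> \<le> 11 * C ^ 3 * (r m + \<bar>m - \<theta>0\<bar>)\<^sup>2"
      using submodel_expansion(2)[OF ball n C \<eta>0 pop path in_ball[OF m] in_ball[OF m] \<eta>h[OF m] rate[OF m]]
      unfolding s_def r_def by (simp only: diff_0 abs_minus_cancel)
    also have "\<dots> \<le> 11 * C ^ 3 * (2 * r m)\<^sup>2"
      using r0[of m] C by (intro mult_left_mono power_mono) auto
    also have "\<dots> = 44 * C ^ 3 * (r m)\<^sup>2" by (simp only: power_mult_distrib) simp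
    finally show ?thesis unfolding r_def .
  qed
qed


text \<open>Putting the two parts of the expansion together: the first-order condition shows that the maximiser
  \<open>m\<close> is within \<open>O(n\<^sup>-\<^sup>1\<^sup>/\<^sup>2)\<close> of \<open>\<theta>0\<close>, and that recentring the quadratic at \<open>m\<close> leaves a linear term
  with coefficient \<open>s - I (m - \<theta>0) = O(1/n)\<close>, which is of the same order as the cubic remainder.\<close>

lemma expansion_imp_nearly_gaussian_weight:
  fixes I C \<theta>0 m s \<delta>' \<delta>'' \<kappa> :: real and n :: nat and pl :: "real \<Rightarrow> real"
  defines "Q \<equiv> \<lambda>t. (t - \<theta>0) * s - I * (t - \<theta>0)\<^sup>2 / 2"
    and "C2 \<equiv> 2 * (C + 88 * C ^ 3) / I"
  assumes n: "0 < n" and I: "0 < I" and C: "1 \<le> C" and s: "\<bar>s\<bar> \<le> C / sqrt n"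
    and \<delta>'': "\<delta>'' < \<delta>'" and \<delta>': "88 * C ^ 3 * \<delta>' \<le> I / 2" and m: "\<bar>m - \<theta>0\<bar> < \<delta>'"
    and score: "\<bar>s - I * (m - \<theta>0)\<bar> \<le> 44 * C ^ 3 * (1 / sqrt n + \<bar>m - \<theta>0\<bar>)\<^sup>2"
    and pos: "\<And>\<theta>. \<bar>\<theta> - \<theta>0\<bar> < \<delta>' \<Longrightarrow> 0 < pl \<theta>"
    and incr: "\<And>\<theta>. \<bar>\<theta> - \<theta>0\<bar> < \<delta>' \<Longrightarrow> \<bar>(ln (pl \<theta>) - ln (pl m)) / n - (Q \<theta> - Q m)\<bar>
      \<le> 99 * C ^ 3 * ((1 / sqrt n + \<bar>\<theta> - \<theta>0\<bar>) + (1 / sqrt n + \<bar>m - \<theta>0\<bar>)) ^ 3"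
    and far: "\<And>\<theta>. \<theta> \<in> \<Theta> \<Longrightarrow> \<delta>'' < \<bar>\<theta> - \<theta>0\<bar> \<Longrightarrow> 0 \<le> pl \<theta> \<and> pl \<theta> \<le> exp (- \<kappa> * n) * pl m"
  shows "nearly_gaussian_weight \<Theta> I (C2 + 44 * C ^ 3 * (1 + C2)\<^sup>2 + 792 * C ^ 3 * (1 + C2) ^ 3) \<delta>'' \<kappa> \<theta>0 n m
    (\<lambda>\<theta>. pl \<theta> / pl m)"
proof -
  define k where "k = 1 / sqrt n"
  define a where "a = \<bar>m - \<theta>0\<bar>"
  have k: "0 < k" "k \<le> 1" unfolding k_def using n by simp_all
  have a: "0 \<le> a" "a < \<delta>'" unfolding a_def using m by simp_all
  have C3: "0 \<le> C ^ 3" using C by simp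
  have C2: "0 \<le> C2" unfolding C2_def using C I by simp
  have plm: "0 < pl m" by (rule pos[OF m])
  have "I * a = \<bar>I * (m - \<theta>0)\<bar>" unfolding a_def using I by (simp add: abs_mult)
  also have "\<dots> \<le> \<bar>s\<bar> + \<bar>s - I * (m - \<theta>0)\<bar>" by linarith
  also have "\<dots> \<le> C * k + 44 * C ^ 3 * (k + a)\<^sup>2" using s score unfolding k_def a_def by simp
  also have "\<dots> \<le> C * k + 44 * C ^ 3 * (2 * k + 2 * \<delta>' * a)"
  proof -
    have "(k + a)\<^sup>2 \<le> 2 * (k * k) + 2 * (a * a)"
      using zero_le_power2[of "k - a"] by (simp add: power2_eq_square algebra_simps)
    also have "\<dots> \<le> 2 * (k * 1) + 2 * (\<delta>' * a)"
      using k a by (intro add_mono mult_left_mono mult_right_mono) auto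
    finally show ?thesis using C3 by (intro add_left_mono mult_left_mono) auto
  qed
  also have "\<dots> = (C + 88 * C ^ 3) * k + 88 * C ^ 3 * \<delta>' * a" by (simp add: algebra_simps)
  also have "\<dots> \<le> (C + 88 * C ^ 3) * k + I / 2 * a"
    using \<delta>' a by (intro add_left_mono mult_right_mono) auto
  finally have "a \<le> C2 * k" unfolding C2_def using I by (simp add: field_simps)
  then have mk: "\<bar>m - \<theta>0\<bar> \<le> C2 * k" unfolding a_def .
  have "1 / sqrt n + \<bar>m - \<theta>0\<bar> \<le> (1 + C2) * k" using mk unfolding k_def[symmetric] by (simp add: algebra_simps)
  then have "(1 / sqrt n + \<bar>m - \<theta>0\<bar>)\<^sup>2 \<le> ((1 + C2) * k)\<^sup>2" by (intro power_mono) auto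
  then have "44 * C ^ 3 * (1 / sqrt n + \<bar>m - \<theta>0\<bar>)\<^sup>2 \<le> 44 * C ^ 3 * ((1 + C2) * k)\<^sup>2"
    using C3 by (intro mult_left_mono) auto
  with score have lin: "\<bar>s - I * (m - \<theta>0)\<bar> \<le> 44 * C ^ 3 * ((1 + C2) * k)\<^sup>2" by linarith
  let ?K = "C2 + 44 * C ^ 3 * (1 + C2)\<^sup>2 + 792 * C ^ 3 * (1 + C2) ^ 3"
  have near: "\<exists>R. pl \<theta> / pl m = exp (R - n * I * (\<theta> - m)\<^sup>2 / 2) \<and> \<bar>R\<bar> \<le> ?K * n * (\<bar>\<theta> - m\<bar> + 1 / sqrt n) ^ 3"
    if "\<bar>\<theta> - \<theta>0\<bar> \<le> \<delta>''" for \<theta>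
  proof -
    have \<theta>: "\<bar>\<theta> - \<theta>0\<bar> < \<delta>'" using that \<delta>'' by simp
    define u where "u = \<bar>\<theta> - m\<bar> + k"
    have u: "0 \<le> u" "k \<le> u" "\<bar>\<theta> - m\<bar> \<le> u" unfolding u_def using k by simp_all
    define L where "L = (ln (pl \<theta>) - ln (pl m)) / n"
    have "(k + \<bar>\<theta> - \<theta>0\<bar>) + (k + \<bar>m - \<theta>0\<bar>) \<le> u + 2 * C2 * k + k"
      using mk unfolding u_def by linarith
    also have "\<dots> \<le> 2 * (1 + C2) * u"
      using u mult_left_mono[OF u(2) C2] by (simp add: algebra_simps)
    finally have "((k + \<bar>\<theta> - \<theta>0\<bar>) + (k + \<bar>m - \<theta>0\<bar>)) ^ 3 \<le> (2 * (1 + C2) * u) ^ 3"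
      using k by (intro power_mono) auto
    also have "\<dots> = 8 * (1 + C2) ^ 3 * u ^ 3" by (simp only: power_mult_distrib) simp
    finally have "99 * C ^ 3 * ((k + \<bar>\<theta> - \<theta>0\<bar>) + (k + \<bar>m - \<theta>0\<bar>)) ^ 3 \<le> 99 * C ^ 3 * (8 * (1 + C2) ^ 3 * u ^ 3)"
      using C3 by (intro mult_left_mono) auto
    then have cubic: "\<bar>L - (Q \<theta> - Q m)\<bar> \<le> 792 * C ^ 3 * (1 + C2) ^ 3 * u ^ 3"
      using incr[OF \<theta>] unfolding k_def[symmetric] L_def by linarith
    have "Q \<theta> - Q m + I * (\<theta> - m)\<^sup>2 / 2 = (\<theta> - m) * (s - I * (m - \<theta>0))"
      unfolding Q_def by (simp add: power2_eq_square field_simps)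
    moreover have "\<bar>(\<theta> - m) * (s - I * (m - \<theta>0))\<bar> \<le> u * (44 * C ^ 3 * ((1 + C2) * u)\<^sup>2)"
      unfolding abs_mult
    proof (intro mult_mono)
      have "((1 + C2) * k)\<^sup>2 \<le> ((1 + C2) * u)\<^sup>2" using C2 u k by (intro power_mono mult_left_mono) auto
      then have "44 * C ^ 3 * ((1 + C2) * k)\<^sup>2 \<le> 44 * C ^ 3 * ((1 + C2) * u)\<^sup>2"
        using C3 by (intro mult_left_mono) auto
      then show "\<bar>s - I * (m - \<theta>0)\<bar> \<le> 44 * C ^ 3 * ((1 + C2) * u)\<^sup>2" using lin by linarith
    qed (use u in auto)
    ultimately have linear: "\<bar>Q \<theta> - Q m + I * (\<theta> - m)\<^sup>2 / 2\<bar> \<le> 44 * C ^ 3 * (1 + C2)\<^sup>2 * u ^ 3"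
      by (simp add: power2_eq_square power3_eq_cube algebra_simps)
    have "L + I * (\<theta> - m)\<^sup>2 / 2 = (L - (Q \<theta> - Q m)) + (Q \<theta> - Q m + I * (\<theta> - m)\<^sup>2 / 2)" by simp
    then have "\<bar>L + I * (\<theta> - m)\<^sup>2 / 2\<bar> \<le> 792 * C ^ 3 * (1 + C2) ^ 3 * u ^ 3 + 44 * C ^ 3 * (1 + C2)\<^sup>2 * u ^ 3"
      using cubic linear by linarith
    also have "\<dots> \<le> ?K * u ^ 3"
      using C2 u by (simp add: algebra_simps)
    finally have "n * \<bar>L + I * (\<theta> - m)\<^sup>2 / 2\<bar> \<le> n * (?K * u ^ 3)" by (intro mult_left_mono) auto
    then have "\<bar>n * (L + I * (\<theta> - m)\<^sup>2 / 2)\<bar> \<le> ?K * n * (\<bar>\<theta> - m\<bar> + 1 / sqrt n) ^ 3"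
      unfolding abs_mult u_def k_def by (simp only: abs_of_nat mult.assoc mult.left_commute)
    moreover have "n * L = ln (pl \<theta> / pl m)"
      unfolding L_def using n pos[OF \<theta>] plm by (simp add: ln_div)
    then have "pl \<theta> / pl m = exp (n * L)" using pos[OF \<theta>] plm by simp
    then have "pl \<theta> / pl m = exp (n * (L + I * (\<theta> - m)\<^sup>2 / 2) - n * I * (\<theta> - m)\<^sup>2 / 2)"
      by (simp add: algebra_simps)
    ultimately show ?thesis by blast
  qed
  have "C2 * k \<le> ?K * k" using C2 C3 k by (intro mult_right_mono) auto
  then have "\<bar>m - \<theta>0\<bar> \<le> ?K / sqrt n" using mk unfolding k_def by simp
  moreover have "0 \<le> pl \<theta> / pl m \<and> pl \<theta> / pl m \<le> exp (- \<kappa> * n)"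
    if "\<theta> \<in> \<Theta>" "\<delta>'' < \<bar>\<theta> - \<theta>0\<bar>" for \<theta>
    using far[OF that] plm by (simp add: divide_le_eq)
  ultimately show ?thesis using near unfolding nearly_gaussian_weight_def by blast
qed

section \<open>Means of derivatives and the efficient information\<close>

lemma has_L1_envelope_integrable:
  assumes "has_L1_envelope P V f" "v \<in> V"
  shows "integrable P (f v)"
proof -
  obtain F where F: "integrable P F" "AE x in P. \<forall>v\<in>V. \<bar>f v x\<bar> \<le> F x" "f v \<in> borel_measurable P"
    using assms unfolding has_L1_envelope_def by blast
  have "AE x in P. norm (f v x) \<le> norm (F x)"
    using F(2) by eventually_elim (use assms(2) in \<open>auto intro: order_trans[OF _ abs_ge_self]\<close>)
  then show ?thesis by (rule Bochner_Integration.integrable_bound[OF F(1,3)])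
qed

text \<open>Differentiation under the integral sign, in the direction that is needed: if the integral is
  differentiable, then its derivative is the integral of the derivative. Difference quotients along one
  sequence suffice, and dominated convergence applies to them by the mean value inequality.\<close>

lemma derivative_of_integral_eq:
  fixes f f' :: "real \<Rightarrow> 'x \<Rightarrow> real"
  assumes \<delta>: "0 < \<delta>" and F: "integrable P F"
    and f: "AE x in P. \<forall>\<theta>\<in>ball \<theta>0 \<delta>. ((\<lambda>\<theta>. f \<theta> x) has_real_derivative f' \<theta> x) (at \<theta>) \<and> \<bar>f' \<theta> x\<bar> \<le> F x"
    and int: "\<And>\<theta>. \<theta> \<in> ball \<theta>0 \<delta> \<Longrightarrow> integrable P (f \<theta>)" and meas: "f' \<theta>0 \<in> borel_measurable P"
    and D: "((\<lambda>\<theta>. integral\<^sup>L P (f \<theta>)) has_real_derivative D) (at \<theta>0)"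
  shows "integral\<^sup>L P (f' \<theta>0) = D"
proof -
  define h where "h k = \<delta> / real (k + 2)" for k :: nat
  have h: "0 < h k" "h k < \<delta>" for k unfolding h_def using \<delta> by (simp_all add: field_simps add_pos_nonneg)
  have h0: "h \<longlonglongrightarrow> 0" unfolding h_def by real_asymp
  have hF: "filterlim h (at 0) sequentially"
    using h0 h(1) by (auto simp: filterlim_at intro!: always_eventually less_imp_neq[symmetric])
  have in_ball: "\<theta>0 + h k \<in> ball \<theta>0 \<delta>" "\<theta>0 \<in> ball \<theta>0 \<delta>" for k
    using h[of k] \<delta> by (simp_all add: dist_real_def)
  define q where "q k x = (f (\<theta>0 + h k) x - f \<theta>0 x) / h k" for k x
  have "(\<lambda>k. integral\<^sup>L P (q k)) \<longlonglongrightarrow> integral\<^sup>L P (f' \<theta>0)"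
  proof (rule integral_dominated_convergence[OF meas _ F])
    show "q k \<in> borel_measurable P" for k
      unfolding q_def using int in_ball by (intro borel_measurable_divide borel_measurable_diff) auto
    show "AE x in P. (\<lambda>k. q k x) \<longlonglongrightarrow> f' \<theta>0 x"
      using f
    proof eventually_elim
      fix x assume "\<forall>\<theta>\<in>ball \<theta>0 \<delta>. ((\<lambda>\<theta>. f \<theta> x) has_real_derivative f' \<theta> x) (at \<theta>) \<and> \<bar>f' \<theta> x\<bar> \<le> F x"
      then have "((\<lambda>y. (f (\<theta>0 + y) x - f \<theta>0 x) / y) \<longlongrightarrow> f' \<theta>0 x) (at 0)"
        using in_ball(2) by (simp add: DERIV_def)
      from filterlim_compose[OF this hF] show "(\<lambda>k. q k x) \<longlonglongrightarrow> f' \<theta>0 x" unfolding q_def .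
    qed
    show "AE x in P. norm (q k x) \<le> F x" for k
      using f
    proof eventually_elim
      fix x assume d: "\<forall>\<theta>\<in>ball \<theta>0 \<delta>. ((\<lambda>\<theta>. f \<theta> x) has_real_derivative f' \<theta> x) (at \<theta>) \<and> \<bar>f' \<theta> x\<bar> \<le> F x"
      have seg: "u \<in> ball \<theta>0 \<delta>" if "\<bar>u - \<theta>0\<bar> \<le> \<bar>\<theta>0 + h k - \<theta>0\<bar>" for u
        using that h[of k] by (simp add: dist_real_def)
      have "\<bar>f (\<theta>0 + h k) x - f \<theta>0 x\<bar> \<le> F x * h k"
        using taylor_remainder_le[where diff = "\<lambda>m u. if m = 0 then f u x else f' u x" and n = 1
            and a = \<theta>0 and t = "\<theta>0 + h k" and B = "F x"] d seg h(1)[of k] by simp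
      then show "norm (q k x) \<le> F x" unfolding q_def using h(1)[of k] by (simp add: abs_divide field_simps)
    qed
  qed
  moreover have "integral\<^sup>L P (q k) = (integral\<^sup>L P (f (\<theta>0 + h k)) - integral\<^sup>L P (f \<theta>0)) / h k" for k
    unfolding q_def using int in_ball by simp
  moreover have "(\<lambda>k. (integral\<^sup>L P (f (\<theta>0 + h k)) - integral\<^sup>L P (f \<theta>0)) / h k) \<longlonglongrightarrow> D"
    using filterlim_compose[OF D[unfolded DERIV_def] hF] .
  ultimately show ?thesis by (simp add: LIMSEQ_unique)
qed

text \<open>Positivity of the variance already contains square integrability, because the Bochner integral of a
  function that is not integrable is zero.\<close>

lemma positive_variance_AE_eq:
  fixes f g :: "'x \<Rightarrow> real"
  assumes f: "f \<in> borel_measurable P" "integral\<^sup>L P f = 0" and eq: "AE x in P. f x = g x"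
    and pos: "0 < (\<integral>x. (g x - integral\<^sup>L P g)\<^sup>2 \<partial>P)"
  shows "integrable P (\<lambda>x. (f x)\<^sup>2)" "(\<integral>x. (g x - integral\<^sup>L P g)\<^sup>2 \<partial>P) = (\<integral>x. (f x)\<^sup>2 \<partial>P)"
proof -
  have mean: "integral\<^sup>L P g = 0"
  proof (cases "g \<in> borel_measurable P")
    case True
    have "integral\<^sup>L P f = integral\<^sup>L P g" by (rule integral_cong_AE[OF f(1) True eq])
    then show ?thesis using f(2) by simp
  next
    case False
    then show ?thesis by (intro not_integrable_integral_eq) auto
  qed
  have g2: "integrable P (\<lambda>x. (g x)\<^sup>2)"
    using pos mean not_integrable_integral_eq[of P "\<lambda>x. (g x)\<^sup>2"] by auto
  have eq2: "AE x in P. (f x)\<^sup>2 = (g x)\<^sup>2" using eq by eventually_elim simp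
  have f2: "(\<lambda>x. (f x)\<^sup>2) \<in> borel_measurable P" using f(1) by simp
  show "integrable P (\<lambda>x. (f x)\<^sup>2)"
    using integrable_cong_AE[OF f2 borel_measurable_integrable[OF g2] eq2] g2 by simp
  show "(\<integral>x. (g x - integral\<^sup>L P g)\<^sup>2 \<partial>P) = (\<integral>x. (f x)\<^sup>2 \<partial>P)"
    using integral_cong_AE[OF f2 borel_measurable_integrable[OF g2] eq2] mean by simp
qed

lemma continuously_differentiable_imp_Lipschitz_at:
  fixes \<rho> \<rho>' :: "real \<Rightarrow> real"
  assumes "0 < \<delta>" "\<And>\<theta>. \<theta> \<in> ball \<theta>0 \<delta> \<Longrightarrow> (\<rho> has_real_derivative \<rho>' \<theta>) (at \<theta>)" "continuous_on (ball \<theta>0 \<delta>) \<rho>'"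
  shows "\<exists>K\<ge>0. \<forall>\<theta>. \<bar>\<theta> - \<theta>0\<bar> \<le> \<delta> / 2 \<longrightarrow> \<bar>\<rho> \<theta> - \<rho> \<theta>0\<bar> \<le> K * \<bar>\<theta> - \<theta>0\<bar>"
proof -
  have sub: "cball \<theta>0 (\<delta> / 2) \<subseteq> ball \<theta>0 \<delta>" using assms(1) by auto
  have "compact (\<rho>' ` cball \<theta>0 (\<delta> / 2))"
    by (intro compact_continuous_image continuous_on_subset[OF assms(3) sub] compact_cball)
  from compact_imp_bounded[OF this] obtain K where K: "\<And>u. u \<in> cball \<theta>0 (\<delta> / 2) \<Longrightarrow> \<bar>\<rho>' u\<bar> \<le> K"
    unfolding bounded_real by blast
  have "0 \<le> K" using K[of \<theta>0] assms(1) by simp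
  moreover have "\<bar>\<rho> \<theta> - \<rho> \<theta>0\<bar> \<le> K * \<bar>\<theta> - \<theta>0\<bar>" if "\<bar>\<theta> - \<theta>0\<bar> \<le> \<delta> / 2" for \<theta>
  proof -
    have seg: "u \<in> cball \<theta>0 (\<delta> / 2)" if "\<bar>u - \<theta>0\<bar> \<le> \<bar>\<theta> - \<theta>0\<bar>" for u
      using that \<open>\<bar>\<theta> - \<theta>0\<bar> \<le> \<delta> / 2\<close> by (simp add: dist_real_def abs_minus_commute)
    have "(\<rho> has_real_derivative \<rho>' u) (at u)" "\<bar>\<rho>' u\<bar> \<le> K" if "\<bar>u - \<theta>0\<bar> \<le> \<bar>\<theta> - \<theta>0\<bar>" for u
      using seg[OF that] sub assms(2) K by blast+
    then show ?thesis
      using taylor_remainder_le[where diff = "\<lambda>m u. if m = 0 then \<rho> u else \<rho>' u" and n = 1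
            and a = \<theta>0 and t = \<theta> and B = K] by simp
  qed
  ultimately show ?thesis by blast
qed

lemma posterior_profile_rescale:
  assumes "0 < c"
  shows "posterior_profile lik H \<Theta> \<rho> d n = density (lebesgue_on \<Theta>)
    (\<lambda>\<theta>. ennreal (\<rho> \<theta> * (profile_lik lik H d n \<theta> / c) /
      (\<integral>\<theta>'. \<rho> \<theta>' * (profile_lik lik H d n \<theta>' / c) \<partial>lebesgue_on \<Theta>)))"
proof -
  have "(\<integral>\<theta>'. \<rho> \<theta>' * (profile_lik lik H d n \<theta>' / c) \<partial>lebesgue_on \<Theta>)
      = (\<integral>\<theta>'. \<rho> \<theta>' * profile_lik lik H d n \<theta>' \<partial>lebesgue_on \<Theta>) / c" by simp
  then show ?thesis unfolding posterior_profile_def using assms by simp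
qed

section \<open>Normal approximation of the posterior profile distribution\<close>

theorem theorem2:
  fixes M :: "'w measure"
    and X :: "'w \<Rightarrow> nat \<Rightarrow> 'x"
    and \<mu> P :: "'x measure"
    and \<Theta> :: "real set"
    and H :: "'h::real_normed_vector set"
    and lik :: "real \<Rightarrow> 'h \<Rightarrow> 'x \<Rightarrow> real"
    and lfs :: "real \<Rightarrow> real \<Rightarrow> 'h \<Rightarrow> 'h"
    and \<theta>0 :: real
    and \<eta>0 :: 'h
    and \<eta>hat :: "nat \<Rightarrow> real \<Rightarrow> 'w \<Rightarrow> 'h"
    and \<theta>hat :: "nat \<Rightarrow> 'w \<Rightarrow> real"
    and \<rho> :: "real \<Rightarrow> real"
  assumes model: "semiparametric_model \<mu> lik \<Theta> H"
    and true_param: "\<theta>0 \<in> \<Theta>" "\<eta>0 \<in> H"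
    and P: "P = model_law \<mu> lik \<theta>0 \<eta>0"
    and sample: "iid_sample M X P"
    and \<eta>hat: "\<And>n \<theta> \<omega>. \<theta> \<in> \<Theta> \<Longrightarrow> \<omega> \<in> space M \<Longrightarrow>
      is_arg_max (lik_n lik (X \<omega>) n \<theta>) (\<lambda>\<eta>. \<eta> \<in> H) (\<eta>hat n \<theta> \<omega>)"
    and mle: "\<And>n \<omega>. \<omega> \<in> space M \<Longrightarrow>
      is_arg_max (\<lambda>(\<theta>, \<eta>). lik_n lik (X \<omega>) n \<theta> \<eta>) (\<lambda>(\<theta>, \<eta>). \<theta> \<in> \<Theta> \<and> \<eta> \<in> H)
        (\<theta>hat n \<omega>, \<eta>hat n (\<theta>hat n \<omega>) \<omega>)"
    and score: "has_theta_score \<mu> lik \<theta>0 \<eta>0"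
    and submodel: "\<And>\<theta> \<eta>. \<theta> \<in> \<Theta> \<Longrightarrow> \<eta> \<in> H \<Longrightarrow> \<forall>\<^sub>F t in at \<theta> within \<Theta>. lfs t \<theta> \<eta> \<in> H"
    and least_favorable:
      "AE x in P. ell_deriv lik lfs 1 0 \<theta>0 \<theta>0 \<eta>0 x = efficient_score \<mu> lik H \<theta>0 \<eta>0 x"
    and A1: "compact \<Theta>" "\<theta>0 \<in> interior \<Theta>"
    and A2: "\<And>\<theta> \<eta>. \<theta> \<in> \<Theta> \<Longrightarrow> \<eta> \<in> H \<Longrightarrow> lfs \<theta> \<theta> \<eta> = \<eta>"
    and A3: "\<And>\<theta>s. (\<And>n \<omega>. \<omega> \<in> space M \<Longrightarrow> \<theta>s n \<omega> \<in> \<Theta>) \<Longrightarrow>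
      o_P_one M (\<lambda>n \<omega>. ereal (\<theta>s n \<omega> - \<theta>0)) \<Longrightarrow>
      O_P M (\<lambda>n \<omega>. norm (\<eta>hat n (\<theta>s n \<omega>) \<omega> - \<eta>0)) (\<lambda>n \<omega>. 1 / sqrt (real n) + \<bar>\<theta>s n \<omega> - \<theta>0\<bar>)"
    and A4_envelopes: "\<exists>\<delta>>0.
      (\<forall>(t, \<theta>, \<eta>) \<in> param_nbhd \<Theta> H \<theta>0 \<eta>0 \<delta>. lfs t \<theta> \<eta> \<in> H) \<and>
      (AE x in P. \<forall>(t, \<theta>, \<eta>) \<in> param_nbhd \<Theta> H \<theta>0 \<eta>0 \<delta>. ell_derivs_exist lik lfs t \<theta> \<eta> x) \<and>
      (\<forall>(l, m) \<in> {(0,0), (1,0), (2,0), (3,0), (1,1), (1,2), (2,1)}.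
        has_L1_envelope P (param_nbhd \<Theta> H \<theta>0 \<eta>0 \<delta>) (\<lambda>(t, \<theta>, \<eta>). ell_deriv lik lfs l m t \<theta> \<eta>))"
    and A4_information:
      "- (\<integral>x. (ell_deriv lik lfs 1 0 \<theta>0 \<theta>0 \<eta>0 x)\<^sup>2 \<partial>P) = (\<integral>x. ell_deriv lik lfs 2 0 \<theta>0 \<theta>0 \<eta>0 x \<partial>P)"
    and A4_mean_derivative:
      "((\<lambda>\<theta>. \<integral>x. ell_deriv lik lfs 1 0 \<theta>0 \<theta> \<eta>0 x \<partial>P) has_real_derivative 0) (at \<theta>0)"
    and A5: "\<exists>\<delta>>0.
      P_Donsker P ((\<lambda>(t, \<theta>, \<eta>). ell_deriv lik lfs 2 0 t \<theta> \<eta>) ` param_nbhd \<Theta> H \<theta>0 \<eta>0 \<delta>) \<and>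
      P_Donsker P ((\<lambda>(t, \<theta>, \<eta>). ell_deriv lik lfs 1 1 t \<theta> \<eta>) ` param_nbhd \<Theta> H \<theta>0 \<eta>0 \<delta>) \<and>
      P_Glivenko_Cantelli P ((\<lambda>(t, \<theta>, \<eta>). ell_deriv lik lfs 3 0 t \<theta> \<eta>) ` param_nbhd \<Theta> H \<theta>0 \<eta>0 \<delta>)"
    and A6: "\<exists>\<delta>>0.
      O_P_uniformly M (H \<inter> ball \<eta>0 \<delta>)
        (\<lambda>n \<eta> \<omega>. emp_process P (X \<omega>) n
          (\<lambda>x. ell_deriv lik lfs 1 0 \<theta>0 \<theta>0 \<eta> x - ell_deriv lik lfs 1 0 \<theta>0 \<theta>0 \<eta>0 x))
        (\<lambda>n \<eta> \<omega>. norm (\<eta> - \<eta>0)) \<and>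
      (\<exists>C. \<forall>\<eta> \<in> H \<inter> ball \<eta>0 \<delta>.
        \<bar>(\<integral>x. ell_deriv lik lfs 2 0 \<theta>0 \<theta>0 \<eta> x \<partial>P) - (\<integral>x. ell_deriv lik lfs 2 0 \<theta>0 \<theta>0 \<eta>0 x \<partial>P)\<bar>
          \<le> C * norm (\<eta> - \<eta>0)) \<and>
      (\<exists>C. \<forall>\<eta> \<in> H \<inter> ball \<eta>0 \<delta>.
        \<bar>(\<integral>x. ell_deriv lik lfs 1 1 \<theta>0 \<theta>0 \<eta> x \<partial>P) - (\<integral>x. ell_deriv lik lfs 1 1 \<theta>0 \<theta>0 \<eta>0 x \<partial>P)\<bar>
          \<le> C * norm (\<eta> - \<eta>0)) \<and>
      (\<exists>C. \<forall>\<eta> \<in> H \<inter> ball \<eta>0 \<delta>.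
        \<bar>\<integral>x. ell_deriv lik lfs 1 0 \<theta>0 \<theta>0 \<eta> x \<partial>P\<bar> \<le> C * (norm (\<eta> - \<eta>0))\<^sup>2)"
    and A7: "efficient_information \<mu> lik H \<theta>0 \<eta>0 > 0"
    and consistency: "\<And>\<theta>s. (\<And>n \<omega>. \<omega> \<in> space M \<Longrightarrow> \<theta>s n \<omega> \<in> \<Theta>) \<Longrightarrow>
      o_P_one M (\<lambda>n \<omega>. Delta_n lik H (X \<omega>) n (\<theta>hat n \<omega>) (\<theta>s n \<omega>)) \<Longrightarrow>
      o_P_one M (\<lambda>n \<omega>. ereal (\<theta>s n \<omega> - \<theta>0))"
    and profile_measurable: "\<And>n \<omega>. \<omega> \<in> space M \<Longrightarrow>
      profile_lik lik H (X \<omega>) n \<in> borel_measurable (lebesgue_on \<Theta>)"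
    and prior: "proper_prior_density \<Theta> \<rho>" "\<rho> \<theta>0 > 0"
    and prior_smooth: "\<exists>\<delta>>0. \<exists>\<rho>'.
      (\<forall>\<theta> \<in> ball \<theta>0 \<delta>. (\<rho> has_real_derivative \<rho>' \<theta>) (at \<theta>)) \<and> continuous_on (ball \<theta>0 \<delta>) \<rho>'"
  shows "O_P M
    (\<lambda>n \<omega>. SUP \<xi>\<in>UNIV. \<bar>measure (posterior_profile lik H \<Theta> \<rho> (X \<omega>) n)
        {\<theta> \<in> \<Theta>. sqrt (real n) * (\<theta> - \<theta>hat n \<omega>) * sqrt (efficient_information \<mu> lik H \<theta>0 \<eta>0) \<le> \<xi>}
      - cdf std_normal_distribution \<xi>\<bar>)
    (\<lambda>n \<omega>. 1 / sqrt (real n))"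
proof -
  let ?D = "ell_deriv lik lfs"
  define I where "I = efficient_information \<mu> lik H \<theta>0 \<eta>0"
  have I: "0 < I" using A7 unfolding I_def .
  have M: "prob_space M" by (rule iid_sampleD(1)[OF sample])
  interpret M: prob_space M by (rule M)

  \<comment> \<open>One neighbourhood on which all local conditions hold.\<close>
  obtain \<delta>1 where \<delta>1: "0 < \<delta>1"
    and lfsH1: "\<forall>(t, \<theta>, \<eta>) \<in> param_nbhd \<Theta> H \<theta>0 \<eta>0 \<delta>1. lfs t \<theta> \<eta> \<in> H"
    and exist: "AE x in P. \<forall>(t, \<theta>, \<eta>) \<in> param_nbhd \<Theta> H \<theta>0 \<eta>0 \<delta>1. ell_derivs_exist lik lfs t \<theta> \<eta> x"
    and env: "\<And>l m. (l, m) \<in> {(0,0), (1,0), (2,0), (3,0), (1,1), (1,2), (2,1)} \<Longrightarrow>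
        has_L1_envelope P (param_nbhd \<Theta> H \<theta>0 \<eta>0 \<delta>1) (\<lambda>(t, \<theta>, \<eta>). ?D l m t \<theta> \<eta>)"
    using A4_envelopes by blast
  obtain \<delta>2 where \<delta>2: "0 < \<delta>2"
    and D20: "P_Donsker P ((\<lambda>(t, \<theta>, \<eta>). ?D 2 0 t \<theta> \<eta>) ` param_nbhd \<Theta> H \<theta>0 \<eta>0 \<delta>2)"
    and D11: "P_Donsker P ((\<lambda>(t, \<theta>, \<eta>). ?D 1 1 t \<theta> \<eta>) ` param_nbhd \<Theta> H \<theta>0 \<eta>0 \<delta>2)"
    using A5 by blast
  obtain \<delta>3 C20 C11 C10 where \<delta>3: "0 < \<delta>3"
    and G10: "O_P_uniformly M (H \<inter> ball \<eta>0 \<delta>3)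
        (\<lambda>n \<eta> \<omega>. emp_process P (X \<omega>) n (\<lambda>x. ?D 1 0 \<theta>0 \<theta>0 \<eta> x - ?D 1 0 \<theta>0 \<theta>0 \<eta>0 x))
        (\<lambda>n \<eta> \<omega>. norm (\<eta> - \<eta>0))"
    and L20: "\<And>\<eta>. \<eta> \<in> H \<inter> ball \<eta>0 \<delta>3 \<Longrightarrow>
        \<bar>(\<integral>x. ?D 2 0 \<theta>0 \<theta>0 \<eta> x \<partial>P) - (\<integral>x. ?D 2 0 \<theta>0 \<theta>0 \<eta>0 x \<partial>P)\<bar> \<le> C20 * norm (\<eta> - \<eta>0)"
    and L11: "\<And>\<eta>. \<eta> \<in> H \<inter> ball \<eta>0 \<delta>3 \<Longrightarrow>
        \<bar>(\<integral>x. ?D 1 1 \<theta>0 \<theta>0 \<eta> x \<partial>P) - (\<integral>x. ?D 1 1 \<theta>0 \<theta>0 \<eta>0 x \<partial>P)\<bar> \<le> C11 * norm (\<eta> - \<eta>0)"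
    and L10: "\<And>\<eta>. \<eta> \<in> H \<inter> ball \<eta>0 \<delta>3 \<Longrightarrow> \<bar>\<integral>x. ?D 1 0 \<theta>0 \<theta>0 \<eta> x \<partial>P\<bar> \<le> C10 * (norm (\<eta> - \<eta>0))\<^sup>2"
    using A6 by blast
  obtain \<delta>4 where \<delta>4: "0 < \<delta>4" "ball \<theta>0 \<delta>4 \<subseteq> \<Theta>"
    using A1(2) unfolding mem_interior by blast
  define \<delta> where "\<delta> = min (min \<delta>1 \<delta>2) (min \<delta>3 \<delta>4)"
  have \<delta>: "0 < \<delta>" "\<delta> \<le> \<delta>1" "\<delta> \<le> \<delta>2" "\<delta> \<le> \<delta>3" "\<delta> \<le> \<delta>4"
    unfolding \<delta>_def using \<delta>1 \<delta>2 \<delta>3 \<delta>4 by auto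
  have ball: "ball \<theta>0 \<delta> \<subseteq> \<Theta>" using \<delta>4(2) \<delta>(5) by auto
  have nbhd: "param_nbhd \<Theta> H \<theta>0 \<eta>0 \<delta> \<subseteq> param_nbhd \<Theta> H \<theta>0 \<eta>0 \<delta>1"
    "param_nbhd \<Theta> H \<theta>0 \<eta>0 \<delta> \<subseteq> param_nbhd \<Theta> H \<theta>0 \<eta>0 \<delta>2"
    using \<delta> unfolding param_nbhd_def by auto
  have base: "(\<theta>0, \<theta>, \<eta>) \<in> param_nbhd \<Theta> H \<theta>0 \<eta>0 \<delta>" if "\<theta> \<in> ball \<theta>0 \<delta>" "\<eta> \<in> H \<inter> ball \<eta>0 \<delta>" for \<theta> \<eta>
    using that ball \<delta>(1) true_param unfolding param_nbhd_def by auto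
  have \<theta>0: "\<theta>0 \<in> ball \<theta>0 \<delta>" and \<eta>0: "\<eta>0 \<in> H \<inter> ball \<eta>0 \<delta>" using \<delta>(1) true_param by auto
  have lfsH: "lfs t \<theta> \<eta> \<in> H" if "(t, \<theta>, \<eta>) \<in> param_nbhd \<Theta> H \<theta>0 \<eta>0 \<delta>" for t \<theta> \<eta>
    using lfsH1 nbhd(1) that by blast

  have integrable: "integrable P (?D l m \<theta>0 \<theta> \<eta>)"
    if "(l, m) \<in> {(0,0), (1,0), (2,0), (3,0), (1,1), (1,2), (2,1)}" "\<theta> \<in> ball \<theta>0 \<delta>" "\<eta> \<in> H \<inter> ball \<eta>0 \<delta>" for l m \<theta> \<eta>
    using has_L1_envelope_integrable[OF env[OF that(1)], of "(\<theta>0, \<theta>, \<eta>)"] base[OF that(2,3)] nbhd(1) by auto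
  obtain F30 where F30: "integrable P F30" "AE x in P. \<forall>(t, \<theta>, \<eta>) \<in> param_nbhd \<Theta> H \<theta>0 \<eta>0 \<delta>1. \<bar>?D 3 0 t \<theta> \<eta> x\<bar> \<le> F30 x"
    using env[of 3 0] unfolding has_L1_envelope_def by (auto simp: case_prod_unfold)
  obtain F12 where F12: "integrable P F12" "AE x in P. \<forall>(t, \<theta>, \<eta>) \<in> param_nbhd \<Theta> H \<theta>0 \<eta>0 \<delta>1. \<bar>?D 1 2 t \<theta> \<eta> x\<bar> \<le> F12 x"
    using env[of 1 2] unfolding has_L1_envelope_def by (auto simp: case_prod_unfold)
  obtain F21 where F21: "integrable P F21" "AE x in P. \<forall>(t, \<theta>, \<eta>) \<in> param_nbhd \<Theta> H \<theta>0 \<eta>0 \<delta>1. \<bar>?D 2 1 t \<theta> \<eta> x\<bar> \<le> F21 x"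
    using env[of 2 1] unfolding has_L1_envelope_def by (auto simp: case_prod_unfold)
  obtain F11 where F11: "integrable P F11" "AE x in P. \<forall>(t, \<theta>, \<eta>) \<in> param_nbhd \<Theta> H \<theta>0 \<eta>0 \<delta>1. \<bar>?D 1 1 t \<theta> \<eta> x\<bar> \<le> F11 x"
    using env[of 1 1] unfolding has_L1_envelope_def by (auto simp: case_prod_unfold)
  define F where "F x = \<bar>F30 x\<bar> + \<bar>F12 x\<bar> + \<bar>F21 x\<bar>" for x
  have F: "integrable P F" "\<And>x. 0 \<le> F x" unfolding F_def using F30(1) F12(1) F21(1) by auto
  have reg: "AE x in P. regular_obs lik lfs (param_nbhd \<Theta> H \<theta>0 \<eta>0 \<delta>) F x"
    using exist F30(2) F12(2) F21(2)
  proof eventually_elim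
    fix x
    assume a: "\<forall>(t, \<theta>, \<eta>) \<in> param_nbhd \<Theta> H \<theta>0 \<eta>0 \<delta>1. ell_derivs_exist lik lfs t \<theta> \<eta> x"
      "\<forall>(t, \<theta>, \<eta>) \<in> param_nbhd \<Theta> H \<theta>0 \<eta>0 \<delta>1. \<bar>?D 3 0 t \<theta> \<eta> x\<bar> \<le> F30 x"
      "\<forall>(t, \<theta>, \<eta>) \<in> param_nbhd \<Theta> H \<theta>0 \<eta>0 \<delta>1. \<bar>?D 1 2 t \<theta> \<eta> x\<bar> \<le> F12 x"
      "\<forall>(t, \<theta>, \<eta>) \<in> param_nbhd \<Theta> H \<theta>0 \<eta>0 \<delta>1. \<bar>?D 2 1 t \<theta> \<eta> x\<bar> \<le> F21 x"
    have "ell_derivs_exist lik lfs t \<theta> \<eta> x \<and> \<bar>?D 3 0 t \<theta> \<eta> x\<bar> \<le> F x \<and> \<bar>?D 1 2 t \<theta> \<eta> x\<bar> \<le> F x \<and> \<bar>?D 2 1 t \<theta> \<eta> x\<bar> \<le> F x"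
      if "(t, \<theta>, \<eta>) \<in> param_nbhd \<Theta> H \<theta>0 \<eta>0 \<delta>" for t \<theta> \<eta>
    proof -
      have "(t, \<theta>, \<eta>) \<in> param_nbhd \<Theta> H \<theta>0 \<eta>0 \<delta>1" using that nbhd(1) by blast
      from bspec[OF a(1) this] bspec[OF a(2) this] bspec[OF a(3) this] bspec[OF a(4) this]
      show ?thesis unfolding F_def by auto
    qed
    then show "regular_obs lik lfs (param_nbhd \<Theta> H \<theta>0 \<eta>0 \<delta>) F x"
      unfolding regular_obs_def by auto
  qed

  \<comment> \<open>Identification of the coefficients of the expansion.\<close>
  have mean10: "integral\<^sup>L P (?D 1 0 \<theta>0 \<theta>0 \<eta>0) = 0"
    using L10[of \<eta>0] \<eta>0 \<delta>3 by simp
  have meas10: "?D 1 0 \<theta>0 \<theta>0 \<eta>0 \<in> borel_measurable P"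
    using integrable[of 1 0 \<theta>0 \<eta>0] \<theta>0 \<eta>0 by auto
  have I_var: "I = (\<integral>x. (efficient_score \<mu> lik H \<theta>0 \<eta>0 x - integral\<^sup>L P (efficient_score \<mu> lik H \<theta>0 \<eta>0))\<^sup>2 \<partial>P)"
    unfolding I_def efficient_information_def P ..
  note variance = positive_variance_AE_eq[OF meas10 mean10 least_favorable I[unfolded I_var], folded I_var]
  have mean20: "integral\<^sup>L P (?D 2 0 \<theta>0 \<theta>0 \<eta>0) = - I"
    using A4_information variance(2) by simp
  have mean11: "integral\<^sup>L P (?D 1 1 \<theta>0 \<theta>0 \<eta>0) = 0"
  proof (rule derivative_of_integral_eq[where f = "\<lambda>\<theta>. ?D 1 0 \<theta>0 \<theta> \<eta>0" and f' = "\<lambda>\<theta>. ?D 1 1 \<theta>0 \<theta> \<eta>0",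
        OF \<delta>(1) F11(1) _ _ _ A4_mean_derivative])
    show "AE x in P. \<forall>\<theta>\<in>ball \<theta>0 \<delta>. ((\<lambda>\<theta>. ?D 1 0 \<theta>0 \<theta> \<eta>0 x) has_real_derivative ?D 1 1 \<theta>0 \<theta> \<eta>0 x) (at \<theta>)
        \<and> \<bar>?D 1 1 \<theta>0 \<theta> \<eta>0 x\<bar> \<le> F11 x"
      using exist F11(2)
    proof eventually_elim
      fix x
      assume a: "\<forall>(t, \<theta>, \<eta>) \<in> param_nbhd \<Theta> H \<theta>0 \<eta>0 \<delta>1. ell_derivs_exist lik lfs t \<theta> \<eta> x"
        "\<forall>(t, \<theta>, \<eta>) \<in> param_nbhd \<Theta> H \<theta>0 \<eta>0 \<delta>1. \<bar>?D 1 1 t \<theta> \<eta> x\<bar> \<le> F11 x"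
      show "\<forall>\<theta>\<in>ball \<theta>0 \<delta>. ((\<lambda>\<theta>. ?D 1 0 \<theta>0 \<theta> \<eta>0 x) has_real_derivative ?D 1 1 \<theta>0 \<theta> \<eta>0 x) (at \<theta>)
        \<and> \<bar>?D 1 1 \<theta>0 \<theta> \<eta>0 x\<bar> \<le> F11 x"
      proof
        fix \<theta> assume "\<theta> \<in> ball \<theta>0 \<delta>"
        then have *: "(\<theta>0, \<theta>, \<eta>0) \<in> param_nbhd \<Theta> H \<theta>0 \<eta>0 \<delta>1" using base[OF _ \<eta>0] nbhd(1) by blast
        from bspec[OF a(1) this] have "(\<lambda>\<theta>'. ?D 1 0 \<theta>0 \<theta>' \<eta>0 x) field_differentiable at \<theta>"
          unfolding ell_derivs_exist_def by simp
        from ell_deriv_has_derivative(2)[OF this] bspec[OF a(2) *]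
        show "((\<lambda>\<theta>. ?D 1 0 \<theta>0 \<theta> \<eta>0 x) has_real_derivative ?D 1 1 \<theta>0 \<theta> \<eta>0 x) (at \<theta>)
            \<and> \<bar>?D 1 1 \<theta>0 \<theta> \<eta>0 x\<bar> \<le> F11 x" by simp
      qed
    qed
  qed (use integrable \<theta>0 \<eta>0 in auto)

  have pop: "population_conditions P lik lfs H \<theta>0 \<eta>0 \<delta> I C" if "max C20 (max C11 C10) \<le> C" for C
    unfolding population_conditions_def
  proof (intro ballI conjI)
    fix \<eta> assume \<eta>: "\<eta> \<in> H \<inter> ball \<eta>0 \<delta>"
    then have \<eta>3: "\<eta> \<in> H \<inter> ball \<eta>0 \<delta>3" using \<delta>(4) by auto
    have C: "C20 * norm (\<eta> - \<eta>0) \<le> C * norm (\<eta> - \<eta>0)" "C11 * norm (\<eta> - \<eta>0) \<le> C * norm (\<eta> - \<eta>0)"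
      "C10 * (norm (\<eta> - \<eta>0))\<^sup>2 \<le> C * (norm (\<eta> - \<eta>0))\<^sup>2"
      using that by (auto intro: mult_right_mono)
    show "integrable P (?D 1 0 \<theta>0 \<theta>0 \<eta>)" using integrable \<theta>0 \<eta> by auto
    show "\<bar>integral\<^sup>L P (?D 1 0 \<theta>0 \<theta>0 \<eta>)\<bar> \<le> C * (norm (\<eta> - \<eta>0))\<^sup>2" using L10[OF \<eta>3] C by linarith
    show "\<bar>integral\<^sup>L P (?D 1 1 \<theta>0 \<theta>0 \<eta>)\<bar> \<le> C * norm (\<eta> - \<eta>0)" using L11[OF \<eta>3] C mean11 by linarith
    show "\<bar>integral\<^sup>L P (?D 2 0 \<theta>0 \<theta>0 \<eta>) + I\<bar> \<le> C * norm (\<eta> - \<eta>0)" using L20[OF \<eta>3] C mean20 by linarith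
  qed

  have likely_regular: "\<exists>C0. \<forall>C\<ge>C0. likely M \<epsilon> (\<lambda>n \<omega>. regular_path P lik lfs \<Theta> H \<theta>0 \<eta>0 \<delta> F C n (X \<omega>))"
    if "0 < \<epsilon>" for \<epsilon>
  proof -
    have e: "0 < \<epsilon> / 5" using that by simp
    obtain CF where CF: "\<forall>C\<ge>CF. likely M (\<epsilon> / 5) (\<lambda>n \<omega>. emp_mean (X \<omega>) n F \<le> C)"
      using emp_mean_bounded_likely[OF sample F e] by blast
    obtain CA where CA: "\<forall>C\<ge>CA. likely M (\<epsilon> / 5) (\<lambda>n \<omega>. \<forall>f\<in>(\<lambda>(t, \<theta>, \<eta>). ?D 2 0 t \<theta> \<eta>) ` param_nbhd \<Theta> H \<theta>0 \<eta>0 \<delta>2.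
        \<bar>emp_process P (X \<omega>) n f\<bar> \<le> C)"
      using P_Donsker_likely_bounded[OF sample D20 e] by blast
    obtain CB where CB: "\<forall>C\<ge>CB. likely M (\<epsilon> / 5) (\<lambda>n \<omega>. \<forall>f\<in>(\<lambda>(t, \<theta>, \<eta>). ?D 1 1 t \<theta> \<eta>) ` param_nbhd \<Theta> H \<theta>0 \<eta>0 \<delta>2.
        \<bar>emp_process P (X \<omega>) n f\<bar> \<le> C)"
      using P_Donsker_likely_bounded[OF sample D11 e] by blast
    obtain CC where CC: "\<forall>C\<ge>CC. likely M (\<epsilon> / 5) (\<lambda>n \<omega>. \<forall>\<eta>\<in>H \<inter> ball \<eta>0 \<delta>3.
        \<bar>emp_process P (X \<omega>) n (\<lambda>x. ?D 1 0 \<theta>0 \<theta>0 \<eta> x - ?D 1 0 \<theta>0 \<theta>0 \<eta>0 x)\<bar> \<le> C * norm (\<eta> - \<eta>0))"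
      using O_P_uniformly_likely[OF M G10 norm_ge_zero e] by blast
    obtain CS where CS: "\<forall>C\<ge>CS. likely M (\<epsilon> / 5) (\<lambda>n \<omega>. \<bar>emp_mean (X \<omega>) n (?D 1 0 \<theta>0 \<theta>0 \<eta>0)\<bar> \<le> C / sqrt (real n))"
      using emp_mean_sqrt_n_likely[OF sample meas10 variance(1) mean10 e] by blast
    have R: "likely M 0 (\<lambda>n \<omega>. \<forall>i. regular_obs lik lfs (param_nbhd \<Theta> H \<theta>0 \<eta>0 \<delta>) F (X \<omega> i))"
      by (intro likely_AE[OF M] iid_sample_AE[OF sample reg]) simp
    have in2: "?D l m \<theta>0 \<theta>0 \<eta> \<in> (\<lambda>(t, \<theta>, \<eta>). ?D l m t \<theta> \<eta>) ` param_nbhd \<Theta> H \<theta>0 \<eta>0 \<delta>2"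
      if "\<eta> \<in> H \<inter> ball \<eta>0 \<delta>" for l m \<eta>
      using base[OF \<theta>0 that] nbhd(2) by (intro image_eqI[of _ _ "(\<theta>0, \<theta>0, \<eta>)"]) auto
    have in3: "\<eta> \<in> H \<inter> ball \<eta>0 \<delta>3" if "\<eta> \<in> H \<inter> ball \<eta>0 \<delta>" for \<eta> using that \<delta>(4) by auto
    show ?thesis
    proof (intro exI[of _ "Max {CF, CA, CB, CC, CS}"] allI impI)
      fix C assume "Max {CF, CA, CB, CC, CS} \<le> C"
      then have C: "CF \<le> C" "CA \<le> C" "CB \<le> C" "CC \<le> C" "CS \<le> C" by simp_all
      show "likely M \<epsilon> (\<lambda>n \<omega>. regular_path P lik lfs \<Theta> H \<theta>0 \<eta>0 \<delta> F C n (X \<omega>))"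
      proof (rule likely_mono[OF M likely_conj[OF M R likely_conj[OF M CF[rule_format, OF C(1)]
            likely_conj[OF M CA[rule_format, OF C(2)] likely_conj[OF M CB[rule_format, OF C(3)]
            likely_conj[OF M CC[rule_format, OF C(4)] CS[rule_format, OF C(5)]]]]]]])
        show "0 + (\<epsilon> / 5 + (\<epsilon> / 5 + (\<epsilon> / 5 + (\<epsilon> / 5 + \<epsilon> / 5)))) \<le> \<epsilon>" by simp
        show "\<forall>\<^sub>F n in sequentially. \<forall>\<omega>\<in>space M.
            (\<forall>i. regular_obs lik lfs (param_nbhd \<Theta> H \<theta>0 \<eta>0 \<delta>) F (X \<omega> i)) \<and> emp_mean (X \<omega>) n F \<le> C \<and>
            (\<forall>f\<in>(\<lambda>(t, \<theta>, \<eta>). ?D 2 0 t \<theta> \<eta>) ` param_nbhd \<Theta> H \<theta>0 \<eta>0 \<delta>2. \<bar>emp_process P (X \<omega>) n f\<bar> \<le> C) \<and>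
            (\<forall>f\<in>(\<lambda>(t, \<theta>, \<eta>). ?D 1 1 t \<theta> \<eta>) ` param_nbhd \<Theta> H \<theta>0 \<eta>0 \<delta>2. \<bar>emp_process P (X \<omega>) n f\<bar> \<le> C) \<and>
            (\<forall>\<eta>\<in>H \<inter> ball \<eta>0 \<delta>3.
              \<bar>emp_process P (X \<omega>) n (\<lambda>x. ?D 1 0 \<theta>0 \<theta>0 \<eta> x - ?D 1 0 \<theta>0 \<theta>0 \<eta>0 x)\<bar> \<le> C * norm (\<eta> - \<eta>0)) \<and>
            \<bar>emp_mean (X \<omega>) n (?D 1 0 \<theta>0 \<theta>0 \<eta>0)\<bar> \<le> C / sqrt (real n) \<longrightarrow>
            regular_path P lik lfs \<Theta> H \<theta>0 \<eta>0 \<delta> F C n (X \<omega>)"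
          unfolding regular_path_def
          by (intro always_eventually allI ballI impI conjI; elim conjE) (use bspec[OF _ in2] bspec[OF _ in3] in simp_all)
      qed
    qed
  qed

  \<comment> \<open>The maximum of the profile likelihood is positive almost surely because the likelihood at the
    true parameter is; hence \<open>\<Delta>\<^sub>n\<close> vanishes at the maximiser, which is therefore consistent.\<close>
  let ?pl = "\<lambda>n \<omega>. profile_lik lik H (X \<omega>) n"
  have \<theta>hat\<Theta>: "\<theta>hat n \<omega> \<in> \<Theta>" if "\<omega> \<in> space M" for n \<omega>
    using mle[OF that, of n] unfolding is_arg_max_def by auto
  have pl_max: "?pl n \<omega> \<theta> \<le> ?pl n \<omega> (\<theta>hat n \<omega>)" if "\<omega> \<in> space M" "\<theta> \<in> \<Theta>" for n \<omega> \<theta>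
  proof -
    have "\<eta>hat n \<theta> \<omega> \<in> H" using \<eta>hat[OF that(2,1), of n] unfolding is_arg_max_def by auto
    then show ?thesis
      using mle[OF that(1), of n] that(2) profile_lik_eq(1)[OF \<eta>hat[OF that(2,1)]]
        profile_lik_eq(1)[OF \<eta>hat[OF \<theta>hat\<Theta>[OF that(1)] that(1)]]
      unfolding is_arg_max_def by (auto simp: not_less)
  qed
  have pl_nonneg: "0 \<le> ?pl n \<omega> \<theta>" if "\<omega> \<in> space M" "\<theta> \<in> \<Theta>" for n \<omega> \<theta>
  proof -
    have "X \<omega> i \<in> space \<mu>" for i
      using measurable_space[OF iid_sampleD(2)[OF sample] that(1)] unfolding P model_law_def by simp
    then have "0 \<le> lik_n lik (X \<omega>) n \<theta> \<eta>0"
      using model that(2) true_param(2) unfolding semiparametric_model_def lik_n_def by (intro prod_nonneg) blast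
    also have "\<dots> \<le> ?pl n \<omega> \<theta>" by (rule profile_lik_eq(2)[OF \<eta>hat[OF that(2,1)] true_param(2)])
    finally show ?thesis .
  qed
  have pl_pos: "AE \<omega> in M. 0 < ?pl n \<omega> (\<theta>hat n \<omega>)" for n
    using iid_sample_AE[OF sample reg] AE_space
  proof eventually_elim
    fix \<omega> assume a: "\<forall>i. regular_obs lik lfs (param_nbhd \<Theta> H \<theta>0 \<eta>0 \<delta>) F (X \<omega> i)" and \<omega>: "\<omega> \<in> space M"
    have "0 < lik \<theta>0 (lfs \<theta>0 \<theta>0 \<eta>0) (X \<omega> i)" for i
      using bspec[OF a[rule_format, of i, unfolded regular_obs_def] base[OF \<theta>0 \<eta>0]]
      by (simp add: ell_derivs_exist_def)
    then have "0 < lik_n lik (X \<omega>) n \<theta>0 \<eta>0"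
      unfolding lik_n_def A2[OF true_param] by (intro prod_pos) simp
    also have "\<dots> \<le> ?pl n \<omega> \<theta>0" by (rule profile_lik_eq(2)[OF \<eta>hat[OF true_param(1) \<omega>] true_param(2)])
    also have "\<dots> \<le> ?pl n \<omega> (\<theta>hat n \<omega>)" by (rule pl_max[OF \<omega> true_param(1)])
    finally show "0 < ?pl n \<omega> (\<theta>hat n \<omega>)" .
  qed
  have "o_P_one M (\<lambda>n \<omega>. Delta_n lik H (X \<omega>) n (\<theta>hat n \<omega>) (\<theta>hat n \<omega>))"
    unfolding o_P_one_def
  proof (intro allI impI)
    fix e :: real assume e: "0 < e"
    have "outer_prob M {\<omega>\<in>space M. \<bar>Delta_n lik H (X \<omega>) n (\<theta>hat n \<omega>) (\<theta>hat n \<omega>)\<bar> > ereal e} = 0"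
      if "0 < n" for n
    proof -
      have "\<not> \<bar>Delta_n lik H (X \<omega>) n (\<theta>hat n \<omega>) (\<theta>hat n \<omega>)\<bar> > ereal e" if "0 < ?pl n \<omega> (\<theta>hat n \<omega>)" for \<omega>
        using that e \<open>0 < n\<close> unfolding Delta_n_def log_ereal_def by simp
      then have "AE \<omega> in M. \<not> \<bar>Delta_n lik H (X \<omega>) n (\<theta>hat n \<omega>) (\<theta>hat n \<omega>)\<bar> > ereal e"
        using pl_pos[of n] by (rule eventually_mono[rotated])
      from M.outer_prob_AE_zero[OF this] show ?thesis by (simp only: not_not)
    qed
    then show "(\<lambda>n. outer_prob M {\<omega>\<in>space M. \<bar>Delta_n lik H (X \<omega>) n (\<theta>hat n \<omega>) (\<theta>hat n \<omega>)\<bar> > ereal e}) \<longlonglongrightarrow> 0"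
      by (intro tendsto_eventually eventually_sequentiallyI[of 1]) simp
  qed
  then have \<theta>hat_cons: "o_P_one M (\<lambda>n \<omega>. ereal (\<theta>hat n \<omega> - \<theta>0))"
    using consistency[of \<theta>hat] \<theta>hat\<Theta> by blast

  obtain \<delta>\<rho> K where \<delta>\<rho>: "0 < \<delta>\<rho>" and K: "0 \<le> K" "\<forall>\<theta>. \<bar>\<theta> - \<theta>0\<bar> \<le> \<delta>\<rho> \<longrightarrow> \<bar>\<rho> \<theta> - \<rho> \<theta>0\<bar> \<le> K * \<bar>\<theta> - \<theta>0\<bar>"
  proof -
    obtain d \<rho>' where d: "0 < d" and \<rho>': "\<forall>\<theta> \<in> ball \<theta>0 d. (\<rho> has_real_derivative \<rho>' \<theta>) (at \<theta>)" "continuous_on (ball \<theta>0 d) \<rho>'"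
      using prior_smooth by blast
    from continuously_differentiable_imp_Lipschitz_at[OF d _ \<rho>'(2), of \<rho>] \<rho>'(1) d that[of "d / 2"]
    show ?thesis by auto
  qed
  have \<Theta>: "\<Theta> \<in> sets lebesgue" using A1(1) by (simp add: borel_compact)

  let ?post = "\<lambda>n \<omega>. posterior_profile lik H \<Theta> \<rho> (X \<omega>) n"
  let ?err = "\<lambda>n \<omega> \<xi>. \<bar>measure (?post n \<omega>) {\<theta> \<in> \<Theta>. sqrt (real n) * (\<theta> - \<theta>hat n \<omega>) * sqrt I \<le> \<xi>}
      - cdf std_normal_distribution \<xi>\<bar>"
  have "\<exists>A. likely M \<epsilon> (\<lambda>n \<omega>. \<bar>SUP \<xi>\<in>UNIV. ?err n \<omega> \<xi>\<bar> \<le> A * (1 / sqrt (real n)))" if "0 < \<epsilon>" for \<epsilon>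
  proof -
    have e: "0 < \<epsilon> / 4" using that by simp
    obtain Creg where Creg: "\<forall>C\<ge>Creg. likely M (\<epsilon> / 4) (\<lambda>n \<omega>. regular_path P lik lfs \<Theta> H \<theta>0 \<eta>0 \<delta> F C n (X \<omega>))"
      using likely_regular[OF e] by blast
    have "\<exists>C0. \<exists>\<delta>>0. \<forall>C\<ge>C0. likely M (\<epsilon> / 4) (\<lambda>n \<omega>. \<forall>\<theta>\<in>\<Theta>. \<bar>\<theta> - \<theta>0\<bar> < \<delta> \<longrightarrow>
        \<bar>norm (\<eta>hat n \<theta> \<omega> - \<eta>0)\<bar> \<le> C * (1 / sqrt (real n) + \<bar>\<theta> - \<theta>0\<bar>))"
      by (rule O_P_along_sequences_imp_uniform[OF M true_param(1) e _ A3]) auto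
    then obtain C\<eta> \<delta>\<eta> where \<delta>\<eta>: "0 < \<delta>\<eta>" and C\<eta>: "\<forall>C\<ge>C\<eta>. likely M (\<epsilon> / 4) (\<lambda>n \<omega>. \<forall>\<theta>\<in>\<Theta>. \<bar>\<theta> - \<theta>0\<bar> < \<delta>\<eta> \<longrightarrow>
        \<bar>norm (\<eta>hat n \<theta> \<omega> - \<eta>0)\<bar> \<le> C * (1 / sqrt (real n) + \<bar>\<theta> - \<theta>0\<bar>))"
      by blast
    define C where "C = Max {1, C20, C11, C10, Creg, C\<eta>}"
    have "1 \<le> C \<and> C20 \<le> C \<and> C11 \<le> C \<and> C10 \<le> C \<and> Creg \<le> C \<and> C\<eta> \<le> C" unfolding C_def by (simp add: le_max_iff_disj)
    then have C: "1 \<le> C" "max C20 (max C11 C10) \<le> C" "Creg \<le> C" "C\<eta> \<le> C" by simp_all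
    \<comment> \<open>The neighbourhoods shrink with \<open>\<epsilon>\<close>: the constants of the expansion depend on \<open>\<epsilon>\<close>, and the cubic
      remainder has to stay below the quadratic term.\<close>
    define \<delta>' where "\<delta>' = min (min \<delta>\<eta> \<delta>) (min (\<delta> / (2 * C)) (I / (176 * C ^ 3)))"
    have C3: "0 < C" "0 < C ^ 3" using C(1) by auto
    have \<delta>': "0 < \<delta>'" "\<delta>' \<le> \<delta>\<eta>" "\<delta>' \<le> \<delta>" "\<delta>' \<le> \<delta> / (2 * C)" "\<delta>' \<le> I / (176 * C ^ 3)"
      unfolding \<delta>'_def using \<delta>(1) \<delta>\<eta> C3 I by auto
    have \<delta>'C: "C * \<delta>' \<le> \<delta> / 2" "88 * C ^ 3 * \<delta>' \<le> I / 2"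
      using \<delta>'(4,5) C3 by (simp_all add: field_simps)
    define C2 where "C2 = 2 * (C + 88 * C ^ 3) / I"
    define C' where "C' = C2 + 44 * C ^ 3 * (1 + C2)\<^sup>2 + 792 * C ^ 3 * (1 + C2) ^ 3"
    have C2: "0 < C2" unfolding C2_def using C3 I by (simp add: add_pos_pos)
    have C': "0 < C'" unfolding C'_def using C2 C3 by (intro add_pos_nonneg) auto
    define \<delta>'' where "\<delta>'' = min (\<delta>' / 2) (min \<delta>\<rho> (I / (24 * C')))"
    have \<delta>'': "0 < \<delta>''" "\<delta>'' < \<delta>'" "\<delta>'' \<le> \<delta>\<rho>" "24 * C' * \<delta>'' \<le> I"
    proof -
      show "0 < \<delta>''" "\<delta>'' < \<delta>'" "\<delta>'' \<le> \<delta>\<rho>" unfolding \<delta>''_def using \<delta>'(1) \<delta>\<rho> I C' by auto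
      have "\<delta>'' \<le> I / (24 * C')" unfolding \<delta>''_def by simp
      then show "24 * C' * \<delta>'' \<le> I" using C' by (simp add: field_simps)
    qed
    have "\<exists>\<kappa>>0. likely M (\<epsilon> / 4) (\<lambda>n \<omega>. \<forall>\<theta>\<in>\<Theta>. \<delta>'' < \<bar>\<theta> - \<theta>0\<bar> \<longrightarrow>
        ?pl n \<omega> \<theta> \<le> exp (- \<kappa> * real n) * ?pl n \<omega> (\<theta>hat n \<omega>))"
      using \<theta>hat\<Theta> pl_max pl_pos consistency
      by (intro consistency_imp_separation[OF M e \<delta>''(1)]) (simp_all add: Delta_n_def)
    then obtain \<kappa> where \<kappa>: "0 < \<kappa>" and sep: "likely M (\<epsilon> / 4) (\<lambda>n \<omega>. \<forall>\<theta>\<in>\<Theta>. \<delta>'' < \<bar>\<theta> - \<theta>0\<bar> \<longrightarrow>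
        ?pl n \<omega> \<theta> \<le> exp (- \<kappa> * real n) * ?pl n \<omega> (\<theta>hat n \<omega>))"
      by blast
    have "\<forall>\<theta>. \<bar>\<theta> - \<theta>0\<bar> \<le> \<delta>'' \<longrightarrow> \<theta> \<in> \<Theta> \<and> \<bar>\<rho> \<theta> - \<rho> \<theta>0\<bar> \<le> K * \<bar>\<theta> - \<theta>0\<bar>"
    proof (intro allI impI conjI)
      fix \<theta> assume *: "\<bar>\<theta> - \<theta>0\<bar> \<le> \<delta>''"
      then have "\<theta> \<in> ball \<theta>0 \<delta>" using \<delta>''(2) \<delta>'(3) by (simp add: dist_real_def)
      then show "\<theta> \<in> \<Theta>" using ball by blast
      show "\<bar>\<rho> \<theta> - \<rho> \<theta>0\<bar> \<le> K * \<bar>\<theta> - \<theta>0\<bar>" using * K(2) \<delta>''(3) by simp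
    qed
    from nearly_gaussian_weight_imp_normal_posterior[OF \<Theta> I less_imp_le[OF C'] \<delta>''(1,4) \<kappa> prior K(1) this]
    obtain A where A: "\<forall>\<^sub>F n in sequentially. \<forall>m w \<xi>.
      nearly_gaussian_weight \<Theta> I C' \<delta>'' \<kappa> \<theta>0 n m w \<longrightarrow> w \<in> borel_measurable (lebesgue_on \<Theta>) \<longrightarrow>
      \<bar>measure (density (lebesgue_on \<Theta>) (\<lambda>\<theta>. ennreal (\<rho> \<theta> * w \<theta> / (\<integral>\<theta>'. \<rho> \<theta>' * w \<theta>' \<partial>lebesgue_on \<Theta>))))
        {\<theta> \<in> \<Theta>. sqrt (real n) * (\<theta> - m) * sqrt I \<le> \<xi>} - cdf std_normal_distribution \<xi>\<bar> \<le> A / sqrt (real n)"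
      by blast
    have "(\<lambda>n. C / sqrt (real n)) \<longlonglongrightarrow> 0" by real_asymp
    from order_tendstoD(2)[OF this, of "\<delta> / 2"] \<delta>(1)
    have evn: "\<forall>\<^sub>F n in sequentially. C / sqrt (real n) < \<delta> / 2" by simp
    \<comment> \<open>The event on which the analysis is carried out for each sample separately.\<close>
    let ?G = "\<lambda>n \<omega>. regular_path P lik lfs \<Theta> H \<theta>0 \<eta>0 \<delta> F C n (X \<omega>) \<and>
      (\<forall>\<theta>\<in>\<Theta>. \<bar>\<theta> - \<theta>0\<bar> < \<delta>\<eta> \<longrightarrow> \<bar>norm (\<eta>hat n \<theta> \<omega> - \<eta>0)\<bar> \<le> C * (1 / sqrt (real n) + \<bar>\<theta> - \<theta>0\<bar>)) \<and>
      (\<forall>\<theta>\<in>\<Theta>. \<delta>'' < \<bar>\<theta> - \<theta>0\<bar> \<longrightarrow> ?pl n \<omega> \<theta> \<le> exp (- \<kappa> * real n) * ?pl n \<omega> (\<theta>hat n \<omega>)) \<and>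
      \<bar>\<theta>hat n \<omega> - \<theta>0\<bar> \<le> \<delta>''"
    have likely_G: "likely M (\<epsilon> / 4 + (\<epsilon> / 4 + (\<epsilon> / 4 + \<epsilon> / 4))) ?G"
      using Creg C\<eta> C sep consistent_imp_likely[OF \<theta>hat_cons \<delta>''(1) e]
      by (intro likely_conj[OF M]) auto
    have "likely M \<epsilon> (\<lambda>n \<omega>. \<bar>SUP \<xi>\<in>UNIV. ?err n \<omega> \<xi>\<bar> \<le> A * (1 / sqrt (real n)))"
    proof (rule likely_mono[OF M likely_G])
      show "\<forall>\<^sub>F n in sequentially. \<forall>\<omega>\<in>space M. ?G n \<omega> \<longrightarrow> \<bar>SUP \<xi>\<in>UNIV. ?err n \<omega> \<xi>\<bar> \<le> A * (1 / sqrt (real n))"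
        using A evn eventually_gt_at_top[of 0]
      proof eventually_elim
        case (elim n)
        show ?case
        proof (intro ballI impI)
          fix \<omega> assume \<omega>: "\<omega> \<in> space M" and G: "?G n \<omega>"
          let ?m = "\<theta>hat n \<omega>"
          define w where "w \<theta> = ?pl n \<omega> \<theta> / ?pl n \<omega> ?m" for \<theta>
          have m: "\<bar>?m - \<theta>0\<bar> < \<delta>'" using G \<delta>''(2) by linarith
          have rate: "norm (\<eta>hat n \<theta> \<omega> - \<eta>0) \<le> C * (1 / sqrt n + \<bar>\<theta> - \<theta>0\<bar>)" if "\<bar>\<theta> - \<theta>0\<bar> < \<delta>'" for \<theta>
          proof -
            have "\<theta> \<in> \<Theta>" using that \<delta>'(3) ball by (auto simp: dist_real_def subset_iff)
            then show ?thesis using G that \<delta>'(2) by simp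
          qed
          have "C * (1 / sqrt n + \<delta>') = C / sqrt n + C * \<delta>'" by (simp add: algebra_simps)
          then have size: "C * (1 / sqrt n + \<delta>') \<le> \<delta>" using elim(2) \<delta>'C(1) by linarith
          note path = conjunct1[OF G]
          note expand = profile_likelihood_expansion[where d = "X \<omega>" and \<eta>h = "\<lambda>\<theta>. \<eta>hat n \<theta> \<omega>" and H = H and lfs = lfs,
              OF ball elim(3) C(1) true_param(2) pop[OF C(2)] path _ _ _ \<delta>'(3) size]
          let ?s = "emp_mean (X \<omega>) n (?D 1 0 \<theta>0 \<theta>0 \<eta>0)"
          have pos: "0 < ?pl n \<omega> \<theta>" if "\<bar>\<theta> - \<theta>0\<bar> < \<delta>'" for \<theta>
            by (rule expand(1)) (use \<eta>hat \<omega> A2 lfsH rate that in blast)+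
          have incr: "\<bar>(ln (?pl n \<omega> \<theta>) - ln (?pl n \<omega> ?m)) / n
              - (((\<theta> - \<theta>0) * ?s - I * (\<theta> - \<theta>0)\<^sup>2 / 2) - ((?m - \<theta>0) * ?s - I * (?m - \<theta>0)\<^sup>2 / 2))\<bar>
              \<le> 99 * C ^ 3 * ((1 / sqrt n + \<bar>\<theta> - \<theta>0\<bar>) + (1 / sqrt n + \<bar>?m - \<theta>0\<bar>)) ^ 3"
            if "\<bar>\<theta> - \<theta>0\<bar> < \<delta>'" for \<theta>
            by (rule expand(2)) (use \<eta>hat \<omega> A2 lfsH rate that m in blast)+
          have score: "\<bar>?s - I * (?m - \<theta>0)\<bar> \<le> 44 * C ^ 3 * (1 / sqrt n + \<bar>?m - \<theta>0\<bar>)\<^sup>2"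
            by (rule expand(3)) (use \<eta>hat \<omega> A2 lfsH rate m pl_max in blast)+
          have "nearly_gaussian_weight \<Theta> I C' \<delta>'' \<kappa> \<theta>0 n ?m w"
            unfolding C'_def C2_def w_def
          proof (rule expansion_imp_nearly_gaussian_weight[OF elim(3) I C(1) _ \<delta>''(2) \<delta>'C(2) m score
                pos incr])
            show "\<bar>emp_mean (X \<omega>) n (?D 1 0 \<theta>0 \<theta>0 \<eta>0)\<bar> \<le> C / sqrt n"
              using path unfolding regular_path_def by blast
          qed (use G pl_max[OF \<omega>] pl_nonneg[OF \<omega>] in auto)
          moreover have "w \<in> borel_measurable (lebesgue_on \<Theta>)"
            unfolding w_def using profile_measurable[OF \<omega>] by simp
          moreover have "?post n \<omega> = density (lebesgue_on \<Theta>) (\<lambda>\<theta>. ennreal (\<rho> \<theta> * w \<theta> / (\<integral>\<theta>'. \<rho> \<theta>' * w \<theta>' \<partial>lebesgue_on \<Theta>)))"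
            unfolding w_def by (rule posterior_profile_rescale[OF pos[OF m]])
          ultimately have err: "?err n \<omega> \<xi> \<le> A / sqrt n" for \<xi>
            using elim(1) by simp
          \<comment> \<open>The bound \<open>err\<close> also makes the set of errors bounded above, so that the supremum is a
            genuine one and dominates the nonnegative error at \<open>0\<close>.\<close>
          have "(SUP \<xi>\<in>UNIV. ?err n \<omega> \<xi>) \<le> A / sqrt n" by (rule cSUP_least[OF UNIV_not_empty err])
          moreover have "?err n \<omega> 0 \<le> (SUP \<xi>\<in>UNIV. ?err n \<omega> \<xi>)"
            using err by (intro cSUP_upper bdd_aboveI2) auto
          ultimately show "\<bar>SUP \<xi>\<in>UNIV. ?err n \<omega> \<xi>\<bar> \<le> A * (1 / sqrt (real n))" by simp
        qed
      qed
    qed simp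
    then show ?thesis ..
  qed
  then show ?thesis
    unfolding O_P_def likely_def I_def by (simp only: not_le) blast
qed

end
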